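(* Over an algebraically closed field of characteristic $2$, every square matrix is congruent to a direct sum, determined uniquely up to permutation of summands, of matrices of the form: (i) $J_n(0)$; (ii) $\begin{bmatrix}0&I_n\\ J_n(\lambda)&0\end{bmatrix}$, in which $\lambda$ is nonzero and is determined up to replacement by $\lambda^{-1}$; (iii) $\sqrt[T]{J_{n}(1)}$ with odd $n$; no blocks of the form $\begin{bmatrix}0&I_n\\ J_n(1)&0\end{bmatrix}$ are permitted for any odd $n$ for which a block $\sqrt[T]{J_{n}(1)}$ occurs in the direct sum. Instead of the matrix (iii), one may use $\Gamma'_n$ or any other nonsingular matrix whose cosquare is similar to $J_n(1)$; these matrices are congruent to (iii).
   Context: Matrices $A,B$ are congruent if $S^TAS=B$ for some nonsingular $S$. $J_n(\lambda)$ is the $n\times n$ upper triangular Jordan block with eigenvalue $\lambda$. The cosquare of a nonsingular matrix $A$ is $A^{-T}A$; if $\Phi$ is a cosquare, $\sqrt[T]{\Phi}$ denotes any fixed chosen matrix $C$ with $C^{-T}C=\Phi$. For odd $n$, $\Gamma'_n$ is the $n\times n$ matrix whose $(i,n+1-i)$ entry is $1$ for all $i$, whose $(i,n+2-i)$ entry is $1$ for $i>(n+1)/2$ and $0$ for $2\le i\le (n+1)/2$, and all other entries are $0$. (If the direct sum would otherwise contain both $\sqrt[T]{J_{n}(1)}$ and $\begin{bmatrix}0&I_n\\ J_n(1)&0\end{bmatrix}$ for the same odd $n$, this pair is replaced by three blocks $\sqrt[T]{J_{n}(1)}$, since these are congruent.) *)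

theory Defs
  imports "HOL-Computational_Algebra.Polynomial" "Jordan_Normal_Form.Jordan_Normal_Form"
begin

definition congruent_mat :: "'a :: comm_ring_1 mat \<Rightarrow> 'a mat \<Rightarrow> bool" where
  "congruent_mat A B \<longleftrightarrow> A \<in> carrier_mat (dim_row A) (dim_row A) \<and>
     (\<exists>S. S \<in> carrier_mat (dim_row A) (dim_row A) \<and> invertible_mat S \<and>
          transpose_mat S * A * S = B)"

definition mat_inv :: "'a :: comm_ring_1 mat \<Rightarrow> 'a mat" where
  "mat_inv A = (SOME B. inverts_mat A B \<and> inverts_mat B A)"

definition cosquare :: "'a :: comm_ring_1 mat \<Rightarrow> 'a mat" where
  "cosquare A = mat_inv (transpose_mat A) * A"

definition Gamma' :: "nat \<Rightarrow> 'a :: {zero,one} mat" where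
  "Gamma' n = mat n n (\<lambda>(i,j). let i1 = i + 1; j1 = j + 1 in
      if j1 = n + 1 - i1 then 1
      else if (n + 1) div 2 < i1 \<and> j1 = n + 2 - i1 then 1 else 0)"

(* Canonical block types:
   BJ0 n        ~ J_n(0)
   BPair n lam  ~ [0 I_n; J_n(lam) 0]
   BRoot n      ~ the chosen matrix for (iii), of size n (n odd) *)
datatype 'a cblock = BJ0 nat | BPair nat 'a | BRoot nat

fun block_mat :: "(nat \<Rightarrow> 'a :: comm_ring_1 mat) \<Rightarrow> 'a cblock \<Rightarrow> 'a mat" where
  "block_mat R (BJ0 n) = jordan_block n 0"
| "block_mat R (BPair n lam) = four_block_mat (0\<^sub>m n n) (1\<^sub>m n) (jordan_block n lam) (0\<^sub>m n n)"
| "block_mat R (BRoot n) = R n"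

definition direct_sum :: "(nat \<Rightarrow> 'a :: comm_ring_1 mat) \<Rightarrow> 'a cblock list \<Rightarrow> 'a mat" where
  "direct_sum R bs = diag_block_mat (map (block_mat R) bs)"

fun block_ok :: "'a :: field cblock \<Rightarrow> bool" where
  "block_ok (BJ0 n) \<longleftrightarrow> n \<ge> 1"
| "block_ok (BPair n lam) \<longleftrightarrow> n \<ge> 1 \<and> lam \<noteq> 0"
| "block_ok (BRoot n) \<longleftrightarrow> odd n"

definition admissible :: "'a :: field cblock list \<Rightarrow> bool" where
  "admissible bs \<longleftrightarrow> (\<forall>b \<in> set bs. block_ok b) \<and>
     (\<forall>n. odd n \<and> BRoot n \<in> set bs \<longrightarrow> BPair n 1 \<notin> set bs)"

fun block_equiv :: "'a :: field cblock \<Rightarrow> 'a cblock \<Rightarrow> bool" where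
  "block_equiv (BPair n lam) (BPair m mu) \<longleftrightarrow> n = m \<and> (mu = lam \<or> mu = inverse lam)"
| "block_equiv b c \<longleftrightarrow> b = c"

definition valid_root_choice :: "(nat \<Rightarrow> 'a :: field mat) \<Rightarrow> bool" where
  "valid_root_choice R \<longleftrightarrow> (\<forall>n. odd n \<longrightarrow>
     R n \<in> carrier_mat n n \<and> invertible_mat (R n) \<and> similar_mat (cosquare (R n)) (jordan_block n 1))"

end

theory Submission
  imports Defs "HOL-Computational_Algebra.Formal_Power_Series"
begin

text \<open>
  A bilinear form with Gram matrix \<open>A\<close> is decomposed by splitting off one block at a time. Everything is
  expressed by chains \<open>x\<^sub>1, \<dots>, x\<^sub>k\<close> with \<open>(A - l A\<^sup>T) x\<^sub>j\<^sub>+\<^sub>1 = A\<^sup>T x\<^sub>j\<close>, that is \<open>A X = A\<^sup>T X J\<^sub>k(l)\<close>. A chain of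
  extremal length has, by the Fredholm alternative, a dual chain pairing perfectly with it, and the span of
  the two has an orthogonal complement. This yields \<open>J\<^sub>2\<^sub>k\<^sub>-\<^sub>1(0)\<close> from the singular chains of the pencil,
  \<open>J\<^sub>2\<^sub>k(0)\<close> from \<open>l = 0\<close>, and \<open>[0 I; J\<^sub>k(l) 0]\<close> from \<open>l \<noteq> 0, 1\<close>, where isotropy is automatic. For \<open>l = 1\<close> in
  characteristic 2 the Gram matrix of a chain is supported on and below the antidiagonal, its odd
  antidiagonals vanish as soon as the preceding ones do, and the even ones can be corrected successively by a
  Hensel argument; this gives isotropic pairs, and also the congruence of all matrices with cosquare \<open>J\<^sub>n(1)\<close>.

  For uniqueness, the dimensions of the spaces of end points of chains are additive invariants that
  determine everything except the choice between two blocks with cosquare \<open>J\<^sub>n(1)\<close> and one block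
  \<open>[0 I; J\<^sub>n(1) 0]\<close>; this is decided by whether some chain of length \<open>n\<close> for \<open>l = 1\<close> has
  \<open>x\<^sub>1\<^sup>T A x\<^sub>n \<noteq> 0\<close>.
\<close>

section \<open>Congruence and direct sums\<close>

text \<open>In characteristic 2 a Gram matrix cannot be corrected by halving it, and this shapes the
  treatment of l = 1. Adding a times a shift of y to a chain x changes the Gram matrix of x by a
  trace part, linear in a, and by a * a times a shifted Gram matrix of y. On the antidiagonal where
  the trace part would be expected to begin, its two terms are equal and cancel; it survives one
  antidiagonal later, with the leading pairing of x and y as its value. The correction there is a
  quadratic equation for a whose linear coefficient is nonzero, and an algebraically closed field
  solves it. The nilpotent blocks have to go in a fixed order, because the length of chains for l =
  0 is bounded only in the absence of singular chains. In the uniqueness proof a pair at l = 1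
  contributes to the dimensions as much as two root blocks of its size, so they determine only 2 p +
  r for p pairs and r roots. Admissibility forbids that p and r are both nonzero, and therefore the
  single bit whether r is zero is enough.\<close>

lemma invertible_mat_iff:
  assumes "A \<in> carrier_mat n n"
  shows "invertible_mat A \<longleftrightarrow> (\<exists>B \<in> carrier_mat n n. A * B = 1\<^sub>m n \<and> B * A = 1\<^sub>m n)"
proof
  assume "invertible_mat A"
  then obtain B where B: "A * B = 1\<^sub>m (dim_row A)" "B * A = 1\<^sub>m (dim_row B)"
    unfolding invertible_mat_def inverts_mat_def by auto
  have "dim_col B = n" using arg_cong[OF B(1), of dim_col] assms by simp
  moreover have "dim_row B = n" using arg_cong[OF B(2), of dim_col] assms by simp
  ultimately show "\<exists>B \<in> carrier_mat n n. A * B = 1\<^sub>m n \<and> B * A = 1\<^sub>m n" using B assms by auto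
next
  assume "\<exists>B \<in> carrier_mat n n. A * B = 1\<^sub>m n \<and> B * A = 1\<^sub>m n"
  then show "invertible_mat A"
    using assms unfolding invertible_mat_def inverts_mat_def by auto
qed

lemma invertible_mat_iff_det:
  fixes A :: "'a :: field mat"
  assumes A: "A \<in> carrier_mat n n"
  shows "invertible_mat A \<longleftrightarrow> det A \<noteq> 0"
proof
  assume "invertible_mat A"
  then obtain B where B: "B \<in> carrier_mat n n" "A * B = 1\<^sub>m n"
    using invertible_mat_iff[OF A] by auto
  have "det A * det B = 1" using det_mult[OF A B(1)] B(2) by simp
  then show "det A \<noteq> 0" by auto
next
  assume "det A \<noteq> 0"
  from det_non_zero_imp_unit[OF A this, of "()"] show "invertible_mat A"
    unfolding invertible_mat_iff[OF A] Units_def by (auto simp: ring_mat_def)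
qed

lemma invertible_mat_if_inj:
  fixes A :: "'a :: field mat"
  assumes A: "A \<in> carrier_mat n n"
    and inj: "\<And>v. v \<in> carrier_vec n \<Longrightarrow> A *\<^sub>v v = 0\<^sub>v n \<Longrightarrow> v = 0\<^sub>v n"
  shows "invertible_mat A"
  using inj unfolding invertible_mat_iff_det[OF A] det_0_iff_vec_prod_zero_field[OF A] by auto

lemma invertible_mat_mult:
  fixes A :: "'a :: field mat"
  assumes "A \<in> carrier_mat n n" "B \<in> carrier_mat n n"
  shows "invertible_mat (A * B) \<longleftrightarrow> invertible_mat A \<and> invertible_mat B"
  using assms by (simp add: invertible_mat_iff_det[of _ n] det_mult[of _ n])

lemma invertible_mat_transpose:
  fixes A :: "'a :: field mat"
  assumes "A \<in> carrier_mat n n"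
  shows "invertible_mat (transpose_mat A) \<longleftrightarrow> invertible_mat A"
  using assms by (simp add: invertible_mat_iff_det[of _ n] det_transpose)

lemma congruent_matI:
  assumes "A \<in> carrier_mat n n" "S \<in> carrier_mat n n" "invertible_mat S" "transpose_mat S * A * S = B"
  shows "congruent_mat A B"
  using assms unfolding congruent_mat_def by auto

lemma congruent_matE:
  assumes "congruent_mat A B" "A \<in> carrier_mat n n"
  obtains S where "S \<in> carrier_mat n n" "invertible_mat S" "B = transpose_mat S * A * S" "B \<in> carrier_mat n n"
  using assms unfolding congruent_mat_def by auto

lemma congruent_mat_square: "congruent_mat A B \<Longrightarrow> A \<in> carrier_mat (dim_row A) (dim_row A)"
  unfolding congruent_mat_def by auto

lemma congruent_mat_refl: "A \<in> carrier_mat n n \<Longrightarrow> congruent_mat (A :: 'a :: field mat) A"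
  by (rule congruent_matI[of _ n "1\<^sub>m n"]) (auto simp: invertible_mat_iff_det[of _ n])

lemma congruent_mat_trans:
  fixes A :: "'a :: field mat"
  assumes AB: "congruent_mat A B" and BC: "congruent_mat B C"
  shows "congruent_mat A C"
proof -
  define n where "n = dim_row A"
  have A: "A \<in> carrier_mat n n" unfolding n_def by (rule congruent_mat_square[OF AB])
  obtain S where S: "S \<in> carrier_mat n n" "invertible_mat S"
    "B = transpose_mat S * A * S" and B: "B \<in> carrier_mat n n" by (rule congruent_matE[OF AB A])
  obtain T where T: "T \<in> carrier_mat n n" "invertible_mat T"
    "C = transpose_mat T * B * T" "C \<in> carrier_mat n n" by (rule congruent_matE[OF BC B])
  have "transpose_mat (S * T) * A * (S * T) = C"
    unfolding T(3) S(3) using S(1) T(1) A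
    by (simp add: transpose_mult[of _ n n _ n] assoc_mult_mat[of _ n n _ n _ n])
  then show ?thesis
    using S T A by (intro congruent_matI[of A n "S * T"]) (auto simp: invertible_mat_mult[of _ n])
qed

lemma congruent_mat_sym:
  fixes A :: "'a :: field mat"
  assumes AB: "congruent_mat A B"
  shows "congruent_mat B A"
proof -
  define n where "n = dim_row A"
  have A: "A \<in> carrier_mat n n" unfolding n_def by (rule congruent_mat_square[OF AB])
  obtain S where S: "S \<in> carrier_mat n n" "invertible_mat S"
    "B = transpose_mat S * A * S" and B: "B \<in> carrier_mat n n" by (rule congruent_matE[OF AB A])
  from S obtain T where T: "T \<in> carrier_mat n n" "S * T = 1\<^sub>m n" "T * S = 1\<^sub>m n"
    using invertible_mat_iff[of S n] by auto
  have TS: "transpose_mat T * transpose_mat S = 1\<^sub>m n"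
    using transpose_mult[of S n n T n] S T by simp
  have "transpose_mat T * B * T = (transpose_mat T * transpose_mat S) * A * (S * T)"
    unfolding S(3) using S(1) T(1) A by (simp add: assoc_mult_mat[of _ n n _ n _ n])
  also have "\<dots> = A" using TS T A by simp
  finally show ?thesis
    using B T S(1) by (intro congruent_matI[of B n T]) (auto simp: invertible_mat_iff[of T n])
qed

lemma congruent_mat_invertible:
  fixes A :: "'a :: field mat"
  assumes "congruent_mat A B" "A \<in> carrier_mat n n"
  shows "invertible_mat A \<longleftrightarrow> invertible_mat B"
  using assms by (elim congruent_matE) (auto simp: invertible_mat_mult[of _ n] invertible_mat_transpose[of _ n])

section \<open>Block diagonal sums and the order of their summands\<close>

definition dsum :: "'a :: zero mat \<Rightarrow> 'a mat \<Rightarrow> 'a mat" where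
  "dsum A B = four_block_mat A (0\<^sub>m (dim_row A) (dim_col B)) (0\<^sub>m (dim_row B) (dim_col A)) B"

lemma dsum_carrier [simp]:
  "A \<in> carrier_mat a c \<Longrightarrow> B \<in> carrier_mat b d \<Longrightarrow> dsum A B \<in> carrier_mat (a + b) (c + d)"
  unfolding dsum_def by auto

lemma dim_dsum [simp]:
  "dim_row (dsum A B) = dim_row A + dim_row B" "dim_col (dsum A B) = dim_col A + dim_col B"
  unfolding dsum_def by auto

lemma dsum_mult:
  fixes A :: "'a :: comm_ring_1 mat"
  assumes "A \<in> carrier_mat a a'" "B \<in> carrier_mat b b'" "C \<in> carrier_mat a' a''" "D \<in> carrier_mat b' b''"
  shows "dsum A B * dsum C D = dsum (A * C) (B * D)"
  using assms unfolding dsum_def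
  by (subst mult_four_block_mat[of _ a a' _ b' _ b _ _ a'' _ b'']) auto

lemma transpose_dsum:
  "transpose_mat (dsum A B) = dsum (transpose_mat A) (transpose_mat B)"
  unfolding dsum_def by (subst transpose_four_block_mat) auto

lemma det_dsum:
  fixes A :: "'a :: field mat"
  assumes "A \<in> carrier_mat a a" "B \<in> carrier_mat b b"
  shows "det (dsum A B) = det A * det B"
  unfolding dsum_def using assms by (subst det_four_block_mat_lower_left_zero[of A a _ b]) auto

lemma invertible_mat_dsum:
  fixes A :: "'a :: field mat"
  assumes "A \<in> carrier_mat a a" "B \<in> carrier_mat b b"
  shows "invertible_mat (dsum A B) \<longleftrightarrow> invertible_mat A \<and> invertible_mat B"
  using assms invertible_mat_iff_det[OF dsum_carrier[OF assms]]
  by (simp add: invertible_mat_iff_det[of _ a] invertible_mat_iff_det[of _ b] det_dsum)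

lemma congruent_mat_dsum:
  fixes A :: "'a :: field mat"
  assumes AA: "congruent_mat A A'" and BB: "congruent_mat B B'"
  shows "congruent_mat (dsum A B) (dsum A' B')"
proof -
  define a where "a = dim_row A"
  define b where "b = dim_row B"
  have A: "A \<in> carrier_mat a a" unfolding a_def by (rule congruent_mat_square[OF AA])
  have B: "B \<in> carrier_mat b b" unfolding b_def by (rule congruent_mat_square[OF BB])
  obtain S where S: "S \<in> carrier_mat a a" "invertible_mat S"
    "A' = transpose_mat S * A * S" "A' \<in> carrier_mat a a" by (rule congruent_matE[OF AA A])
  obtain T where T: "T \<in> carrier_mat b b" "invertible_mat T"
    "B' = transpose_mat T * B * T" "B' \<in> carrier_mat b b" by (rule congruent_matE[OF BB B])
  show ?thesis
    using A B S T
    by (intro congruent_matI[of _ "a + b" "dsum S T"])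
      (auto simp: invertible_mat_dsum[of _ a _ b] transpose_dsum dsum_mult[of _ a a _ b b _ a _ b])
qed

lemma congruent_mat_dsum_commute:
  fixes A :: "'a :: field mat"
  assumes A: "A \<in> carrier_mat a a" and B: "B \<in> carrier_mat b b"
  shows "congruent_mat (dsum A B) (dsum B A)"
proof -
  \<comment> \<open>The swap of the two groups of coordinates; \<open>?T\<close> is its transpose as
    well as its inverse.\<close>
  let ?S = "four_block_mat (0\<^sub>m a b) (1\<^sub>m a) (1\<^sub>m b) (0\<^sub>m b a) :: 'a mat"
  let ?T = "four_block_mat (0\<^sub>m b a) (1\<^sub>m b) (1\<^sub>m a) (0\<^sub>m a b) :: 'a mat"
  have S: "?S \<in> carrier_mat (a + b) (a + b)"
  proof (rule carrier_matI) qed auto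
  have T: "?T \<in> carrier_mat (a + b) (a + b)"
  proof (rule carrier_matI) qed auto
  have tr: "transpose_mat ?S = ?T"
    by (subst transpose_four_block_mat[of _ a b _ a _ b]) auto
  have ST: "?T * ?S = 1\<^sub>m (b + a)"
    by (subst mult_four_block_mat[of _ b a _ b _ a _ _ b _ a]) auto
  have TS: "?S * ?T = 1\<^sub>m (a + b)"
    by (subst mult_four_block_mat[of _ a b _ a _ b _ _ a _ b]) auto
  have inv: "invertible_mat ?S"
    unfolding invertible_mat_iff[OF S] using T ST TS by (auto simp: add.commute)
  have "?T * dsum A B * ?S = dsum B A"
    unfolding dsum_def using A B
    by (simp add: mult_four_block_mat[of _ b a _ b _ a _ _ a _ b]
        mult_four_block_mat[of _ b a _ b _ a _ _ b _ a])
  then show ?thesis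
    using S A B inv tr by (intro congruent_matI[of _ "a + b" ?S]) auto
qed

lemma dsum_assoc: "dsum A (dsum B C) = dsum (dsum A B) C"
  using assoc_four_block_mat[of A B C] unfolding dsum_def by simp

lemma direct_sum_Nil [simp]: "direct_sum R [] = 0\<^sub>m 0 0"
  unfolding direct_sum_def by simp

lemma direct_sum_Cons: "direct_sum R (b # bs) = dsum (block_mat R b) (direct_sum R bs)"
  unfolding direct_sum_def dsum_def by (simp add: Let_def)

lemma direct_sum_append: "direct_sum R (bs @ cs) = dsum (direct_sum R bs) (direct_sum R cs)"
  unfolding direct_sum_def dsum_def by (simp add: diag_block_mat_append Let_def)

lemma direct_sum_single [simp]: "direct_sum R [b] = block_mat R b"
  unfolding direct_sum_def by (simp only: list.map diag_block_mat_singleton)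

fun block_size :: "'a cblock \<Rightarrow> nat" where
  "block_size (BJ0 n) = n"
| "block_size (BPair n lam) = 2 * n"
| "block_size (BRoot n) = n"

lemma block_mat_carrier:
  assumes "valid_root_choice R" "block_ok b"
  shows "block_mat R b \<in> carrier_mat (block_size b) (block_size b)"
  using assms
  by (cases b) (auto simp: valid_root_choice_def four_block_carrier_mat mult_2 jordan_block_def)

lemma direct_sum_carrier:
  assumes "valid_root_choice R" "\<forall>b \<in> set bs. block_ok b"
  shows "direct_sum R bs \<in> carrier_mat (sum_list (map block_size bs)) (sum_list (map block_size bs))"
  using assms(2) by (induct bs) (auto simp: direct_sum_Cons intro!: dsum_carrier block_mat_carrier assms(1))

text \<open>The head of the first list is moved behind the prefix \<open>us\<close> that precedes it
  in the second list, which is a single commutation once the sums are reassociated.\<close>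

lemma congruent_direct_sum_perm:
  fixes R :: "nat \<Rightarrow> 'a :: field mat"
  assumes R: "valid_root_choice R" and ok: "\<forall>b \<in> set bs. block_ok b" and eq: "mset bs = mset cs"
  shows "congruent_mat (direct_sum R bs) (direct_sum R cs)"
  using ok eq
proof (induct bs arbitrary: cs)
  case Nil
  then show ?case by (auto intro!: congruent_mat_refl[of _ 0])
next
  case (Cons b bs)
  have "b \<in> set cs" using Cons.prems(2) by (metis list.set_intros(1) set_mset_mset)
  then obtain us vs where cs: "cs = us @ b # vs" by (meson split_list)
  have m: "mset bs = mset (us @ vs)" using Cons.prems(2) cs by simp
  have okb: "block_ok b" and okbs: "\<forall>b \<in> set bs. block_ok b" using Cons.prems by auto
  have okc: "\<forall>b \<in> set (us @ vs). block_ok b" using okbs m by (metis set_mset_mset)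
  let ?B = "block_mat R b"
  let ?U = "direct_sum R us"
  let ?V = "direct_sum R vs"
  note B = block_mat_carrier[OF R okb]
  have U: "?U \<in> carrier_mat (sum_list (map block_size us)) (sum_list (map block_size us))"
    and V: "?V \<in> carrier_mat (sum_list (map block_size vs)) (sum_list (map block_size vs))"
    using okc by (auto intro!: direct_sum_carrier[OF R])
  have "congruent_mat (dsum ?B (direct_sum R bs)) (dsum ?B (dsum ?U ?V))"
    using Cons.hyps[OF okbs m]
    by (intro congruent_mat_dsum congruent_mat_refl[OF B]) (simp add: direct_sum_append)
  also have "dsum ?B (dsum ?U ?V) = dsum (dsum ?B ?U) ?V" by (rule dsum_assoc)
  finally have 1: "congruent_mat (dsum ?B (direct_sum R bs)) (dsum (dsum ?B ?U) ?V)" .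
  have 2: "congruent_mat (dsum (dsum ?B ?U) ?V) (dsum (dsum ?U ?B) ?V)"
    by (intro congruent_mat_dsum congruent_mat_dsum_commute[OF B U] congruent_mat_refl[OF V])
  show ?case
    using congruent_mat_trans[OF 1 2] unfolding cs
    by (simp add: direct_sum_append direct_sum_Cons dsum_assoc)
qed

text \<open>Vectors are functions on \<open>nat\<close> of which only the first \<open>dim_row A\<close> values matter; this avoids
  carrier conditions on vectors and makes restriction to a summand the identity.\<close>

definition bf :: "'a :: comm_ring_1 mat \<Rightarrow> (nat \<Rightarrow> 'a) \<Rightarrow> (nat \<Rightarrow> 'a) \<Rightarrow> 'a" where
  "bf A x y = (\<Sum>i<dim_row A. \<Sum>j<dim_row A. x i * A $$ (i,j) * y j)"

lemma bf_add_left: "bf A (\<lambda>i. x i + c * y i) w = bf A x w + c * bf A y w"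
  unfolding bf_def by (simp add: algebra_simps sum.distrib sum_distrib_left)

lemma bf_add_right: "bf A w (\<lambda>i. x i + c * y i) = bf A w x + c * bf A w y"
  unfolding bf_def by (simp add: algebra_simps sum.distrib sum_distrib_left)

lemma bf_plus_left: "bf A (\<lambda>i. x i + y i) w = bf A x w + bf A y w"
  using bf_add_left[of A x 1 y w] by simp

lemma bf_zero_left [simp]: "bf A (\<lambda>_. 0) w = 0"
  unfolding bf_def by simp

lemma bf_zero_right [simp]: "bf A w (\<lambda>_. 0) = 0"
  unfolding bf_def by simp

lemma bf_smult_left: "bf A (\<lambda>i. c * x i) w = c * bf A x w"
  using bf_add_left[of A "\<lambda>_. 0" c x w] by simp

lemma bf_smult_right: "bf A w (\<lambda>i. c * x i) = c * bf A w x"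
  using bf_add_right[of A w "\<lambda>_. 0" c x] by simp

lemma bf_sum_left: "bf A (\<lambda>i. \<Sum>s\<in>F. c s * x s i) w = (\<Sum>s\<in>F. c s * bf A (x s) w)"
proof (induct F rule: infinite_finite_induct)
  case (insert s F)
  then show ?case by (simp add: add.commute[of "c s * _"] bf_add_left)
qed auto

lemma bf_sum_right: "bf A w (\<lambda>i. \<Sum>s\<in>F. c s * x s i) = (\<Sum>s\<in>F. c s * bf A w (x s))"
proof (induct F rule: infinite_finite_induct)
  case (insert s F)
  then show ?case by (simp add: add.commute[of "c s * _"] bf_add_right)
qed auto

lemma bf_cong:
  assumes "\<And>i. i < dim_row A \<Longrightarrow> x i = x' i" "\<And>i. i < dim_row A \<Longrightarrow> y i = y' i"
  shows "bf A x y = bf A x' y'"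
  unfolding bf_def using assms by (intro sum.cong) auto

definition ue :: "nat \<Rightarrow> nat \<Rightarrow> 'a :: comm_ring_1" where
  "ue l = (\<lambda>i. if i = l then 1 else 0)"

lemma bf_expand_left: "bf A w v = (\<Sum>l<dim_row A. w l * bf A (ue l) v)"
proof -
  have "bf A w v = bf A (\<lambda>i. \<Sum>l<dim_row A. w l * ue l i) v"
    by (rule bf_cong) (auto simp: ue_def if_distrib sum.delta' cong: if_cong)
  then show ?thesis by (simp add: bf_sum_left)
qed

lemma bf_expand_right: "bf A v w = (\<Sum>l<dim_row A. w l * bf A v (ue l))"
proof -
  have "bf A v w = bf A v (\<lambda>i. \<Sum>l<dim_row A. w l * ue l i)"
    by (rule bf_cong) (auto simp: ue_def if_distrib sum.delta' cong: if_cong)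
  then show ?thesis by (simp add: bf_sum_right)
qed

lemma bf_ue_ue:
  assumes "i < dim_row A" "j < dim_row A"
  shows "bf A (ue i) (ue j) = A $$ (i,j)"
proof -
  have "bf A (ue i) (ue j) = (\<Sum>a<dim_row A. if i = a then (\<Sum>b<dim_row A. if j = b then A $$ (a,b) else 0) else 0)"
    unfolding bf_def ue_def by (intro sum.cong refl) (auto simp: if_distrib cong: if_cong)
  then show ?thesis using assms by simp
qed

lemma mult_mat_vec_index_bf:
  assumes "A \<in> carrier_mat m m" "v \<in> carrier_vec m" "i < m"
  shows "(A *\<^sub>v v) $ i = bf A (ue i) (\<lambda>j. v $ j)"
proof -
  have "(A *\<^sub>v v) $ i = (\<Sum>j<m. A $$ (i,j) * v $ j)"
    using assms by (simp add: scalar_prod_def lessThan_atLeast0)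
  also have "\<dots> = (\<Sum>j<m. v $ j * bf A (ue i) (ue j))"
    using assms by (intro sum.cong) (auto simp: bf_ue_ue)
  also have "\<dots> = bf A (ue i) (\<lambda>j. v $ j)"
    using assms bf_expand_right[of A "ue i" "\<lambda>j. v $ j"] by simp
  finally show ?thesis .
qed

lemma bf_transpose: "A \<in> carrier_mat m m \<Longrightarrow> bf (transpose_mat A) x y = bf A y x"
  unfolding bf_def by (subst sum.swap) (auto simp: mult_ac intro!: sum.cong)

lemma gram_index:
  assumes A: "A \<in> carrier_mat m m" and S: "S \<in> carrier_mat m n" and T: "T \<in> carrier_mat m k"
    and i: "i < n" and j: "j < k"
  shows "(transpose_mat S * A * T) $$ (i,j) = bf A (\<lambda>l. S $$ (l,i)) (\<lambda>l. T $$ (l,j))"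
proof -
  have "(transpose_mat S * A * T) $$ (i,j) = (\<Sum>a<m. S $$ (a,i) * (\<Sum>b<m. A $$ (a,b) * T $$ (b,j)))"
    using assms by (simp add: scalar_prod_def lessThan_atLeast0)
  also have "\<dots> = bf A (\<lambda>l. S $$ (l,i)) (\<lambda>l. T $$ (l,j))"
    unfolding bf_def using A by (simp add: sum_distrib_left mult.assoc)
  finally show ?thesis .
qed

lemma gram_vec_index:
  fixes B :: "'a :: comm_ring_1 mat"
  assumes B: "B \<in> carrier_mat m m" and v: "v \<in> carrier_vec m" and i: "i < n"
  shows "(transpose_mat (mat m n (\<lambda>(i,j). s j i)) * B *\<^sub>v v) $ i = bf B (s i) (\<lambda>j. v $ j)"
proof -
  define S where "S = mat m n (\<lambda>(i,j). s j i)"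
  define V where "V = mat m 1 (\<lambda>(i,j). v $ i)"
  define X where "X = transpose_mat S * B"
  have S: "S \<in> carrier_mat m n" and V: "V \<in> carrier_mat m 1" unfolding S_def V_def by auto
  have X: "X \<in> carrier_mat n m" unfolding X_def using S B by simp
  have "col V 0 = v" using v by (intro eq_vecI) (auto simp: V_def)
  then have "(X *\<^sub>v v) $ i = (X * V) $$ (i,0)" using X V i by simp
  also have "\<dots> = bf B (\<lambda>l. S $$ (l,i)) (\<lambda>l. V $$ (l,0))"
    unfolding X_def using gram_index[OF B S V i, of 0] by simp
  also have "\<dots> = bf B (s i) (\<lambda>j. v $ j)" using B i by (intro bf_cong) (auto simp: S_def V_def)
  finally show ?thesis unfolding X_def S_def .
qed

text \<open>Linear independence of the vectors \<open>s i\<close> need not be checked: an invertible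
  Gram matrix forces the matrix with these columns to be invertible.\<close>

lemma congruent_matI_gram:
  fixes A :: "'a :: field mat"
  assumes A: "A \<in> carrier_mat m m" and B: "B \<in> carrier_mat m m" "invertible_mat B"
    and gram: "\<And>i j. i < m \<Longrightarrow> j < m \<Longrightarrow> bf A (s i) (s j) = B $$ (i,j)"
  shows "congruent_mat A B"
proof -
  define S where "S = mat m m (\<lambda>(i,j). s j i)"
  have S: "S \<in> carrier_mat m m" unfolding S_def by auto
  have eq: "transpose_mat S * A * S = B"
  proof (rule eq_matI)
    fix i j assume "i < dim_row B" "j < dim_col B"
    then have ij: "i < m" "j < m" using B by auto
    have "bf A (\<lambda>l. S $$ (l,i)) (\<lambda>l. S $$ (l,j)) = bf A (s i) (s j)"
      using A ij by (intro bf_cong) (auto simp: S_def)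
    then show "(transpose_mat S * A * S) $$ (i,j) = B $$ (i,j)"
      using gram_index[OF A S S ij] gram[OF ij] by simp
  qed (use A B S in auto)
  then have "invertible_mat (transpose_mat S * A * S)" using B by simp
  then have "invertible_mat S" using invertible_mat_mult[of "transpose_mat S * A" m S] A S by auto
  then show ?thesis using congruent_matI[OF A S _ eq] by simp
qed

section \<open>Dimension and orthogonal splitting\<close>

definition hcat :: "'a mat \<Rightarrow> 'a mat \<Rightarrow> 'a mat" where
  "hcat S Q = mat (dim_row S) (dim_col S + dim_col Q)
     (\<lambda>(i,j). if j < dim_col S then S $$ (i,j) else Q $$ (i, j - dim_col S))"

lemma hcat_carrier [simp]:
  "S \<in> carrier_mat m n \<Longrightarrow> Q \<in> carrier_mat m d \<Longrightarrow> hcat S Q \<in> carrier_mat m (n + d)"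
  unfolding hcat_def by auto

lemma hcat_mult_vec:
  fixes S :: "'a :: comm_ring_1 mat"
  assumes S: "S \<in> carrier_mat m n" and Q: "Q \<in> carrier_mat m d"
    and x: "x \<in> carrier_vec n" and y: "y \<in> carrier_vec d"
  shows "hcat S Q *\<^sub>v (x @\<^sub>v y) = S *\<^sub>v x + Q *\<^sub>v y"
proof (rule eq_vecI)
  fix i assume "i < dim_vec (S *\<^sub>v x + Q *\<^sub>v y)"
  then have i: "i < m" using Q by simp
  have r: "row (hcat S Q) i = row S i @\<^sub>v row Q i"
    using S Q i by (intro eq_vecI) (auto simp: hcat_def)
  have "(hcat S Q *\<^sub>v (x @\<^sub>v y)) $ i = row (hcat S Q) i \<bullet> (x @\<^sub>v y)"
    using S i by (simp add: hcat_def)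
  also have "\<dots> = row S i \<bullet> x + row Q i \<bullet> y"
    unfolding r using S Q x y i by (intro scalar_prod_append[of _ n _ d]) auto
  finally show "(hcat S Q *\<^sub>v (x @\<^sub>v y)) $ i = (S *\<^sub>v x + Q *\<^sub>v y) $ i"
    using S Q x y i by simp
qed (use S Q in \<open>simp add: hcat_def\<close>)

lemma vec_splitE:
  assumes "x \<in> carrier_vec (n + d)"
  obtains y z where "y \<in> carrier_vec n" "z \<in> carrier_vec d" "x = y @\<^sub>v z"
  using assms vec_first_last_append[of x n d] vec_first_carrier vec_last_carrier by metis

lemma append_vec_eq_zero_iff:
  fixes x :: "'a :: zero vec"
  assumes "x \<in> carrier_vec n" "y \<in> carrier_vec d"
  shows "x @\<^sub>v y = 0\<^sub>v (n + d) \<longleftrightarrow> x = 0\<^sub>v n \<and> y = 0\<^sub>v d"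
proof -
  have "0\<^sub>v (n + d) = (0\<^sub>v n @\<^sub>v 0\<^sub>v d :: 'a vec)" by (intro eq_vecI) auto
  then show ?thesis using append_vec_eq[OF assms(1) zero_carrier_vec] by metis
qed

section \<open>Dimension of subspaces of column vectors\<close>

definition inj_mat :: "'a :: comm_ring_1 mat \<Rightarrow> bool" where
  "inj_mat P \<longleftrightarrow> (\<forall>x \<in> carrier_vec (dim_col P). P *\<^sub>v x = 0\<^sub>v (dim_row P) \<longrightarrow> x = 0\<^sub>v (dim_col P))"

definition range_mat :: "'a :: comm_ring_1 mat \<Rightarrow> 'a vec set" where
  "range_mat P = {P *\<^sub>v x | x. x \<in> carrier_vec (dim_col P)}"

text \<open>A dimension is witnessed by a matrix whose columns form a basis, so that it can be
  carried along by matrix products; \<open>hasdim_unique\<close> shows that it is well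
  defined.\<close>

definition hasdim :: "nat \<Rightarrow> 'a :: comm_ring_1 vec set \<Rightarrow> nat \<Rightarrow> bool" where
  "hasdim m W d \<longleftrightarrow> (\<exists>P \<in> carrier_mat m d. inj_mat P \<and> W = range_mat P)"

lemma range_mat_one: "range_mat (1\<^sub>m m) = (carrier_vec m :: 'a :: comm_ring_1 vec set)"
  unfolding range_mat_def by (auto, metis one_mult_mat_vec)

lemma range_mat_subset: "P \<in> carrier_mat m d \<Longrightarrow> range_mat P \<subseteq> carrier_vec m"
  unfolding range_mat_def by auto

text \<open>Padding with zero rows produces a square matrix with a zero row, hence a singular one,
  and the determinant supplies the kernel vector.\<close>

lemma exists_kernel_vec_wide:
  fixes X :: "'a :: field mat"
  assumes X: "X \<in> carrier_mat d' d" and lt: "d' < d"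
  shows "\<exists>v \<in> carrier_vec d. v \<noteq> 0\<^sub>v d \<and> X *\<^sub>v v = 0\<^sub>v d'"
proof -
  define Z where "Z = mat d d (\<lambda>(i,j). if i < d' then X $$ (i,j) else 0)"
  have Z: "Z \<in> carrier_mat d d" unfolding Z_def by auto
  have "\<not> invertible_mat Z"
  proof
    assume "invertible_mat Z"
    then obtain B where B: "B \<in> carrier_mat d d" "Z * B = 1\<^sub>m d"
      using invertible_mat_iff[OF Z] by auto
    have "(Z * B) $$ (d - 1, d - 1) = 0"
      using B(1) lt by (auto simp: Z_def scalar_prod_def intro!: sum.neutral)
    then show False using B(2) lt by simp
  qed
  then obtain v where v: "v \<in> carrier_vec d" "v \<noteq> 0\<^sub>v d" "Z *\<^sub>v v = 0\<^sub>v d"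
    using invertible_mat_iff_det[OF Z] det_0_iff_vec_prod_zero_field[OF Z] by auto
  have "X *\<^sub>v v = 0\<^sub>v d'"
  proof (rule eq_vecI)
    fix i assume "i < dim_vec (0\<^sub>v d' :: 'a vec)"
    then have i: "i < d'" by simp
    have "row X i = row Z i" using X i lt by (intro eq_vecI) (auto simp: Z_def)
    then have "(X *\<^sub>v v) $ i = (Z *\<^sub>v v) $ i" using X Z i lt by simp
    then show "(X *\<^sub>v v) $ i = 0\<^sub>v d' $ i" using v i lt by simp
  qed (use X in auto)
  with v show ?thesis by auto
qed

text \<open>Expressing the columns of P through those of P' gives P = P' * X. If X were wider than
  high, a kernel vector of X would also be killed by the injective P.\<close>

lemma range_mat_mono_dim:
  fixes P :: "'a :: field mat"
  assumes P: "P \<in> carrier_mat m d" "inj_mat P" and P': "P' \<in> carrier_mat m d'"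
    and sub: "range_mat P \<subseteq> range_mat P'"
  shows "d \<le> d'"
proof (rule ccontr)
  assume "\<not> d \<le> d'"
  then have lt: "d' < d" by simp
  have "\<exists>x \<in> carrier_vec d'. col P j = P' *\<^sub>v x" if j: "j < d" for j
  proof -
    have "col P j = P *\<^sub>v unit_vec d j"
      using P j by (intro eq_vecI) auto
    then have "col P j \<in> range_mat P" unfolding range_mat_def using P by auto
    then show ?thesis using sub P' unfolding range_mat_def by auto
  qed
  then obtain f where f: "\<And>j. j < d \<Longrightarrow> f j \<in> carrier_vec d'" "\<And>j. j < d \<Longrightarrow> col P j = P' *\<^sub>v f j"
    by metis
  define X where "X = mat d' d (\<lambda>(i,j). f j $ i)"
  have X: "X \<in> carrier_mat d' d" unfolding X_def by auto
  have PX: "P = P' * X"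
  proof (rule mat_col_eqI)
    fix j assume "j < dim_col (P' * X)"
    then have j: "j < d" using X by simp
    have "col X j = f j" using f(1)[OF j] j by (intro eq_vecI) (auto simp: X_def)
    moreover have "col (P' * X) j = P' *\<^sub>v col X j" using X P' j by (intro eq_vecI) auto
    ultimately show "col P j = col (P' * X) j" using f(2)[OF j] by simp
  qed (use P P' X in auto)
  obtain v where v: "v \<in> carrier_vec d" "v \<noteq> 0\<^sub>v d" "X *\<^sub>v v = 0\<^sub>v d'"
    using exists_kernel_vec_wide[OF X lt] by auto
  have "P *\<^sub>v v = P' *\<^sub>v (X *\<^sub>v v)" unfolding PX using P' X v by (intro assoc_mult_mat_vec) auto
  also have "\<dots> = 0\<^sub>v m" unfolding v(3) using P' by (intro eq_vecI) (auto simp: scalar_prod_def)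
  finally show False using P v unfolding inj_mat_def by auto
qed

lemma hasdim_unique:
  fixes W :: "'a :: field vec set"
  assumes "hasdim m W d" "hasdim m W d'"
  shows "d = d'"
  using assms range_mat_mono_dim unfolding hasdim_def by (metis le_antisym order_refl)

lemma hasdim_full: "hasdim m (carrier_vec m :: 'a :: field vec set) m"
  unfolding hasdim_def
  by (rule bexI[of _ "1\<^sub>m m"]) (auto simp: inj_mat_def range_mat_one)

definition vsubspace :: "nat \<Rightarrow> 'a :: comm_ring_1 vec set \<Rightarrow> bool" where
  "vsubspace m W \<longleftrightarrow> W \<subseteq> carrier_vec m \<and> 0\<^sub>v m \<in> W \<and> (\<forall>x\<in>W. \<forall>y\<in>W. \<forall>c. x + c \<cdot>\<^sub>v y \<in> W)"

lemma mult_mat_vec_zero: "P \<in> carrier_mat m d \<Longrightarrow> P *\<^sub>v 0\<^sub>v d = (0\<^sub>v m :: 'a :: comm_ring_1 vec)"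
  by (intro eq_vecI) (auto simp: scalar_prod_def)

text \<open>An independent family in W of maximal size spans W, since a vector outside its span
  could be appended as a further column.\<close>

lemma vsubspace_hasdim:
  fixes W :: "'a :: field vec set"
  assumes W: "vsubspace m W"
  shows "\<exists>d. hasdim m W d"
proof -
  define D where "D = {d. \<exists>P \<in> carrier_mat m d. inj_mat P \<and> range_mat P \<subseteq> W}"
  have "D \<subseteq> {..m}"
  proof
    fix d assume "d \<in> D"
    then obtain P :: "'a mat" where "P \<in> carrier_mat m d" "inj_mat P" unfolding D_def by auto
    then have "d \<le> m"
      by (intro range_mat_mono_dim[of P m d "1\<^sub>m m"]) (auto simp: range_mat_one dest: range_mat_subset)
    then show "d \<in> {..m}" by simp
  qed
  then have finD: "finite D" by (rule finite_subset) simp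
  have "0 \<in> D"
  proof -
    have "0\<^sub>m m 0 *\<^sub>v x = 0\<^sub>v m" if "x \<in> carrier_vec 0" for x :: "'a vec"
      using that by (intro eq_vecI) (auto simp: scalar_prod_def)
    then show ?thesis unfolding D_def using W
      by (auto intro!: bexI[of _ "0\<^sub>m m 0"] simp: inj_mat_def range_mat_def vsubspace_def)
  qed
  define d where "d = Max D"
  have "d \<in> D" unfolding d_def using finD \<open>0 \<in> D\<close> by (intro Max_in) auto
  then obtain P where P: "P \<in> carrier_mat m d" "inj_mat P" "range_mat P \<subseteq> W" unfolding D_def by auto
  have "W \<subseteq> range_mat P"
  proof (rule ccontr)
    assume "\<not> W \<subseteq> range_mat P"
    then obtain v where v: "v \<in> W" "v \<notin> range_mat P" by auto
    have vc: "v \<in> carrier_vec m" using v W unfolding vsubspace_def by auto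
    define V where "V = mat m 1 (\<lambda>(i,j). v $ i)"
    have V: "V \<in> carrier_mat m 1" unfolding V_def by auto
    have Vx: "V *\<^sub>v z = z $ 0 \<cdot>\<^sub>v v" if "z \<in> carrier_vec 1" for z
      using that vc by (intro eq_vecI) (auto simp: V_def scalar_prod_def)
    have H: "hcat P V \<in> carrier_mat m (d + 1)" by (rule hcat_carrier[OF P(1) V])
    have inj: "x = 0\<^sub>v (d + 1)" if x: "x \<in> carrier_vec (d + 1)" "hcat P V *\<^sub>v x = 0\<^sub>v m" for x
    proof -
      obtain y z where yz: "y \<in> carrier_vec d" "z \<in> carrier_vec 1" "x = y @\<^sub>v z"
        using vec_splitE[OF x(1)] by auto
      have e: "P *\<^sub>v y + z $ 0 \<cdot>\<^sub>v v = 0\<^sub>v m"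
        using x(2) hcat_mult_vec[OF P(1) V yz(1,2)] Vx[OF yz(2)] yz(3) by simp
      have z0: "z $ 0 = 0"
      proof (rule ccontr)
        assume nz: "z $ 0 \<noteq> 0"
        let ?c = "- inverse (z $ 0)"
        have "v = ?c \<cdot>\<^sub>v (P *\<^sub>v y)"
        proof (rule eq_vecI)
          fix i assume "i < dim_vec (?c \<cdot>\<^sub>v (P *\<^sub>v y))"
          then have i: "i < m" using P by simp
          have "(P *\<^sub>v y) $ i + z $ 0 * v $ i = 0"
            using arg_cong[OF e, of "\<lambda>u. u $ i"] i P vc yz by simp
          then have "(P *\<^sub>v y) $ i = - (z $ 0 * v $ i)" by (simp add: add_eq_0_iff2)
          then show "v $ i = (?c \<cdot>\<^sub>v (P *\<^sub>v y)) $ i" using nz i P by (simp del: index_mult_mat_vec)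
        qed (use vc P in auto)
        also have "\<dots> = P *\<^sub>v (?c \<cdot>\<^sub>v y)" using P yz by (simp add: mult_mat_vec)
        finally have "v \<in> range_mat P" unfolding range_mat_def using P yz by auto
        with v show False by simp
      qed
      have z: "z = 0\<^sub>v 1" using yz z0 by (intro eq_vecI) auto
      have "P *\<^sub>v y = 0\<^sub>v m"
      proof (rule eq_vecI)
        fix i assume "i < dim_vec (0\<^sub>v m :: 'a vec)"
        then show "(P *\<^sub>v y) $ i = 0\<^sub>v m $ i"
          using arg_cong[OF e, of "\<lambda>u. u $ i"] z0 P vc by simp
      qed (use P in auto)
      then have "y = 0\<^sub>v d" using P yz unfolding inj_mat_def by auto
      then show ?thesis using z yz append_vec_eq_zero_iff[OF yz(1,2)] by simp
    qed
    have "range_mat (hcat P V) \<subseteq> W"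
    proof
      fix u assume "u \<in> range_mat (hcat P V)"
      then obtain x where x: "x \<in> carrier_vec (d + 1)" "u = hcat P V *\<^sub>v x"
        unfolding range_mat_def using H by auto
      obtain y z where yz: "y \<in> carrier_vec d" "z \<in> carrier_vec 1" "x = y @\<^sub>v z"
        using vec_splitE[OF x(1)] by auto
      have "u = P *\<^sub>v y + z $ 0 \<cdot>\<^sub>v v"
        using x(2) hcat_mult_vec[OF P(1) V yz(1,2)] Vx[OF yz(2)] yz(3) by simp
      moreover have "P *\<^sub>v y \<in> W" using P yz unfolding range_mat_def by auto
      ultimately show "u \<in> W" using W v unfolding vsubspace_def by auto
    qed
    then have "d + 1 \<in> D" unfolding D_def using H inj
      by (auto intro!: bexI[of _ "hcat P V"] simp: inj_mat_def)
    then have "d + 1 \<le> d" unfolding d_def using finD by (intro Max_ge) auto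
    then show False by simp
  qed
  then show ?thesis unfolding hasdim_def using P by blast
qed

lemma hasdim_image_invertible:
  fixes W :: "'a :: field vec set"
  assumes W: "hasdim m W d" and T: "T \<in> carrier_mat m m" "invertible_mat T"
  shows "hasdim m ((\<lambda>v. T *\<^sub>v v) ` W) d"
proof -
  obtain P where P: "P \<in> carrier_mat m d" "inj_mat P" "W = range_mat P"
    using W unfolding hasdim_def by auto
  have a: "T * P *\<^sub>v x = T *\<^sub>v (P *\<^sub>v x)" if "x \<in> carrier_vec d" for x
    using T P that by (intro assoc_mult_mat_vec) auto
  have ti: "v = 0\<^sub>v m" if "v \<in> carrier_vec m" "T *\<^sub>v v = 0\<^sub>v m" for v
    using that T invertible_mat_iff_det[OF T(1)] det_0_iff_vec_prod_zero_field[OF T(1)] by auto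
  have "inj_mat (T * P)"
    unfolding inj_mat_def
  proof (intro ballI impI)
    fix x assume "x \<in> carrier_vec (dim_col (T * P))" and 0: "T * P *\<^sub>v x = 0\<^sub>v (dim_row (T * P))"
    then have x: "x \<in> carrier_vec d" using P(1) by simp
    have "T *\<^sub>v (P *\<^sub>v x) = 0\<^sub>v m" using 0 a[OF x] T(1) by simp
    then have "P *\<^sub>v x = 0\<^sub>v m" using ti[of "P *\<^sub>v x"] P(1) x by simp
    then show "x = 0\<^sub>v (dim_col (T * P))" using P(1,2) x unfolding inj_mat_def by simp
  qed
  moreover have "(\<lambda>v. T *\<^sub>v v) ` W = range_mat (T * P)"
  proof -
    have "range_mat (T * P) = {T *\<^sub>v (P *\<^sub>v x) | x. x \<in> carrier_vec d}"
      unfolding range_mat_def using P(1) a by (auto, metis)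
    then show ?thesis unfolding P(3) range_mat_def using P(1) by auto
  qed
  ultimately show ?thesis
    unfolding hasdim_def using P T by (intro bexI[of _ "T * P"]) auto
qed

lemma hasdim_append:
  fixes W :: "'a :: field vec set"
  assumes W: "hasdim m W d" and W': "hasdim m' W' d'"
  shows "hasdim (m + m') {v @\<^sub>v w | v w. v \<in> W \<and> w \<in> W'} (d + d')"
proof -
  obtain P where P: "P \<in> carrier_mat m d" "inj_mat P" "W = range_mat P"
    using W unfolding hasdim_def by auto
  obtain Q where Q: "Q \<in> carrier_mat m' d'" "inj_mat Q" "W' = range_mat Q"
    using W' unfolding hasdim_def by auto
  let ?M = "dsum P Q"
  have M: "?M \<in> carrier_mat (m + m') (d + d')" using P Q by simp
  have mv: "?M *\<^sub>v (x @\<^sub>v y) = (P *\<^sub>v x) @\<^sub>v (Q *\<^sub>v y)"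
    if "x \<in> carrier_vec d" "y \<in> carrier_vec d'" for x y
  proof -
    have "0\<^sub>m m d' *\<^sub>v y = 0\<^sub>v m" "0\<^sub>m m' d *\<^sub>v x = 0\<^sub>v m'"
      using that by (auto intro!: eq_vecI simp: scalar_prod_def)
    then show ?thesis
      unfolding dsum_def using P Q that
      by (subst four_block_mat_mult_vec[of _ m d _ d' _ m']) auto
  qed
  have "inj_mat ?M"
    unfolding inj_mat_def
  proof (intro ballI impI)
    fix x assume "x \<in> carrier_vec (dim_col ?M)" and 0: "?M *\<^sub>v x = 0\<^sub>v (dim_row ?M)"
    then have "x \<in> carrier_vec (d + d')" using P Q by simp
    then obtain y z where yz: "y \<in> carrier_vec d" "z \<in> carrier_vec d'" "x = y @\<^sub>v z"
      by (rule vec_splitE)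
    have "(P *\<^sub>v y) @\<^sub>v (Q *\<^sub>v z) = 0\<^sub>v (m + m')" using 0 mv[OF yz(1,2)] yz P Q by simp
    then have "P *\<^sub>v y = 0\<^sub>v m \<and> Q *\<^sub>v z = 0\<^sub>v m'"
      using append_vec_eq_zero_iff[of "P *\<^sub>v y" m "Q *\<^sub>v z" m'] P Q yz by auto
    then have "y = 0\<^sub>v d \<and> z = 0\<^sub>v d'" using P Q yz unfolding inj_mat_def by auto
    then show "x = 0\<^sub>v (dim_col ?M)" using yz P Q append_vec_eq_zero_iff[OF yz(1,2)] by simp
  qed
  moreover have "{v @\<^sub>v w | v w. v \<in> W \<and> w \<in> W'} = range_mat ?M"
  proof (intro equalityI subsetI)
    fix u assume "u \<in> {v @\<^sub>v w | v w. v \<in> W \<and> w \<in> W'}"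
    then obtain x y where "x \<in> carrier_vec d" "y \<in> carrier_vec d'" "u = (P *\<^sub>v x) @\<^sub>v (Q *\<^sub>v y)"
      unfolding P(3) Q(3) range_mat_def using P Q by auto
    then show "u \<in> range_mat ?M"
      unfolding range_mat_def using M mv by (auto intro!: exI[of _ "x @\<^sub>v y"])
  next
    fix u assume "u \<in> range_mat ?M"
    then obtain x where x: "x \<in> carrier_vec (d + d')" "u = ?M *\<^sub>v x"
      unfolding range_mat_def using M by auto
    obtain y z where yz: "y \<in> carrier_vec d" "z \<in> carrier_vec d'" "x = y @\<^sub>v z"
      using x(1) by (rule vec_splitE)
    then show "u \<in> {v @\<^sub>v w | v w. v \<in> W \<and> w \<in> W'}"
      unfolding P(3) Q(3) range_mat_def using x mv P Q by auto
  qed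
  ultimately show ?thesis unfolding hasdim_def using M by blast
qed

text \<open>The chain spaces computed later are assembled from coordinate subspaces, and their
  dimensions thereby become cardinalities.\<close>

lemma hasdim_coordinate:
  assumes I: "I \<subseteq> {..<m}"
  shows "hasdim m {v :: 'a :: field vec. v \<in> carrier_vec m \<and> (\<forall>i<m. i \<notin> I \<longrightarrow> v $ i = 0)} (card I)"
proof -
  have fin: "finite I" using I finite_subset by blast
  define d where "d = card I"
  obtain f where f: "bij_betw f {..<d} I"
    using fin ex_bij_betw_nat_finite[of I] unfolding d_def lessThan_atLeast0 by auto
  define P :: "'a mat" where "P = mat m d (\<lambda>(i,j). if i = f j then 1 else 0)"
  have P: "P \<in> carrier_mat m d" unfolding P_def by auto
  have fm: "f j < m" "f j \<in> I" if "j < d" for j using f I that unfolding bij_betw_def by auto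
  have finj: "f i = f j \<longleftrightarrow> i = j" if "i < d" "j < d" for i j
    using f that unfolding bij_betw_def inj_on_def by auto
  have ev: "(P *\<^sub>v x) $ f j = x $ j" if x: "x \<in> carrier_vec d" and j: "j < d" for x j
  proof -
    have "(P *\<^sub>v x) $ f j = (\<Sum>k<d. if j = k then x $ k else 0)"
      using x fm[OF j] finj[OF j]
      by (auto simp: P_def scalar_prod_def lessThan_atLeast0 simp del: sum.delta sum.delta' intro!: sum.cong)
    also have "\<dots> = x $ j" using j by simp
    finally show ?thesis .
  qed
  have ev0: "(P *\<^sub>v x) $ i = 0" if x: "x \<in> carrier_vec d" and i: "i < m" "i \<notin> I" for x i
    using x i fm by (auto simp: P_def scalar_prod_def intro!: sum.neutral)
  have "inj_mat P"
    unfolding inj_mat_def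
  proof (intro ballI impI)
    fix x assume "x \<in> carrier_vec (dim_col P)" and 0: "P *\<^sub>v x = 0\<^sub>v (dim_row P)"
    then have x: "x \<in> carrier_vec d" using P by simp
    have "x $ j = 0" if "j < d" for j using ev[OF x that] 0 fm[OF that] P by simp
    then show "x = 0\<^sub>v (dim_col P)" using x P by (intro eq_vecI) auto
  qed
  moreover have "{v :: 'a vec. v \<in> carrier_vec m \<and> (\<forall>i<m. i \<notin> I \<longrightarrow> v $ i = 0)} = range_mat P"
  proof (intro equalityI subsetI)
    fix v :: "'a vec" assume "v \<in> {v. v \<in> carrier_vec m \<and> (\<forall>i<m. i \<notin> I \<longrightarrow> v $ i = 0)}"
    then have v: "v \<in> carrier_vec m" "\<And>i. i < m \<Longrightarrow> i \<notin> I \<Longrightarrow> v $ i = 0" by auto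
    let ?x = "vec d (\<lambda>j. v $ f j)"
    have "P *\<^sub>v ?x = v"
    proof (rule eq_vecI)
      fix i assume "i < dim_vec v"
      then have i: "i < m" using v by simp
      show "(P *\<^sub>v ?x) $ i = v $ i"
      proof (cases "i \<in> I")
        case True
        then obtain j where "j < d" "i = f j" using f unfolding bij_betw_def by auto
        then show ?thesis using ev[of ?x j] by simp
      next
        case False
        then show ?thesis using ev0[of ?x i] i v by simp
      qed
    qed (use v P in auto)
    then show "v \<in> range_mat P" unfolding range_mat_def using P by (auto intro!: exI[of _ ?x])
  next
    fix v assume "v \<in> range_mat P"
    then show "v \<in> {v. v \<in> carrier_vec m \<and> (\<forall>i<m. i \<notin> I \<longrightarrow> v $ i = 0)}"
      unfolding range_mat_def using P ev0 by (auto simp del: index_mult_mat_vec)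
  qed
  ultimately show ?thesis unfolding hasdim_def d_def[symmetric] using P by blast
qed

text \<open>\<open>L\<close> gives the coordinates along the columns of \<open>S\<close>; the last assumption says that its
  kernel is orthogonal to them on both sides, so the kernel is an orthogonal complement.\<close>

lemma congruent_mat_split:
  fixes A :: "'a :: field mat"
  assumes A: "A \<in> carrier_mat m m" and S: "S \<in> carrier_mat m n" and L: "L \<in> carrier_mat n m"
    and LS: "L * S = 1\<^sub>m n"
    and orth: "\<And>v. v \<in> carrier_vec m \<Longrightarrow> L *\<^sub>v v = 0\<^sub>v n \<Longrightarrow>
      transpose_mat S * A *\<^sub>v v = 0\<^sub>v n \<and> transpose_mat S * transpose_mat A *\<^sub>v v = 0\<^sub>v n"
  shows "\<exists>d A2. m = n + d \<and> A2 \<in> carrier_mat d d \<and> congruent_mat A (dsum (transpose_mat S * A * S) A2)"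
proof -
  define K where "K = {v \<in> carrier_vec m. L *\<^sub>v v = 0\<^sub>v n}"
  have "vsubspace m K"
    unfolding vsubspace_def K_def using L
    by (auto simp: mult_mat_vec_zero mult_add_distrib_mat_vec[of _ n m] mult_mat_vec[of _ n m])
  then obtain d where "hasdim m K d" using vsubspace_hasdim by blast
  then obtain Q where Q: "Q \<in> carrier_mat m d" "inj_mat Q" "K = range_mat Q"
    unfolding hasdim_def by auto
  let ?M = "hcat S Q"
  have M: "?M \<in> carrier_mat m (n + d)" using S Q by simp
  have QK: "L *\<^sub>v (Q *\<^sub>v y) = 0\<^sub>v n" if "y \<in> carrier_vec d" for y
  proof -
    have "Q *\<^sub>v y \<in> K" unfolding Q(3) range_mat_def using that Q by auto
    then show ?thesis unfolding K_def by auto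
  qed
  have LSx: "L *\<^sub>v (S *\<^sub>v x) = x" if "x \<in> carrier_vec n" for x
    using assoc_mult_mat_vec[OF L S that] LS that by simp
  have injM: "x = 0\<^sub>v (n + d)" if x: "x \<in> carrier_vec (n + d)" "?M *\<^sub>v x = 0\<^sub>v m" for x
  proof -
    obtain y z where yz: "y \<in> carrier_vec n" "z \<in> carrier_vec d" "x = y @\<^sub>v z"
      using x(1) by (rule vec_splitE)
    have e: "S *\<^sub>v y + Q *\<^sub>v z = 0\<^sub>v m" using x(2) hcat_mult_vec[OF S Q(1) yz(1,2)] yz(3) by simp
    have "L *\<^sub>v (S *\<^sub>v y + Q *\<^sub>v z) = L *\<^sub>v (S *\<^sub>v y) + L *\<^sub>v (Q *\<^sub>v z)"
      using L S Q yz by (intro mult_add_distrib_mat_vec[of _ n m]) auto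
    then have y0: "y = 0\<^sub>v n" using e LSx[OF yz(1)] QK[OF yz(2)] L yz by (simp add: mult_mat_vec_zero)
    then have "Q *\<^sub>v z = 0\<^sub>v m" using e S Q yz by (simp add: mult_mat_vec_zero)
    then have "z = 0\<^sub>v d" using Q yz unfolding inj_mat_def by auto
    then show ?thesis using y0 yz append_vec_eq_zero_iff[OF yz(1,2)] by simp
  qed
  have "carrier_vec m = range_mat ?M"
  proof (intro equalityI subsetI)
    fix v :: "'a vec" assume v: "v \<in> carrier_vec m"
    \<comment> \<open>The projection of v to the kernel of L along the columns of S.\<close>
    let ?u = "v - S *\<^sub>v (L *\<^sub>v v)"
    have Lv: "L *\<^sub>v v \<in> carrier_vec n" using L v by auto
    have u: "?u \<in> carrier_vec m" using v S L by (auto intro!: minus_carrier_vec)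
    have "L *\<^sub>v ?u = L *\<^sub>v v - L *\<^sub>v (S *\<^sub>v (L *\<^sub>v v))"
      using L S v by (intro mult_minus_distrib_mat_vec[of _ n m]) auto
    also have "\<dots> = 0\<^sub>v n" using LSx[OF Lv] Lv by simp
    finally have "?u \<in> K" unfolding K_def using u by simp
    then obtain z where z: "z \<in> carrier_vec d" "?u = Q *\<^sub>v z"
      unfolding Q(3) range_mat_def using Q by auto
    have "?M *\<^sub>v (L *\<^sub>v v @\<^sub>v z) = S *\<^sub>v (L *\<^sub>v v) + ?u"
      using hcat_mult_vec[OF S Q(1) Lv z(1)] z by simp
    also have "\<dots> = v" using v S L by (intro eq_vecI) auto
    finally show "v \<in> range_mat ?M"
      unfolding range_mat_def using M Lv z by (auto intro!: exI[of _ "L *\<^sub>v v @\<^sub>v z"])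
  next
    fix v assume "v \<in> range_mat ?M"
    then show "v \<in> carrier_vec m" unfolding range_mat_def using M by auto
  qed
  \<comment> \<open>Comparing this basis with the standard one makes \<open>hcat S Q\<close> square,
    so that injectivity gives invertibility.\<close>
  then have "hasdim m (carrier_vec m :: 'a vec set) (n + d)"
    unfolding hasdim_def using M injM by (auto intro!: bexI[of _ ?M] simp: inj_mat_def)
  then have md: "m = n + d" using hasdim_unique hasdim_full by blast
  have M': "?M \<in> carrier_mat m m" using M md by simp
  have inv: "invertible_mat ?M" using injM md by (intro invertible_mat_if_inj[OF M']) auto
  have SQ: "bf A (\<lambda>l. S $$ (l,i)) (\<lambda>l. Q $$ (l,j)) = 0" "bf A (\<lambda>l. Q $$ (l,j)) (\<lambda>l. S $$ (l,i)) = 0"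
    if i: "i < n" and j: "j < d" for i j
  proof -
    have "col Q j = Q *\<^sub>v unit_vec d j" using Q j by (intro eq_vecI) auto
    then have c: "L *\<^sub>v col Q j = 0\<^sub>v n" using QK by simp
    have "(transpose_mat S * A * Q) $$ (i,j) = (transpose_mat S * A *\<^sub>v col Q j) $ i"
      using S Q i j by simp
    also have "\<dots> = 0" using orth[OF _ c] Q i by auto
    finally show "bf A (\<lambda>l. S $$ (l,i)) (\<lambda>l. Q $$ (l,j)) = 0"
      using gram_index[OF A S Q(1) i j] by simp
    have "(transpose_mat S * transpose_mat A * Q) $$ (i,j) = (transpose_mat S * transpose_mat A *\<^sub>v col Q j) $ i"
      using S Q i j by simp
    also have "\<dots> = 0" using orth[OF _ c] Q i by auto
    finally show "bf A (\<lambda>l. Q $$ (l,j)) (\<lambda>l. S $$ (l,i)) = 0"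
      using gram_index[of "transpose_mat A" m S n Q d i j] A S Q i j by (simp add: bf_transpose[OF A])
  qed
  have colM: "?M $$ (l,i) = (if i < n then S $$ (l,i) else Q $$ (l, i - n))" if "l < m" "i < n + d" for l i
    using that S Q unfolding hcat_def by auto
  have "transpose_mat ?M * A * ?M = dsum (transpose_mat S * A * S) (transpose_mat Q * A * Q)"
    (is "?X = ?Y")
  proof (rule eq_matI)
    have Y: "?Y \<in> carrier_mat (n + d) (n + d)" using S Q A by (intro dsum_carrier) auto
    show "dim_row ?X = dim_row ?Y" "dim_col ?X = dim_col ?Y"
      using carrier_matD[OF M] S Q A by auto
    fix i j assume "i < dim_row ?Y" "j < dim_col ?Y"
    then have ij: "i < n + d" "j < n + d" using Y by auto
    have "?X $$ (i,j) = bf A (\<lambda>l. ?M $$ (l,i)) (\<lambda>l. ?M $$ (l,j))"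
      using gram_index[OF A M M ij] .
    also have "\<dots> = bf A (\<lambda>l. if i < n then S $$ (l,i) else Q $$ (l, i - n))
      (\<lambda>l. if j < n then S $$ (l,j) else Q $$ (l, j - n))"
      using A ij by (intro bf_cong) (auto simp: colM)
    also have "\<dots> = ?Y $$ (i,j)"
    proof -
      have "?Y $$ (i,j) = (if i < n then if j < n then (transpose_mat S * A * S) $$ (i,j) else 0
        else if j < n then 0 else (transpose_mat Q * A * Q) $$ (i - n, j - n))"
        using S Q A ij unfolding dsum_def by (auto simp del: index_mult_mat(1))
      then show ?thesis
        using SQ ij gram_index[OF A S S] gram_index[OF A Q(1) Q(1)]
        by (auto simp del: index_mult_mat(1))
    qed
    finally show "?X $$ (i,j) = ?Y $$ (i,j)" .
  qed
  then have "congruent_mat A (dsum (transpose_mat S * A * S) (transpose_mat Q * A * Q))"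
    by (intro congruent_matI[OF A M' inv])
  then show ?thesis using md Q A by (intro exI[of _ d] exI[of _ "transpose_mat Q * A * Q"]) auto
qed

section \<open>Chains and their duals\<close>

text \<open>Induction on the number of functionals. If \<open>g e\<close> vanishes wherever the
  others do, it can be omitted. Otherwise some v is killed by the others but not by
  \<open>g e\<close>, and subtracting a suitable multiple of \<open>g e\<close> makes f vanish on
  the common kernel of the others.\<close>

lemma functional_dependence:
  fixes f :: "('i \<Rightarrow> 'a :: field) \<Rightarrow> 'a" and g :: "'e \<Rightarrow> ('i \<Rightarrow> 'a) \<Rightarrow> 'a"
  assumes "finite E"
    and "\<And>y v c. f (\<lambda>i. y i + c * v i) = f y + c * f v"
    and "\<And>e y v c. e \<in> E \<Longrightarrow> g e (\<lambda>i. y i + c * v i) = g e y + c * g e v"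
    and "\<And>y. (\<forall>e\<in>E. g e y = 0) \<Longrightarrow> f y = 0"
  shows "\<exists>z. \<forall>y. f y = (\<Sum>e\<in>E. z e * g e y)"
  using assms
proof (induct E arbitrary: f rule: finite_induct)
  case empty
  then show ?case by simp
next
  case (insert e E)
  note lf = insert.prems(1) and lg = insert.prems(2) and ker = insert.prems(3)
  show ?case
  proof (cases "\<forall>y. (\<forall>e'\<in>E. g e' y = 0) \<longrightarrow> g e y = 0")
    case True
    then have "\<exists>z. \<forall>y. f y = (\<Sum>e\<in>E. z e * g e y)"
      using lf lg ker by (intro insert.hyps(3)) auto
    then obtain z where z: "\<And>y. f y = (\<Sum>e\<in>E. z e * g e y)" by blast
    have "f y = (\<Sum>e'\<in>insert e E. (z(e := 0)) e' * g e' y)" for y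
    proof -
      have "(\<Sum>e'\<in>E. (z(e := 0)) e' * g e' y) = (\<Sum>e'\<in>E. z e' * g e' y)"
        using insert.hyps by (intro sum.cong) auto
      then show ?thesis using z[of y] insert.hyps by simp
    qed
    then show ?thesis by blast
  next
    case False
    then obtain v where v: "\<forall>e'\<in>E. g e' v = 0" "g e v \<noteq> 0" by auto
    define f' where "f' = (\<lambda>y. f y - f v / g e v * g e y)"
    have "\<exists>z. \<forall>y. f' y = (\<Sum>e\<in>E. z e * g e y)"
    proof (rule insert.hyps(3))
      show "f' (\<lambda>i. y i + c * u i) = f' y + c * f' u" for y u c
        unfolding f'_def using lf[of y c u] lg[of e y c u] by (simp add: algebra_simps add_divide_distrib)
      show "g e' (\<lambda>i. y i + c * u i) = g e' y + c * g e' u" if "e' \<in> E" for e' y u c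
        using lg that by auto
      fix y assume y: "\<forall>e'\<in>E. g e' y = 0"
      define c where "c = - (g e y / g e v)"
      have "f (\<lambda>i. y i + c * v i) = 0"
      proof (rule ker, rule ballI)
        fix e' assume e': "e' \<in> insert e E"
        have "g e' (\<lambda>i. y i + c * v i) = g e' y + c * g e' v" using lg[OF e'] .
        then show "g e' (\<lambda>i. y i + c * v i) = 0" using e' y v unfolding c_def by auto
      qed
      then show "f' y = 0" unfolding f'_def using lf[of y c v] v(2) by (simp add: c_def field_simps)
    qed
    then obtain z where z: "\<And>y. f' y = (\<Sum>e\<in>E. z e * g e y)" by blast
    have "f y = (\<Sum>e'\<in>insert e E. (z(e := f v / g e v)) e' * g e' y)" for y
    proof -
      have "(\<Sum>e'\<in>E. (z(e := f v / g e v)) e' * g e' y) = (\<Sum>e'\<in>E. z e' * g e' y)"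
        using insert.hyps by (intro sum.cong) auto
      then show ?thesis using z[of y] insert.hyps unfolding f'_def by (simp add: diff_eq_eq add.commute)
    qed
    then show ?thesis by blast
  qed
qed

text \<open>The Fredholm alternative: a dual chain that pairs nontrivially with \<open>x\<close> exists unless \<open>x\<close>
  can be prolonged to a chain in the other direction.\<close>

lemma dual_chain:
  fixes A :: "'a :: field mat"
  assumes p: "p = q \<or> p = Suc q"
  shows "(\<exists>y. (\<forall>j. j = 0 \<or> p < j \<longrightarrow> y j = (\<lambda>_. 0)) \<and>
      (\<forall>j w. 1 \<le> j \<and> j \<le> q \<longrightarrow> bf A (y j) w = l * bf A w (y j) + bf A w (y (Suc j))) \<and>
      bf A x (y 1) \<noteq> 0) \<or>
    (\<exists>z. z 0 = x \<and> (\<forall>j<q. \<forall>w. bf A w (z (Suc j)) = l * bf A (z (Suc j)) w + bf A (z j) w) \<and>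
      (p = Suc q \<longrightarrow> (\<forall>w. bf A (z q) w = 0)))" (is "?P \<or> ?Q")
proof (rule disjCI)
  assume nQ: "\<not> ?Q"
  show ?P
  proof (rule ccontr)
    assume nP: "\<not> ?P"
    \<comment> \<open>All members of a candidate y are coded as one vector indexed by pairs; cutting
      off outside 1..p builds in the boundary values and leaves only the linear equations
      \<open>g\<close>, one per link j and coordinate k.\<close>
    define Y where "Y = (\<lambda>(y :: nat \<times> nat \<Rightarrow> 'a) j. if 1 \<le> j \<and> j \<le> p then (\<lambda>i. y (j,i)) else (\<lambda>_. 0))"
    have Ylin: "Y (\<lambda>i. y i + c * v i) j = (\<lambda>i. Y y j i + c * Y v j i)" for y v c j
      unfolding Y_def by auto
    define g where "g = (\<lambda>(j,k) y. bf A (Y y j) (ue k) - l * bf A (ue k) (Y y j) - bf A (ue k) (Y y (Suc j)))"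
    define f where "f = (\<lambda>y. bf A x (Y y 1))"
    let ?E = "{1..q} \<times> {..<dim_row A}"
    have "\<exists>z. \<forall>y. f y = (\<Sum>e\<in>?E. z e * g e y)"
    proof (rule functional_dependence)
      show "f (\<lambda>i. y i + c * v i) = f y + c * f v" for y v c
        unfolding f_def Ylin by (rule bf_add_right)
      show "g e (\<lambda>i. y i + c * v i) = g e y + c * g e v" for e y v c
        unfolding g_def by (cases e) (simp add: Ylin bf_add_right bf_add_left algebra_simps)
      fix y assume y: "\<forall>e\<in>?E. g e y = 0"
      have "bf A (Y y j) w = l * bf A w (Y y j) + bf A w (Y y (Suc j))" if j: "1 \<le> j" "j \<le> q" for j w
      proof -
        have e: "bf A (Y y j) (ue k) = l * bf A (ue k) (Y y j) + bf A (ue k) (Y y (Suc j))"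
          if "k < dim_row A" for k
          using bspec[OF y, of "(j,k)"] j that unfolding g_def by (simp add: algebra_simps)
        have "bf A (Y y j) w = (\<Sum>k<dim_row A. w k * bf A (Y y j) (ue k))" by (rule bf_expand_right)
        also have "\<dots> = (\<Sum>k<dim_row A. w k * (l * bf A (ue k) (Y y j) + bf A (ue k) (Y y (Suc j))))"
          by (intro sum.cong refl) (simp add: e)
        also have "\<dots> = l * (\<Sum>k<dim_row A. w k * bf A (ue k) (Y y j)) + (\<Sum>k<dim_row A. w k * bf A (ue k) (Y y (Suc j)))"
          by (simp add: algebra_simps sum.distrib sum_distrib_left)
        also have "\<dots> = l * bf A w (Y y j) + bf A w (Y y (Suc j))"
          by (simp add: bf_expand_left[of A w])
        finally show ?thesis .
      qed
      moreover have "\<forall>j. j = 0 \<or> p < j \<longrightarrow> Y y j = (\<lambda>_. 0)" unfolding Y_def by auto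
      ultimately show "f y = 0" using nP unfolding f_def by (metis One_nat_def)
    qed simp
    then obtain z where z: "\<And>y. f y = (\<Sum>e\<in>?E. z e * g e y)" by blast
    \<comment> \<open>The multipliers of the linear dependence, grouped by j, are the members of the
      chain in the other direction.\<close>
    define Z where "Z = (\<lambda>j. if j = 0 then x else (\<lambda>k. z (j,k)))"
    have key: "bf A x (Y y 1) = (\<Sum>j\<in>{1..q}. bf A (Y y j) (Z j) - l * bf A (Z j) (Y y j) - bf A (Z j) (Y y (Suc j)))" for y
    proof -
      have "bf A x (Y y 1) = (\<Sum>j\<in>{1..q}. \<Sum>k<dim_row A. z (j,k) * g (j,k) y)"
        using z[of y] unfolding f_def by (simp add: sum.cartesian_product)
      also have "\<dots> = (\<Sum>j\<in>{1..q}. bf A (Y y j) (Z j) - l * bf A (Z j) (Y y j) - bf A (Z j) (Y y (Suc j)))"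
      proof (rule sum.cong[OF refl])
        fix j assume "j \<in> {1..q}"
        then have Zj: "Z j = (\<lambda>k. z (j,k))" unfolding Z_def by auto
        show "(\<Sum>k<dim_row A. z (j,k) * g (j,k) y) = bf A (Y y j) (Z j) - l * bf A (Z j) (Y y j) - bf A (Z j) (Y y (Suc j))"
          unfolding Zj bf_expand_left[of A "\<lambda>k. z (j,k)"] bf_expand_right[of A "Y y j" "\<lambda>k. z (j,k)"] g_def
          by (simp add: algebra_simps sum_subtractf sum.distrib sum_distrib_left)
      qed
      finally show ?thesis .
    qed
    \<comment> \<open>Testing \<open>key\<close> with a family concentrated in the slot j0 yields
      one link of Z. For p = Suc q the last slot occurs in no equation as left argument, and testing
      it gives the closing condition on \<open>Z q\<close>.\<close>
    have step: "(if j0 \<le> q then bf A v (Z j0) - l * bf A (Z j0) v else 0) = bf A (Z (j0 - 1)) v"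
      if j0: "1 \<le> j0" "j0 \<le> p" for j0 v
    proof -
      define y where "y = (\<lambda>(j :: nat, i :: nat). if j = j0 then v i else 0)"
      have Yy: "Y y j = (if j = j0 then v else (\<lambda>_. 0))" for j
        unfolding Y_def y_def using j0 by auto
      have "(\<Sum>j\<in>{1..q}. bf A (Y y j) (Z j) - l * bf A (Z j) (Y y j) - bf A (Z j) (Y y (Suc j)))
        = (\<Sum>j\<in>{1..q}. (if j = j0 then bf A v (Z j) - l * bf A (Z j) v else 0) - (if j = j0 - 1 then bf A (Z j) v else 0))"
        unfolding Yy using j0 by (intro sum.cong refl) auto
      also have "\<dots> = (if j0 \<le> q then bf A v (Z j0) - l * bf A (Z j0) v else 0) - (if j0 = 1 then 0 else bf A (Z (j0 - 1)) v)"
        using j0 p by (auto simp: sum_subtractf)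
      finally have "bf A x (Y y 1) = \<dots>" using key[of y] by simp
      moreover have "bf A x (Y y 1) = (if j0 = 1 then bf A (Z 0) v else 0)" unfolding Yy Z_def by auto
      ultimately show ?thesis by (auto split: if_splits)
    qed
    have "?Q"
    proof (intro exI[of _ Z] conjI allI impI)
      show "Z 0 = x" unfolding Z_def by simp
      show "bf A w (Z (Suc j)) = l * bf A (Z (Suc j)) w + bf A (Z j) w" if "j < q" for j w
        using step[of "Suc j" w] that p by (auto simp: algebra_simps)
      show "bf A (Z q) w = 0" if "p = Suc q" for w
        using step[of "Suc q" w] that by simp
    qed
    with nQ show False by simp
  qed
qed

text \<open>The two-sided radical. A nonzero vector in it spans a summand of size 1 that is split
  off separately, so the chains used for larger blocks are required to leave it.\<close>

definition null :: "'a :: field mat \<Rightarrow> (nat \<Rightarrow> 'a) \<Rightarrow> bool" where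
  "null A x \<longleftrightarrow> (\<forall>w. bf A w x = 0 \<and> bf A x w = 0)"

text \<open>Members are indexed from 1; \<open>x 0 = 0\<close> absorbs the first equation, and \<open>x j\<close> is arbitrary for \<open>j > k\<close>.\<close>

definition chain :: "'a :: field mat \<Rightarrow> 'a \<Rightarrow> nat \<Rightarrow> (nat \<Rightarrow> nat \<Rightarrow> 'a) \<Rightarrow> bool" where
  "chain A l k x \<longleftrightarrow> x 0 = (\<lambda>_. 0) \<and>
     (\<forall>j<k. \<forall>w. bf A w (x (Suc j)) = l * bf A (x (Suc j)) w + bf A (x j) w)"

text \<open>Equivalently, the polynomial vector with coefficients \<open>x j\<close> at t^j is
  annihilated by the pencil A - t A^T: the links hold for all j, including the one beyond the last
  member. This is Kronecker's notion of a singular pencil.\<close>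

definition singular_chain :: "'a :: field mat \<Rightarrow> nat \<Rightarrow> (nat \<Rightarrow> nat \<Rightarrow> 'a) \<Rightarrow> bool" where
  "singular_chain A k x \<longleftrightarrow> x 0 = (\<lambda>_. 0) \<and> (\<forall>j. k < j \<longrightarrow> x j = (\<lambda>_. 0)) \<and>
     (\<forall>j w. bf A w (x (Suc j)) = bf A (x j) w)"

section \<open>Splitting off nilpotent Jordan blocks\<close>

definition jordan_family :: "'a :: field mat \<Rightarrow> nat \<Rightarrow> (nat \<Rightarrow> nat \<Rightarrow> 'a) \<Rightarrow> bool" where
  "jordan_family A n e \<longleftrightarrow> (\<forall>w. bf A w (e 0) = 0) \<and> (\<forall>i w. i + 2 < n \<longrightarrow> bf A w (e (i + 2)) = bf A (e i) w) \<and>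
     (\<forall>w. bf A (e (n - 1)) w = 0) \<and>
     (\<forall>i<n. \<forall>j<n. bf A (e i) (e j) = (if j = Suc i then 1 else 0))"

text \<open>In \<open>J_n(0)\<close> the relation between left and right products links positions
  that differ by two, while the nonzero Gram entries join neighbours. Hence a chain fills the even
  positions and its dual the odd ones.\<close>

lemma jordan_family_interleave:
  fixes A :: "'a :: field mat"
  defines "e \<equiv> \<lambda>(x :: nat \<Rightarrow> nat \<Rightarrow> 'a) y i. if even i then x (i div 2 + 1) else y (i div 2 + 1)"
  assumes n: "n \<ge> 1" and x0: "x 0 = (\<lambda>_. 0)"
    and X1: "\<And>i w. Suc i \<le> (n + 1) div 2 \<Longrightarrow> bf A w (x (Suc i)) = bf A (x i) w"
    and Y1: "\<And>j w. 1 \<le> j \<Longrightarrow> Suc j \<le> n div 2 \<Longrightarrow> bf A (y j) w = bf A w (y (Suc j))"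
    and last: "\<And>w. bf A (e x y (n - 1)) w = 0"
    and T: "\<And>i j. i \<le> (n + 1) div 2 \<Longrightarrow> 1 \<le> j \<Longrightarrow> j \<le> n div 2 \<Longrightarrow> bf A (x i) (y j) = (if i = j then 1 else 0)"
    and XX: "\<And>i j. i \<le> (n + 1) div 2 \<Longrightarrow> j \<le> (n + 1) div 2 \<Longrightarrow> bf A (x i) (x j) = 0"
    and YY: "\<And>i j. 1 \<le> i \<Longrightarrow> i \<le> n div 2 \<Longrightarrow> 1 \<le> j \<Longrightarrow> j \<le> n div 2 \<Longrightarrow> bf A (y i) (y j) = 0"
  shows "jordan_family A n (e x y)"
  unfolding jordan_family_def
proof (intro conjI allI impI)
  have 1: "Suc 0 \<le> (n + 1) div 2" using n by auto
  show "bf A w (e x y 0) = 0" for w using X1[OF 1, of w] x0 unfolding e_def by simp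
  show "bf A (e x y (n - 1)) w = 0" for w by (rule last)
  fix i
  show "bf A w (e x y (i + 2)) = bf A (e x y i) w" if "i + 2 < n" for w
  proof (cases "even i")
    case True
    then obtain a where a: "i = 2 * a" by (elim evenE)
    have "Suc (Suc a) \<le> (n + 1) div 2" using that a by linarith
    from X1[OF this, of w] show ?thesis unfolding e_def a by simp
  next
    case False
    then obtain a where a: "i = 2 * a + 1" by (elim oddE)
    have "Suc (Suc a) \<le> n div 2" using that a by linarith
    from Y1[OF _ this, of w] show ?thesis unfolding e_def a by simp
  qed
  fix j
  assume i: "i < n" and j: "j < n"
  obtain a where a: "i = 2 * a \<or> i = 2 * a + 1" by (metis evenE oddE)
  obtain b where b: "j = 2 * b \<or> j = 2 * b + 1" by (metis evenE oddE)
  \<comment> \<open>One link of x turns this product into a pairing of x with y, with the index of x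
    lowered by one; this places the entry right above the diagonal.\<close>
  have yx: "bf A (y (Suc a)) (x (Suc b)) = (if b = Suc a then 1 else 0)" if "Suc a \<le> n div 2" "Suc b \<le> (n + 1) div 2"
    using X1[OF that(2), of "y (Suc a)"] T[of b "Suc a"] that by auto
  consider "i = 2 * a" "j = 2 * b" | "i = 2 * a" "j = 2 * b + 1" | "i = 2 * a + 1" "j = 2 * b"
    | "i = 2 * a + 1" "j = 2 * b + 1" using a b by blast
  then show "bf A (e x y i) (e x y j) = (if j = Suc i then 1 else 0)"
  proof cases
    case 1
    moreover have "Suc a \<le> (n + 1) div 2" "Suc b \<le> (n + 1) div 2" using i j 1 by linarith+
    ultimately show ?thesis unfolding e_def using XX by (auto) presburger
  next
    case 2
    moreover have "Suc a \<le> (n + 1) div 2" "Suc b \<le> n div 2" using i j 2 by linarith+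
    ultimately show ?thesis unfolding e_def using T[of "Suc a" "Suc b"] by auto
  next
    case 3
    moreover have "Suc a \<le> n div 2" "Suc b \<le> (n + 1) div 2" using i j 3 by linarith+
    ultimately show ?thesis unfolding e_def using yx by auto
  next
    case 4
    moreover have "Suc a \<le> n div 2" "Suc b \<le> n div 2" using i j 4 by linarith+
    ultimately show ?thesis unfolding e_def using YY[of "Suc a" "Suc b"] by auto presburger
  qed
qed

text \<open>The Gram matrix alone would not give an orthogonal complement, as it is singular. The
  clauses of \<open>jordan_family\<close> about arbitrary w make orthogonality on one side imply
  orthogonality on the other, up to the two end positions.\<close>

lemma jordan_family_split:
  fixes A :: "'a :: field mat"
  assumes A: "A \<in> carrier_mat m m" and n: "n \<ge> 2" and e: "jordan_family A n e"
  shows "\<exists>d A2. m = n + d \<and> A2 \<in> carrier_mat d d \<and> congruent_mat A (dsum (jordan_block n 0) A2)"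
proof -
  note e = e[unfolded jordan_family_def]
  have e0: "bf A w (e 0) = 0" for w using e by blast
  have e2: "bf A w (e (i + 2)) = bf A (e i) w" if "i + 2 < n" for i w using e that by blast
  have en: "bf A (e (n - 1)) w = 0" for w using e by blast
  have gr: "bf A (e i) (e j) = (if j = Suc i then 1 else 0)" if "i < n" "j < n" for i j using e that by blast
  define S where "S = mat m n (\<lambda>(i,j). e j i)"
  \<comment> \<open>Coordinate i is read off by multiplying with \<open>e (Suc i)\<close> from the
    right. The last coordinate has no such partner and is read off with \<open>e (n - 2)\<close>
    from the left, which is where n \<ge> 2 enters.\<close>
  define L where "L = mat n m (\<lambda>(i,j). if Suc i < n then bf A (ue j) (e (Suc i)) else bf A (e (n - 2)) (ue j))"
  have S: "S \<in> carrier_mat m n" and L: "L \<in> carrier_mat n m" unfolding S_def L_def by auto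
  have Sc: "bf A (\<lambda>l. S $$ (l,i)) w = bf A (e i) w" "bf A w (\<lambda>l. S $$ (l,i)) = bf A w (e i)" if "i < n" for i w
    using that A by (auto intro!: bf_cong simp: S_def)
  have Lv: "(L *\<^sub>v v) $ i = (if Suc i < n then bf A (\<lambda>j. v $ j) (e (Suc i)) else bf A (e (n - 2)) (\<lambda>j. v $ j))"
    if "i < n" "v \<in> carrier_vec m" for i v
  proof -
    have "(L *\<^sub>v v) $ i = (\<Sum>j<m. v $ j * L $$ (i,j))"
      using that L by (simp add: scalar_prod_def lessThan_atLeast0 mult.commute)
    then show ?thesis
      using that A bf_expand_left[of A "\<lambda>j. v $ j" "e (Suc i)"] bf_expand_right[of A "e (n - 2)" "\<lambda>j. v $ j"]
      by (simp add: L_def)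
  qed
  have LS: "L * S = 1\<^sub>m n"
  proof (rule eq_matI)
    fix i j assume "i < dim_row (1\<^sub>m n :: 'a mat)" "j < dim_col (1\<^sub>m n :: 'a mat)"
    then have ij: "i < n" "j < n" by auto
    have v: "bf A (\<lambda>l. col S j $ l) w = bf A (e j) w" "bf A w (\<lambda>l. col S j $ l) = bf A w (e j)" for w
      using ij A S by (auto intro!: bf_cong simp: S_def)
    have "(L * S) $$ (i,j) = (L *\<^sub>v col S j) $ i" using L S ij by simp
    also have "\<dots> = 1\<^sub>m n $$ (i,j)"
      using Lv[OF ij(1), of "col S j"] S ij n gr[of j "Suc i"] gr[of "n - 2" j] unfolding v by auto
    finally show "(L * S) $$ (i,j) = 1\<^sub>m n $$ (i,j)" .
  qed (use L S in auto)
  have SA: "(transpose_mat S * B *\<^sub>v v) $ i = bf B (e i) (\<lambda>j. v $ j)"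
    if "B \<in> carrier_mat m m" "v \<in> carrier_vec m" "i < n" for B v i
    unfolding S_def by (rule gram_vec_index[OF that])
  have orth: "transpose_mat S * A *\<^sub>v v = 0\<^sub>v n \<and> transpose_mat S * transpose_mat A *\<^sub>v v = 0\<^sub>v n"
    if v: "v \<in> carrier_vec m" and 0: "L *\<^sub>v v = 0\<^sub>v n" for v
  proof -
    let ?v = "\<lambda>j. v $ j"
    have z: "(if Suc i < n then bf A ?v (e (Suc i)) else bf A (e (n - 2)) ?v) = 0" if "i < n" for i
      using Lv[OF that v] 0 that by simp
    have r: "bf A ?v (e i) = 0" if "i < n" for i
      using z[of "i - 1"] e0[of ?v] that by (cases i) auto
    \<comment> \<open>A product from the left equals the product from the right two positions
      further on. Of the two remaining positions, one is the last row of L and the other is the end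
      of the family, whose left products vanish.\<close>
    have l: "bf A (e i) ?v = 0" if "i < n" for i
    proof -
      have "i + 2 < n \<or> i = n - 2 \<or> i = n - 1" using that by linarith
      then consider "i + 2 < n" | "i = n - 2" | "i = n - 1" by blast
      then show ?thesis
      proof cases
        case 1
        then show ?thesis using e2[of i ?v] r[of "i + 2"] by simp
      next
        case 2
        then show ?thesis using z[of "n - 1"] n by auto
      next
        case 3
        then show ?thesis using en by simp
      qed
    qed
    show ?thesis
      using SA[OF A v] SA[of "transpose_mat A", OF _ v] A S r l
      by (auto intro!: eq_vecI simp: bf_transpose[OF A] simp del: index_mult_mat_vec)
  qed
  have "transpose_mat S * A * S = jordan_block n 0"
  proof (rule eq_matI)
    fix i j assume "i < dim_row (jordan_block n (0::'a))" "j < dim_col (jordan_block n (0::'a))"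
    then have ij: "i < n" "j < n" by auto
    show "(transpose_mat S * A * S) $$ (i,j) = jordan_block n 0 $$ (i,j)"
      using gram_index[OF A S S ij] gr[OF ij] ij by (auto simp: Sc)
  qed (use S in auto)
  with congruent_mat_split[OF A S L LS orth] show ?thesis by simp
qed

lemma null_zero [simp]: "null A (\<lambda>_. 0)"
  unfolding null_def by simp

text \<open>Two links lower both indices by one without changing the value, until one index is
  0.\<close>

lemma singular_chain_isotropic:
  assumes "singular_chain A k x"
  shows "bf A (x i) (x j) = 0"
proof (induct i arbitrary: j)
  case 0
  then show ?case using assms unfolding singular_chain_def by simp
next
  case (Suc i)
  show ?case
  proof (cases j)
    case 0
    then show ?thesis using assms unfolding singular_chain_def by simp
  next
    case (Suc j')
    have "bf A (x (Suc i)) (x (Suc j')) = bf A (x j') (x (Suc i))"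
      using assms unfolding singular_chain_def by blast
    also have "\<dots> = bf A (x i) (x j')"
      using assms unfolding singular_chain_def by blast
    finally show ?thesis using Suc.hyps Suc by simp
  qed
qed

text \<open>A singular chain of least length k among those leaving the radical is used. Minimality
  excludes the second alternative of \<open>dual_chain\<close>, so k - 1 dual vectors exist, and
  together the two families span a block of size 2 * k - 1.\<close>

lemma jordan_family_odd:
  fixes A :: "'a :: field mat"
  assumes ex: "\<exists>k x. singular_chain A k x \<and> (\<exists>j. \<not> null A (x j))"
  shows "\<exists>n e. n \<ge> 2 \<and> jordan_family A n e"
proof -
  let ?P = "\<lambda>k. \<exists>x. singular_chain A k x \<and> (\<exists>j. \<not> null A (x j))"
  define k where "k = (LEAST k. ?P k)"
  have Pk: "?P k" unfolding k_def by (rule LeastI_ex[OF ex])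
  have min: "\<not> ?P k'" if "k' < k" for k' using that unfolding k_def by (rule not_less_Least)
  from Pk obtain x j1 where x: "singular_chain A k x" and j1: "\<not> null A (x j1)" by blast
  have x0: "x 0 = (\<lambda>_. 0)" and xk: "\<And>j. k < j \<Longrightarrow> x j = (\<lambda>_. 0)"
    and xs: "\<And>j w. bf A w (x (Suc j)) = bf A (x j) w" using x unfolding singular_chain_def by auto
  have k1: "k \<ge> 1"
  proof (rule ccontr)
    assume "\<not> k \<ge> 1"
    then have "x j1 = (\<lambda>_. 0)" using x0 xk[of j1] by (cases j1) auto
    then show False using j1 by simp
  qed
  \<comment> \<open>A first member in the radical could be dropped, which would shorten the
    chain.\<close>
  have x1: "\<not> null A (x 1)"
  proof
    assume n1: "null A (x 1)"
    define x' where "x' = (\<lambda>j. if j = 0 then (\<lambda>_. 0) else x (Suc j))"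
    have "singular_chain A (k - 1) x'"
      unfolding singular_chain_def
    proof (intro conjI allI impI)
      show "x' 0 = (\<lambda>_. 0)" unfolding x'_def by simp
      show "x' j = (\<lambda>_. 0)" if "k - 1 < j" for j using that xk unfolding x'_def by auto
      show "bf A w (x' (Suc j)) = bf A (x' j) w" for j w
        using xs[of w "Suc j"] n1 unfolding x'_def null_def by (cases j) auto
    qed
    moreover have "\<not> null A (x' (j1 - 1))"
    proof -
      have "j1 \<noteq> 0" "j1 \<noteq> 1" using j1 x0 n1 by (metis null_zero)+
      then have "x' (j1 - 1) = x j1" unfolding x'_def by auto
      then show ?thesis using j1 by simp
    qed
    ultimately show False using min[of "k - 1"] k1 by auto
  qed
  have k2: "k \<ge> 2"
  proof (rule ccontr)
    assume "\<not> k \<ge> 2"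
    then have "k = 1" using k1 by simp
    then have "null A (x 1)"
      unfolding null_def using xs[of _ 0] xs[of _ 1] x0 xk[of 2] by (simp add: numeral_2_eq_2)
    with x1 show False by simp
  qed
  \<comment> \<open>A continuation of \<open>x 1\<close> that closes up after q steps has q + 1 = k
    - 1 members and would be a shorter singular chain.\<close>
  define q where "q = k - 2"
  have kq: "k = Suc (Suc q)" using k2 unfolding q_def by simp
  have noz: "\<not> (\<exists>z. z 0 = x 1 \<and> (\<forall>j<q. \<forall>w. bf A w (z (Suc j)) = 0 * bf A (z (Suc j)) w + bf A (z j) w) \<and>
      (Suc q = Suc q \<longrightarrow> (\<forall>w. bf A (z q) w = 0)))"
  proof
    assume "\<exists>z. z 0 = x 1 \<and> (\<forall>j<q. \<forall>w. bf A w (z (Suc j)) = 0 * bf A (z (Suc j)) w + bf A (z j) w) \<and>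
      (Suc q = Suc q \<longrightarrow> (\<forall>w. bf A (z q) w = 0))"
    then obtain z where z: "z 0 = x 1" "\<And>j w. j < q \<Longrightarrow> bf A w (z (Suc j)) = bf A (z j) w"
      "\<And>w. bf A (z q) w = 0" by auto
    define x' where "x' = (\<lambda>j. if 1 \<le> j \<and> j \<le> Suc q then z (j - 1) else (\<lambda>_. 0))"
    have "singular_chain A (Suc q) x'"
      unfolding singular_chain_def
    proof (intro conjI allI impI)
      show "x' 0 = (\<lambda>_. 0)" unfolding x'_def by simp
      show "x' j = (\<lambda>_. 0)" if "Suc q < j" for j using that unfolding x'_def by auto
      fix j w
      consider "j = 0" | i where "j = Suc i" "i < q" | "j = Suc q" | "j > Suc q"
        by (cases j) (auto, metis linorder_neqE_nat)
      then show "bf A w (x' (Suc j)) = bf A (x' j) w"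
      proof cases
        case 1
        then show ?thesis using xs[of w 0] x0 z unfolding x'_def by simp
      next
        case (2 i)
        then show ?thesis using z(2)[of i w] unfolding x'_def by simp
      next
        case 3
        then show ?thesis using z(3)[of w] unfolding x'_def by simp
      next
        case 4
        then show ?thesis unfolding x'_def by simp
      qed
    qed
    moreover have "\<not> null A (x' 1)" using x1 z unfolding x'_def by simp
    ultimately show False using min[of "Suc q"] kq by auto
  qed
  from dual_chain[of "Suc q" q A 0 "x 1"] noz
  obtain y where *: "(\<forall>j. j = 0 \<or> Suc q < j \<longrightarrow> y j = (\<lambda>_. 0)) \<and>
      (\<forall>j w. 1 \<le> j \<and> j \<le> q \<longrightarrow> bf A (y j) w = 0 * bf A w (y j) + bf A w (y (Suc j))) \<and>
      bf A (x 1) (y 1) \<noteq> 0" by blast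
  have y0: "\<And>j. j = 0 \<or> Suc q < j \<Longrightarrow> y j = (\<lambda>_. 0)" and y1: "bf A (x 1) (y 1) \<noteq> 0"
    using * by blast+
  have ys: "bf A (y j) w = bf A w (y (Suc j))" if "1 \<le> j" "j \<le> q" for j w
    using * that by (metis add_0 mult_zero_left)
  define t where "t = bf A (x 1) (y 1)"
  have Tstep: "bf A (x (Suc i)) (y (Suc j)) = bf A (x i) (y j)" if "1 \<le> j" "j \<le> q" for i j
    using ys[OF that, of "x (Suc i)"] xs[of "y j" i] by simp
  have Tshift: "bf A (x (i + s)) (y (j + s)) = bf A (x i) (y j)" if "1 \<le> j" "j + s \<le> Suc q" for i j s
    using that
  proof (induct s)
    case (Suc s)
    then show ?case using Tstep[of "j + s" "i + s"] by simp
  qed simp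
  \<comment> \<open>A simultaneous shift of indices does not change the pairing. Downwards it ends
    at \<open>x 0\<close>, upwards at \<open>x k\<close>, and both give 0, so only entries with
    equal indices survive.\<close>
  have xend: "bf A (x k) w = 0" for w using xs[of w k] xk[of "Suc k"] by simp
  have T: "bf A (x i) (y j) = (if i = j then t else 0)" if j: "1 \<le> j" "j \<le> Suc q" and i: "i \<le> k" for i j
  proof -
    consider "i = j" | "i < j" | "j < i" by linarith
    then show ?thesis
    proof cases
      case 1
      then show ?thesis using Tshift[of 1 "j - 1" 1] j unfolding t_def by simp
    next
      case 2
      then show ?thesis using Tshift[of "j - i" i 0] j x0 by simp
    next
      case 3
      then show ?thesis using Tshift[of j "k - i" i] j i xend kq by simp
    qed
  qed
  define y1 where "y1 = (\<lambda>j i. inverse t * y j i)"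
  have t0: "t \<noteq> 0" using y1 unfolding t_def .
  have T1: "bf A (x i) (y1 j) = (if i = j then 1 else 0)" if "1 \<le> j" "j \<le> Suc q" "i \<le> k" for i j
    using T[OF that] t0 unfolding y1_def bf_smult_right by simp
  have y1s: "bf A (y1 j) w = bf A w (y1 (Suc j))" if "1 \<le> j" "j \<le> q" for j w
    using ys[OF that, of w] unfolding y1_def bf_smult_right bf_smult_left by simp
  define g where "g = (\<lambda>i j. bf A (y1 i) (y1 j))"
  have g1: "g i (Suc j) = g j i" if "1 \<le> j" "j \<le> q" for i j
    unfolding g_def using y1s[OF that, of "y1 i"] by simp
  have g2: "g (Suc i) (Suc j) = g i j" if "1 \<le> i" "i \<le> q" "1 \<le> j" "j \<le> q" for i j
    using g1[OF that(3,4), of "Suc i"] g1[OF that(1,2), of j] by simp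
  have g3: "g (i + s) (j + s) = g i j" if "1 \<le> i" "1 \<le> j" "i + s \<le> Suc q" "j + s \<le> Suc q" for i j s
    using that
  proof (induct s)
    case (Suc s)
    then show ?case using g2[of "i + s" "j + s"] by simp
  qed simp
  \<comment> \<open>Adding shifts of x respects the links of the dual chain and, as x is isotropic,
    its pairing with x. Each entry of the Gram matrix \<open>g\<close> is met by exactly one of the
    two linear correction terms, according to whether j \<le> i or i < j, so nothing has to be
    halved. The factor 1 fits the shape of \<open>bf_add_left\<close>.\<close>
  define y2 where "y2 = (\<lambda>j i. y1 j i + 1 * (\<Sum>d\<in>{1..Suc q}. (- g d 1) * x (j + d) i))"
  have y2l: "bf A (y2 j) w = bf A (y1 j) w - (\<Sum>d\<in>{1..Suc q}. g d 1 * bf A (x (j + d)) w)" for j w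
    unfolding y2_def by (simp only: bf_add_left bf_sum_left) (simp add: sum_negf)
  have y2r: "bf A w (y2 j) = bf A w (y1 j) - (\<Sum>d\<in>{1..Suc q}. g d 1 * bf A w (x (j + d)))" for j w
    unfolding y2_def by (simp only: bf_add_right bf_sum_right) (simp add: sum_negf)
  have y2s: "bf A (y2 j) w = bf A w (y2 (Suc j))" if "1 \<le> j" "j \<le> q" for j w
    unfolding y2l y2r using y1s[OF that, of w] xs by simp
  have xx: "bf A (x i) (x j) = 0" for i j using singular_chain_isotropic[OF x] .
  have T2: "bf A (x i) (y2 j) = (if i = j then 1 else 0)" if "1 \<le> j" "j \<le> Suc q" "i \<le> k" for i j
    unfolding y2r using T1[OF that] xx by simp
  have y1x: "bf A (y1 i) (x l) = (if l = Suc i then 1 else 0)" if "1 \<le> i" "i \<le> Suc q" for i l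
  proof (cases "l \<le> Suc k")
    case True
    then show ?thesis
      using T1[of i "l - 1"] xs[of "y1 i" "l - 1"] that x0 by (cases l) auto
  next
    case False
    then show ?thesis using xk[of l] that kq by auto
  qed
  have x_y1: "bf A (x l) (y1 j) = (if l = j then 1 else 0)" if "1 \<le> j" "j \<le> Suc q" for l j
  proof (cases "l \<le> k")
    case True
    then show ?thesis using T1 that by simp
  next
    case False
    then show ?thesis using xk[of l] that kq by auto
  qed
  have YY: "bf A (y2 i) (y2 j) = 0" if i: "1 \<le> i" "i \<le> Suc q" and j: "1 \<le> j" "j \<le> Suc q" for i j
  proof -
    have a: "(\<Sum>d\<in>{1..Suc q}. g d 1 * bf A (y1 i) (x (j + d))) = (if j \<le> i then g (Suc i - j) 1 else 0)"
    proof -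
      have "(\<Sum>d\<in>{1..Suc q}. g d 1 * bf A (y1 i) (x (j + d))) = (\<Sum>d\<in>{1..Suc q}. if d = Suc i - j then g d 1 else 0)"
        using y1x[OF i] by (intro sum.cong) auto
      then show ?thesis using i j by auto
    qed
    have b: "(\<Sum>d\<in>{1..Suc q}. g d 1 * bf A (x (i + d)) (y1 j)) = (if i < j then g (j - i) 1 else 0)"
    proof -
      have "(\<Sum>d\<in>{1..Suc q}. g d 1 * bf A (x (i + d)) (y1 j)) = (\<Sum>d\<in>{1..Suc q}. if d = j - i then g d 1 else 0)"
        using x_y1[OF j] by (intro sum.cong) auto
      then show ?thesis using i j by auto
    qed
    have "bf A (y2 i) (y2 j) = g i j - (if j \<le> i then g (Suc i - j) 1 else 0) - (if i < j then g (j - i) 1 else 0)"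
      unfolding y2l y2r using a b by (simp add: xx g_def)
    also have "\<dots> = 0"
    proof (cases "j \<le> i")
      case True
      then show ?thesis using g3[of "Suc i - j" 1 "j - 1"] i j by auto
    next
      case False
      then have "g i j = g (j - 1) i" using g1[of "j - 1" i] i j by (cases j) auto
      also have "\<dots> = g (j - i) 1" using g3[of "j - i" 1 "i - 1"] i j False by auto
      finally show ?thesis using False by simp
    qed
    finally show ?thesis .
  qed
  let ?n = "2 * k - 1"
  have "jordan_family A ?n (\<lambda>i. if even i then x (i div 2 + 1) else y2 (i div 2 + 1))"
  proof (rule jordan_family_interleave)
    show "1 \<le> ?n" using k2 by simp
    show "x 0 = (\<lambda>_. 0)" by (rule x0)
    show "bf A w (x (Suc i)) = bf A (x i) w" for i w by (rule xs)
    show "bf A (y2 j) w = bf A w (y2 (Suc j))" if "1 \<le> j" "Suc j \<le> ?n div 2" for j w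
      using that kq by (intro y2s) auto
    have "?n - 1 = 2 * (k - 1)" using k2 by simp
    then show "bf A (if even (?n - 1) then x ((?n - 1) div 2 + 1) else y2 ((?n - 1) div 2 + 1)) w = 0" for w
      using xend k2 by simp
    show "bf A (x i) (y2 j) = (if i = j then 1 else 0)" if "i \<le> (?n + 1) div 2" "1 \<le> j" "j \<le> ?n div 2" for i j
      using that kq by (intro T2) auto
    show "bf A (x i) (x j) = 0" for i j by (rule xx)
    show "bf A (y2 i) (y2 j) = 0" if "1 \<le> i" "i \<le> ?n div 2" "1 \<le> j" "j \<le> ?n div 2" for i j
      using that kq by (intro YY) auto
  qed
  moreover have "?n \<ge> 2" using k2 by simp
  ultimately show ?thesis by blast
qed

text \<open>A chain longer than the dimension is linearly dependent, and the dependency can be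
  shifted down the chain until only a multiple of \<open>x 1\<close> is left. The shifts are linked
  to each other and begin with a null vector. Without one-sided kernel all of them are null; for l =
  0 they form, in reverse order, a singular chain. Either way \<open>x 1\<close> would be null or
  the hypothesis contradicted.\<close>

lemma chain_length_bounded:
  fixes A :: "'a :: field mat"
  assumes x: "chain A l k x" and x1: "\<not> null A (x 1)"
    and hyp: "l = 0 \<and> \<not> (\<exists>k x. singular_chain A k x \<and> (\<exists>j. \<not> null A (x j))) \<or>
      (\<forall>x. (\<forall>w. bf A x w = 0) \<longrightarrow> null A x)"
  shows "k \<le> dim_row A"
proof (rule ccontr)
  assume "\<not> k \<le> dim_row A"
  define m where "m = dim_row A"
  have km: "m < k" using \<open>\<not> k \<le> dim_row A\<close> m_def by simp
  have x0: "x 0 = (\<lambda>_. 0)" and xs: "\<And>j w. j < k \<Longrightarrow> bf A w (x (Suc j)) = l * bf A (x (Suc j)) w + bf A (x j) w"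
    using x unfolding chain_def by auto
  define X where "X = mat m (Suc m) (\<lambda>(i,j). x (Suc j) i)"
  have "X \<in> carrier_mat m (Suc m)" unfolding X_def by auto
  from exists_kernel_vec_wide[OF this] obtain v where v: "v \<in> carrier_vec (Suc m)" "v \<noteq> 0\<^sub>v (Suc m)"
    "X *\<^sub>v v = 0\<^sub>v m" by auto
  define c where "c = (\<lambda>j. if 1 \<le> j \<and> j \<le> Suc m then v $ (j - 1) else 0)"
  have dep: "(\<Sum>j\<in>{1..Suc m}. c j * x j i) = 0" if i: "i < m" for i
  proof -
    have "(X *\<^sub>v v) $ i = (\<Sum>j\<in>{0..<Suc m}. x (Suc j) i * v $ j)"
      using v(1) i unfolding X_def by (simp add: scalar_prod_def del: sum.op_ivl_Suc)
    also have "\<dots> = (\<Sum>j\<in>{Suc 0..<Suc (Suc m)}. c j * x j i)"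
      by (subst sum.shift_bounds_Suc_ivl) (auto simp: c_def mult.commute intro!: sum.cong)
    also have "{Suc 0..<Suc (Suc m)} = {1..Suc m}" by auto
    finally show ?thesis using v(3) i by simp
  qed
  \<comment> \<open>After r - 1 shifts only the term of the last nonzero coefficient survives, since
    all earlier members have reached \<open>x 0 = 0\<close>.\<close>
  define r where "r = Max {j. c j \<noteq> 0}"
  have fin: "finite {j. c j \<noteq> 0}" by (rule finite_subset[of _ "{1..Suc m}"]) (auto simp: c_def)
  have ne: "{j. c j \<noteq> 0} \<noteq> {}"
  proof -
    obtain i where "i < Suc m" "v $ i \<noteq> 0" using v by (metis carrier_vecD eq_vecI index_zero_vec)
    then have "c (Suc i) \<noteq> 0" unfolding c_def by auto
    then show ?thesis by auto
  qed
  have cr: "c r \<noteq> 0" using Max_in[OF fin ne] unfolding r_def by simp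
  have rmax: "c j = 0" if "r < j" for j
  proof (rule ccontr)
    assume "c j \<noteq> 0"
    then have "j \<le> r" unfolding r_def using fin by (intro Max_ge) auto
    with that show False by simp
  qed
  have r: "1 \<le> r" "r \<le> Suc m" using cr unfolding c_def by (auto split: if_splits)
  define u where "u = (\<lambda>s i. \<Sum>j\<in>{1..Suc m}. c j * x (j - s) i)"
  have us: "bf A w (u s) = l * bf A (u s) w + bf A (u (Suc s)) w" for s w
  proof -
    have "bf A w (x (j - s)) = l * bf A (x (j - s)) w + bf A (x (j - Suc s)) w" if "j \<in> {1..Suc m}" for j
    proof (cases "j \<le> s")
      case True
      then show ?thesis using x0 by simp
    next
      case False
      then have "j - s = Suc (j - Suc s)" "j - Suc s < k" using that km by auto
      then show ?thesis using xs[of "j - Suc s" w] by simp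
    qed
    then show ?thesis
      unfolding u_def bf_sum_left bf_sum_right
      by (simp add: sum_distrib_left sum.distrib[symmetric] algebra_simps)
  qed
  have u0: "null A (u 0)"
  proof -
    have "u 0 i = 0" if "i < dim_row A" for i using dep[of i] that unfolding u_def m_def by simp
    then have "bf A (u 0) w = bf A (\<lambda>_. 0) w" "bf A w (u 0) = bf A w (\<lambda>_. 0)" for w
      by (intro bf_cong; simp)+
    then show ?thesis unfolding null_def by simp
  qed
  have ur: "u r = (\<lambda>_. 0)"
  proof
    fix i
    have "c j * x (j - r) i = 0" for j using rmax[of j] x0 by (cases "j \<le> r") auto
    then show "u r i = 0" unfolding u_def by (intro sum.neutral ballI)
  qed
  have ur1: "u (r - 1) = (\<lambda>i. c r * x 1 i)"
  proof
    fix i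
    have "c j * x (j - (r - 1)) i = (if j = r then c r * x 1 i else 0)" for j
      using rmax[of j] x0 r by (cases j r rule: linorder_cases) auto
    then have "u (r - 1) i = (\<Sum>j\<in>{1..Suc m}. if j = r then c r * x 1 i else 0)"
      unfolding u_def by (intro sum.cong refl)
    then show "u (r - 1) i = c r * x 1 i" using r by (simp del: sum.cl_ivl_Suc)
  qed
  have nn: "\<not> null A (u (r - 1))"
    using x1 cr unfolding ur1 null_def bf_smult_left bf_smult_right by auto
  from hyp show False
  proof
    assume "\<forall>x. (\<forall>w. bf A x w = 0) \<longrightarrow> null A x"
    then have nd: "null A x" if "\<And>w. bf A x w = 0" for x using that by blast
    have "null A (u s)" for s
    proof (induct s)
      case 0
      show ?case by (rule u0)
    next
      case (Suc s)
      then have "bf A (u (Suc s)) w = 0" for w using us[of w s] unfolding null_def by simp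
      then show ?case by (rule nd)
    qed
    with nn show False by simp
  next
    assume h: "l = 0 \<and> \<not> (\<exists>k x. singular_chain A k x \<and> (\<exists>j. \<not> null A (x j)))"
    have r2: "r \<noteq> 1" using u0 nn by auto
    define x' where "x' = (\<lambda>j. if 1 \<le> j \<and> j < r then u (r - j) else (\<lambda>_. 0))"
    have "singular_chain A r x'"
      unfolding singular_chain_def
    proof (intro conjI allI impI)
      show "x' 0 = (\<lambda>_. 0)" unfolding x'_def by simp
      show "x' j = (\<lambda>_. 0)" if "r < j" for j using that unfolding x'_def by auto
      fix j w
      have us0: "bf A w (u s) = bf A (u (Suc s)) w" for s using us[of w s] h by simp
      have "j = 0 \<or> (1 \<le> j \<and> Suc j < r) \<or> (1 \<le> j \<and> Suc j = r) \<or> r \<le> j" by linarith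
      then show "bf A w (x' (Suc j)) = bf A (x' j) w"
      proof (elim disjE conjE)
        assume "j = 0"
        then show ?thesis using us0[of "r - 1"] ur r r2 unfolding x'_def by simp
      next
        assume j: "1 \<le> j" "Suc j < r"
        then have "r - j = Suc (r - Suc j)" by simp
        then show ?thesis using us0[of "r - Suc j"] j unfolding x'_def by simp
      next
        assume j: "1 \<le> j" "Suc j = r"
        then show ?thesis using us0[of 0] u0 unfolding x'_def null_def by auto
      next
        assume "r \<le> j"
        then show ?thesis unfolding x'_def by simp
      qed
    qed
    moreover have "x' 1 = u (r - 1)" using r r2 unfolding x'_def by simp
    ultimately show False using h nn by metis
  qed
qed

text \<open>For a chain of greatest length k, a sequence z prolonging \<open>x 1\<close> by k
  further links would be a chain of length k + 1. This leaves the first alternative of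
  \<open>dual_chain\<close>, a dual of full length.\<close>

lemma maximal_chain_dual:
  fixes A :: "'a :: field mat"
  assumes x1: "\<not> null A x1" "\<And>w. bf A w x1 = l * bf A x1 w"
    and hyp: "l = 0 \<and> \<not> (\<exists>k x. singular_chain A k x \<and> (\<exists>j. \<not> null A (x j))) \<or>
      (\<forall>x. (\<forall>w. bf A x w = 0) \<longrightarrow> null A x)"
  shows "\<exists>k x y. 1 \<le> k \<and> chain A l k x \<and> (\<forall>j. j = 0 \<or> k < j \<longrightarrow> y j = (\<lambda>_. 0)) \<and>
     (\<forall>j w. 1 \<le> j \<longrightarrow> bf A (y j) w = l * bf A w (y j) + bf A w (y (Suc j))) \<and> bf A (x 1) (y 1) \<noteq> 0"
proof -
  let ?P = "\<lambda>k. \<exists>x. chain A l k x \<and> \<not> null A (x 1)"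
  have P1: "?P 1"
    using x1 unfolding chain_def by (intro exI[of _ "\<lambda>j. if j = 0 then (\<lambda>_. 0) else x1"]) auto
  have bound: "\<forall>k. ?P k \<longrightarrow> k \<le> dim_row A" using chain_length_bounded hyp by blast
  from ex_has_greatest_nat[of ?P 1 "\<lambda>k. k" "Suc (dim_row A)"] P1 bound
  obtain k where k: "?P k" "\<And>k'. ?P k' \<Longrightarrow> k' \<le> k" by (metis less_Suc_eq_le)
  have k1: "1 \<le> k" using k(2)[OF P1] .
  from k(1) obtain x where x: "chain A l k x" "\<not> null A (x 1)" by blast
  have x0: "x 0 = (\<lambda>_. 0)" and xs: "\<And>j w. j < k \<Longrightarrow> bf A w (x (Suc j)) = l * bf A (x (Suc j)) w + bf A (x j) w"
    using x unfolding chain_def by auto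
  have noz: "\<not> (\<exists>z. z 0 = x 1 \<and> (\<forall>j<k. \<forall>w. bf A w (z (Suc j)) = l * bf A (z (Suc j)) w + bf A (z j) w) \<and>
      (k = Suc k \<longrightarrow> (\<forall>w. bf A (z k) w = 0)))"
  proof
    assume "\<exists>z. z 0 = x 1 \<and> (\<forall>j<k. \<forall>w. bf A w (z (Suc j)) = l * bf A (z (Suc j)) w + bf A (z j) w) \<and>
      (k = Suc k \<longrightarrow> (\<forall>w. bf A (z k) w = 0))"
    then obtain z where z: "z 0 = x 1" "\<And>j w. j < k \<Longrightarrow> bf A w (z (Suc j)) = l * bf A (z (Suc j)) w + bf A (z j) w"
      by auto
    define x' where "x' = (\<lambda>j. if j = 0 then (\<lambda>_. 0) else z (j - 1))"
    have "chain A l (Suc k) x'"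
      unfolding chain_def
    proof (intro conjI allI impI)
      show "x' 0 = (\<lambda>_. 0)" unfolding x'_def by simp
      show "bf A w (x' (Suc j)) = l * bf A (x' (Suc j)) w + bf A (x' j) w" if "j < Suc k" for j w
        using that z xs[of 0 w] k1 x0 unfolding x'_def by (cases j) auto
    qed
    moreover have "\<not> null A (x' 1)" using x z unfolding x'_def by simp
    ultimately have "Suc k \<le> k" by (intro k(2)) blast
    then show False by simp
  qed
  from dual_chain[of k k A l "x 1"] noz
  obtain y where *: "(\<forall>j. j = 0 \<or> k < j \<longrightarrow> y j = (\<lambda>_. 0)) \<and>
      (\<forall>j w. 1 \<le> j \<and> j \<le> k \<longrightarrow> bf A (y j) w = l * bf A w (y j) + bf A w (y (Suc j))) \<and>
      bf A (x 1) (y 1) \<noteq> 0" by blast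
  have y0: "\<And>j. j = 0 \<or> k < j \<Longrightarrow> y j = (\<lambda>_. 0)"
    and ys: "\<And>j w. 1 \<le> j \<Longrightarrow> j \<le> k \<Longrightarrow> bf A (y j) w = l * bf A w (y j) + bf A w (y (Suc j))"
    and y1: "bf A (x 1) (y 1) \<noteq> 0" using * by blast+
  \<comment> \<open>Beyond k all members are zero, so the links may be used for every j \<ge>
    1.\<close>
  have "bf A (y j) w = l * bf A w (y j) + bf A w (y (Suc j))" if "1 \<le> j" for j w
    using ys[OF that, of w] y0 by (cases "j \<le> k") auto
  then show ?thesis using k1 x y0 y1 by blast
qed

text \<open>A link of x and a link of y expand the same product
  \<open>bf A (y j) (x (Suc i))\<close>, and the terms with factor l agree. What remains says that
  raising both indices preserves the pairing.\<close>

lemma chain_dual_toeplitz: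
  fixes A :: "'a :: field mat"
  assumes x: "chain A l k x"
    and ys: "\<And>j w. 1 \<le> j \<Longrightarrow> bf A (y j) w = l * bf A w (y j) + bf A w (y (Suc j))"
    and j: "1 \<le> j" and i: "i \<le> k"
  shows "bf A (x i) (y j) = (if j \<le> i then bf A (x (Suc (i - j))) (y 1) else 0)"
proof -
  have x0: "x 0 = (\<lambda>_. 0)" and xs: "\<And>j w. j < k \<Longrightarrow> bf A w (x (Suc j)) = l * bf A (x (Suc j)) w + bf A (x j) w"
    using x unfolding chain_def by auto
  have step: "bf A (x (Suc i)) (y (Suc j)) = bf A (x i) (y j)" if "1 \<le> j" "i < k" for i j
    using ys[OF that(1), of "x (Suc i)"] xs[OF that(2), of "y j"] by simp
  have shift: "bf A (x (i + s)) (y (j + s)) = bf A (x i) (y j)" if "1 \<le> j" "i + s \<le> k" for i j s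
    using that
  proof (induct s)
    case (Suc s)
    then show ?case using step[of "j + s" "i + s"] by simp
  qed simp
  show ?thesis
  proof (cases "j \<le> i")
    case True
    then show ?thesis using shift[of 1 "Suc (i - j)" "j - 1"] i j by simp
  next
    case False
    then show ?thesis using shift[of "j - i" 0 i] i j x0 by simp
  qed
qed

text \<open>For l = 0 the links merely move indices: those of x can be lowered to 0 and those of the
  dual raised beyond k, so both families are isotropic without correction. Only the Toeplitz matrix
  between them has to be normalised.\<close>

lemma jordan_family_even:
  fixes A :: "'a :: field mat"
  assumes x1: "\<not> null A x1" "\<And>w. bf A w x1 = 0"
    and nosing: "\<not> (\<exists>k x. singular_chain A k x \<and> (\<exists>j. \<not> null A (x j)))"
  shows "\<exists>n e. n \<ge> 2 \<and> jordan_family A n e"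
proof -
  have e: "bf A w x1 = 0 * bf A x1 w" for w using x1 by simp
  obtain k x y where *: "1 \<le> k \<and> chain A 0 k x \<and> (\<forall>j. j = 0 \<or> k < j \<longrightarrow> y j = (\<lambda>_. 0)) \<and>
     (\<forall>j w. 1 \<le> j \<longrightarrow> bf A (y j) w = 0 * bf A w (y j) + bf A w (y (Suc j))) \<and> bf A (x 1) (y 1) \<noteq> 0"
    using maximal_chain_dual[OF x1(1) e] nosing by blast
  have k: "1 \<le> k" and x: "chain A 0 k x" and y0: "\<And>j. j = 0 \<or> k < j \<Longrightarrow> y j = (\<lambda>_. 0)"
    and ys0: "\<And>j w. 1 \<le> j \<Longrightarrow> bf A (y j) w = 0 * bf A w (y j) + bf A w (y (Suc j))"
    and y1: "bf A (x 1) (y 1) \<noteq> 0" using * by blast+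
  have ys: "bf A (y j) w = bf A w (y (Suc j))" if "1 \<le> j" for j w using ys0[OF that] by simp
  have x0: "x 0 = (\<lambda>_. 0)" and xs: "\<And>j w. j < k \<Longrightarrow> bf A w (x (Suc j)) = bf A (x j) w"
    using x unfolding chain_def by auto
  note T = chain_dual_toeplitz[where l = 0 and A = A and k = k and x = x and y = y, OF x ys0]
  \<comment> \<open>Lower triangular Toeplitz matrices multiply like power series, so the
    coefficients of \<open>inverse F\<close> give the combinations of shifts of y that are dual to
    x.\<close>
  define F where "F = Abs_fps (\<lambda>s. bf A (x (Suc s)) (y 1))"
  define c where "c = fps_nth (inverse F)"
  have F0: "fps_nth F 0 \<noteq> 0" unfolding F_def using y1 by simp
  have conv: "(\<Sum>s\<le>d. c s * bf A (x (Suc (d - s))) (y 1)) = (if d = 0 then 1 else 0)" for d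
  proof -
    have "inverse F * F = 1" using inverse_mult_eq_1[OF F0] .
    then have "fps_nth (inverse F * F) d = (if d = 0 then 1 else 0)" by simp
    then show ?thesis unfolding fps_mult_nth c_def F_def by (simp add: atLeast0AtMost)
  qed
  define y' where "y' = (\<lambda>j i. \<Sum>s<k. c s * y (j + s) i)"
  have y's: "bf A (y' j) w = bf A w (y' (Suc j))" if "1 \<le> j" for j w
    unfolding y'_def bf_sum_left bf_sum_right using ys that by simp
  have y'0: "y' j = (\<lambda>_. 0)" if "k < j" for j
    unfolding y'_def using y0 that by simp
  have T': "bf A (x i) (y' j) = (if i = j then 1 else 0)" if j: "1 \<le> j" and i: "i \<le> k" for i j
  proof -
    have "bf A (x i) (y' j) = (\<Sum>s<k. c s * (if j + s \<le> i then bf A (x (Suc (i - (j + s)))) (y 1) else 0))"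
      unfolding y'_def bf_sum_right using T[of "j + _" i] i j by (intro sum.cong) auto
    also have "\<dots> = (if i = j then 1 else 0)"
    proof (cases "j \<le> i")
      case True
      have "(\<Sum>s<k. c s * (if j + s \<le> i then bf A (x (Suc (i - (j + s)))) (y 1) else 0))
        = (\<Sum>s\<le>i - j. c s * bf A (x (Suc (i - j - s))) (y 1))"
        using True i j by (intro sum.mono_neutral_cong_right) auto
      then show ?thesis using conv[of "i - j"] True by simp
    next
      case False
      then show ?thesis by (auto intro!: sum.neutral)
    qed
    finally show ?thesis .
  qed
  have xx: "bf A (x i) (x j) = 0" if "i \<le> k" "j \<le> k" for i j
    using that
  proof (induct i arbitrary: j)
    case 0
    then show ?case using x0 by simp
  next
    case (Suc i)
    show ?case
    proof (cases j)
      case 0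
      then show ?thesis using x0 by simp
    next
      case (Suc j')
      then show ?thesis
        using xs[of j' "x (Suc i)"] xs[of i "x j'"] Suc.hyps[of j'] Suc.prems by simp
    qed
  qed
  have yy: "bf A (y' i) (y' j) = 0" if "1 \<le> i" "1 \<le> j" for i j
  proof -
    have step: "bf A (y' i) (y' j) = bf A (y' (Suc i)) (y' (Suc j))" if "1 \<le> i" "1 \<le> j" for i j
      using y's[OF that(1), of "y' j"] y's[OF that(2), of "y' (Suc i)"] by simp
    have "bf A (y' i) (y' j) = bf A (y' (i + s)) (y' (j + s))" for s
    proof (induct s)
      case (Suc s)
      then show ?case using step[of "i + s" "j + s"] that by simp
    qed simp
    from this[of k] show ?thesis using y'0[of "i + k"] that by simp
  qed
  let ?n = "2 * k"
  have "jordan_family A ?n (\<lambda>i. if even i then x (i div 2 + 1) else y' (i div 2 + 1))"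
  proof (rule jordan_family_interleave)
    show "1 \<le> ?n" using k by simp
    show "x 0 = (\<lambda>_. 0)" by (rule x0)
    show "bf A w (x (Suc i)) = bf A (x i) w" if "Suc i \<le> (?n + 1) div 2" for i w using that by (intro xs) auto
    show "bf A (y' j) w = bf A w (y' (Suc j))" if "1 \<le> j" "Suc j \<le> ?n div 2" for j w
      using that by (intro y's) auto
    have "?n - 1 = 2 * (k - 1) + 1" using k by simp
    then show "bf A (if even (?n - 1) then x ((?n - 1) div 2 + 1) else y' ((?n - 1) div 2 + 1)) w = 0" for w
      using y's[of k w] y'0[of "Suc k"] k by simp
    show "bf A (x i) (y' j) = (if i = j then 1 else 0)" if "i \<le> (?n + 1) div 2" "1 \<le> j" "j \<le> ?n div 2" for i j
      using that by (intro T') auto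
    show "bf A (x i) (x j) = 0" if "i \<le> (?n + 1) div 2" "j \<le> (?n + 1) div 2" for i j
      using that by (intro xx) auto
    show "bf A (y' i) (y' j) = 0" if "1 \<le> i" "i \<le> ?n div 2" "1 \<le> j" "j \<le> ?n div 2" for i j
      using that by (intro yy) auto
  qed
  moreover have "?n \<ge> 2" using k by simp
  ultimately show ?thesis by blast
qed

section \<open>Unipotent chains in characteristic 2\<close>

definition vanish_below :: "nat \<Rightarrow> nat \<Rightarrow> (nat \<Rightarrow> nat \<Rightarrow> 'a :: zero) \<Rightarrow> bool" where
  "vanish_below k c T \<longleftrightarrow> (\<forall>i\<le>k. \<forall>j\<le>k. i + j < c \<longrightarrow> T i j = 0)"

text \<open>The relation satisfied by the pairings of two chains for l = 1; \<open>gram_rel\<close>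
  is the stronger one for a chain paired with itself. Stated for arrays, they also apply to sums of
  a Gram matrix and a prescribed target.\<close>

definition pair_rel :: "nat \<Rightarrow> (nat \<Rightarrow> nat \<Rightarrow> 'a :: field) \<Rightarrow> bool" where
  "pair_rel k T \<longleftrightarrow> (\<forall>j\<le>k. T 0 j = 0) \<and> (\<forall>i\<le>k. T i 0 = 0) \<and>
     (\<forall>i<k. \<forall>j<k. T i (Suc j) + T (Suc i) j + T i j = 0)"

definition gram_rel :: "nat \<Rightarrow> (nat \<Rightarrow> nat \<Rightarrow> 'a :: field) \<Rightarrow> bool" where
  "gram_rel k G \<longleftrightarrow> (\<forall>j\<le>k. G 0 j = 0) \<and> (\<forall>i\<le>k. G i 0 = 0) \<and>
     (\<forall>i\<le>k. \<forall>j<k. G i (Suc j) = G (Suc j) i + G j i)"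

lemma gram_relD: "gram_rel k G \<Longrightarrow> i \<le> k \<Longrightarrow> j < k \<Longrightarrow> G i (Suc j) = G (Suc j) i + G j i"
  unfolding gram_rel_def by blast

lemma chain_0: "chain A l k x \<Longrightarrow> x 0 = (\<lambda>_. 0)"
  unfolding chain_def by blast

lemma chainD: "chain A l k x \<Longrightarrow> j < k \<Longrightarrow> bf A w (x (Suc j)) = l * bf A (x (Suc j)) w + bf A (x j) w"
  unfolding chain_def by blast

lemma chain_1D: "chain A 1 k x \<Longrightarrow> j < k \<Longrightarrow> bf A w (x (Suc j)) = bf A (x (Suc j)) w + bf A (x j) w"
  using chainD[of A 1 k x j w] by simp

text \<open>Interchanging the arguments twice returns to the same entry, so the terms picked up on
  the way add up to 0.\<close>

lemma gram_rel_imp_pair_rel: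
  assumes "gram_rel k G"
  shows "pair_rel k G"
  unfolding pair_rel_def
proof (intro conjI allI impI)
  show "G 0 j = 0" if "j \<le> k" for j using assms that unfolding gram_rel_def by auto
  show "G i 0 = 0" if "i \<le> k" for i using assms that unfolding gram_rel_def by auto
  fix i j assume ij: "i < k" "j < k"
  note r = gram_relD[OF assms]
  have "G (Suc i) (Suc j) = G (Suc j) (Suc i) + G j (Suc i)" using r[of "Suc i" j] ij by simp
  also have "\<dots> = (G (Suc i) (Suc j) + G i (Suc j)) + (G (Suc i) j + G i j)"
    using r[of "Suc j" i] r[of j i] ij by simp
  finally show "G i (Suc j) + G (Suc i) j + G i j = 0" by (simp add: algebra_simps)
qed

lemma gram_rel_add:
  assumes "gram_rel k G" "gram_rel k H"
  shows "gram_rel k (\<lambda>i j. G i j + H i j)"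
  unfolding gram_rel_def
proof (intro conjI allI impI)
  show "G 0 j + H 0 j = 0" "G j 0 + H j 0 = 0" if "j \<le> k" for j
    using assms that unfolding gram_rel_def by auto
  show "G i (Suc j) + H i (Suc j) = G (Suc j) i + H (Suc j) i + (G j i + H j i)" if "i \<le> k" "j < k" for i j
    using gram_relD[OF assms(1) that] gram_relD[OF assms(2) that] by (simp add: add_ac)
qed

text \<open>The relation expresses an entry of row i + 1 through entries of row i at most one column
  further right. Row 0 is zero, and the loss of one column per row produces the antitriangular
  shape.\<close>

lemma pair_rel_vanish_below:
  assumes "pair_rel k T"
  shows "vanish_below k (Suc k) T"
proof -
  have "T i j = 0" if "i + j \<le> k" for i j
    using that
  proof (induct i arbitrary: j)
    case 0
    then show ?case using assms unfolding pair_rel_def by auto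
  next
    case (Suc i)
    have "T i (Suc j) + T (Suc i) j + T i j = 0" using assms Suc.prems unfolding pair_rel_def by auto
    then show ?case using Suc.hyps[of "Suc j"] Suc.hyps[of j] Suc.prems by simp
  qed
  then show ?thesis unfolding vanish_below_def by auto
qed

section \<open>Leading antidiagonals in characteristic 2\<close>

locale char_2 =
  fixes ty :: "'a :: field itself"
  assumes add_self: "\<And>c :: 'a. c + c = 0"
begin

lemma eq_if_add_zero: "(c :: 'a) + d = 0 \<Longrightarrow> c = d"
  using add_self[of d] by (metis add_right_cancel)

lemma of_nat_even: "even s \<Longrightarrow> (of_nat s :: 'a) = 0"
  by (elim evenE) (simp add: mult_2 add_self)

lemma antidiagonal_step:
  fixes T :: "nat \<Rightarrow> nat \<Rightarrow> 'a"
  assumes T: "pair_rel k T" and V: "vanish_below k c T" and ij: "i < k" "j < k" "i + j + 1 = c"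
  shows "T i (Suc j) = T (Suc i) j"
proof -
  have "T i (Suc j) + T (Suc i) j + T i j = 0" using T ij unfolding pair_rel_def by auto
  moreover have "T i j = 0" using V ij unfolding vanish_below_def by auto
  ultimately show ?thesis by (metis add.right_neutral eq_if_add_zero)
qed

text \<open>On the first antidiagonal that may be nonzero the third term of \<open>pair_rel\<close>
  drops out, and without signs neighbouring entries are equal.\<close>

lemma antidiagonal_const:
  fixes T :: "nat \<Rightarrow> nat \<Rightarrow> 'a"
  assumes T: "pair_rel k T" and V: "vanish_below k c T"
    and ij: "i \<le> k" "j \<le> k" "i + j = c" and ij': "i' \<le> k" "j' \<le> k" "i' + j' = c"
  shows "T i j = T i' j'"
proof -
  have *: "T i j = T (i + s) (j - s)" if "i \<le> k" "j \<le> k" "i + j = c" "i + s \<le> k" "s \<le> j" for i j s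
    using that
  proof (induct s)
    case (Suc s)
    have "T (i + s) (Suc (j - Suc s)) = T (Suc (i + s)) (j - Suc s)"
      using Suc.prems by (intro antidiagonal_step[OF T V]) auto
    then show ?case using Suc by (simp add: Suc_diff_Suc)
  qed simp
  show ?thesis
  proof (cases "i \<le> i'")
    case True
    then have "i' = i + (i' - i)" "j' = j - (i' - i)" using ij ij' by auto
    then show ?thesis using *[OF ij, of "i' - i"] ij ij' True by simp
  next
    case False
    then have "i = i' + (i - i')" "j = j' - (i - i')" using ij ij' by auto
    then show ?thesis using *[OF ij', of "i - i'"] ij ij' False by simp
  qed
qed

lemma vanish_below_Suc:
  fixes T :: "nat \<Rightarrow> nat \<Rightarrow> 'a"
  assumes T: "pair_rel k T" and V: "vanish_below k c T"
    and z: "i \<le> k" "j \<le> k" "i + j = c" "T i j = 0"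
  shows "vanish_below k (Suc c) T"
  unfolding vanish_below_def
proof (intro allI impI)
  fix i' j' assume *: "i' \<le> k" "j' \<le> k" "i' + j' < Suc c"
  show "T i' j' = 0"
  proof (cases "i' + j' = c")
    case True
    then show ?thesis using antidiagonal_const[OF T V * (1,2) True z(1,2,3)] z(4) by simp
  next
    case False
    then show ?thesis using V * unfolding vanish_below_def by auto
  qed
qed

text \<open>The antidiagonal 2 * d + 1 passes next to the diagonal, and \<open>gram_rel\<close> at
  the diagonal entry of index d + 1 compares this entry with itself: the extra term
  \<open>G d (Suc d)\<close> must be 0, and constancy does the rest.\<close>

lemma vanish_below_odd:
  fixes G :: "nat \<Rightarrow> nat \<Rightarrow> 'a"
  assumes G: "gram_rel k G" and V: "vanish_below k c G" and c: "odd c"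
  shows "vanish_below k (Suc c) G"
proof -
  obtain d where d: "c = 2 * d + 1" using c by (elim oddE)
  show ?thesis
  proof (cases "d < k")
    case True
    have "G (Suc d) (Suc d) = G (Suc d) (Suc d) + G d (Suc d)"
      using True by (intro gram_relD[OF G]) auto
    then have "G d (Suc d) = 0" by simp
    then show ?thesis
      using True d by (intro vanish_below_Suc[OF gram_rel_imp_pair_rel[OF G] V, of d "Suc d"]) auto
  next
    case False
    then show ?thesis using V d unfolding vanish_below_def by auto
  qed
qed

text \<open>The sum is the coefficient of a in the Gram matrix of x plus a times y shifted by e. On
  the antidiagonal k + 1 + e both terms are the leading value and cancel. On the next one, i and j
  have the same parity, so \<open>T i (j - e)\<close> and \<open>T j (i - e)\<close> agree, and what
  remains is the difference between T' and the transpose of T, again the leading value.\<close>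

lemma trace_leading_term:
  fixes T T' :: "nat \<Rightarrow> nat \<Rightarrow> 'a"
  assumes T: "pair_rel k T" and k: "1 \<le> k"
    and T'0: "\<And>i. i \<le> k \<Longrightarrow> T' i 0 = 0" "\<And>j. j \<le> k \<Longrightarrow> T' 0 j = 0"
    and T': "\<And>i j. i < k \<Longrightarrow> j \<le> k \<Longrightarrow> T' j (Suc i) = T (Suc i) j + T i j"
    and ev: "even (k + 2 + e)" and ij: "i \<le> k" "j \<le> k"
  shows "i + j < k + 2 + e \<Longrightarrow> T i (j - e) + T' (i - e) j = 0"
    and "i + j = k + 2 + e \<Longrightarrow> T i (j - e) + T' (i - e) j = T 1 k"
proof -
  note V = pair_rel_vanish_below[OF T]
  let ?t = "T 1 k"
  have T0: "T i 0 = 0" if "i \<le> k" for i using T that unfolding pair_rel_def by auto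
  have Tz: "T i j = 0" if "i \<le> k" "j \<le> k" "i + j \<le> k" for i j
    using V that unfolding vanish_below_def by auto
  have Tt: "T i j = ?t" if "i \<le> k" "j \<le> k" "i + j = Suc k" for i j
    using that k by (intro antidiagonal_const[OF T V]) auto
  have T'z: "T' j i = 0" if "i \<le> k" "j \<le> k" "i + j \<le> k" for i j
    using that T'[of "i - 1" j] T'0 Tz by (cases i) auto
  have T't: "T' j i = ?t" if "i \<le> k" "j \<le> k" "i + j = Suc k" for i j
    using that T'[of "i - 1" j] Tz[of "i - 1" j] Tt[of i j] by (cases i) auto
  {
    assume "i + j < k + 2 + e"
    then consider "i + j < k + 1 + e" | "i + j = k + 1 + e" by linarith
    then show "T i (j - e) + T' (i - e) j = 0"
    proof cases
      case 1
      have "T i (j - e) = 0" using 1 ij T0 Tz[of i "j - e"] by (cases "e \<le> j") auto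
      moreover have "T' (i - e) j = 0" using 1 ij T'0 T'z[of j "i - e"] by (cases "e \<le> i") auto
      ultimately show ?thesis by simp
    next
      case 2
      have "T i (j - e) = ?t" using 2 ij by (intro Tt) auto
      moreover have "T' (i - e) j = ?t" using 2 ij by (intro T't) auto
      ultimately show ?thesis by (simp add: add_self)
    qed
  next
    assume c: "i + j = k + 2 + e"
    \<comment> \<open>Second antidiagonal of T: each move along it adds the leading value, so
      entries an even number of moves apart coincide.\<close>
    have D: "T (a + s) (b - s) = T a b + of_nat s * ?t"
      if "a \<le> k" "b \<le> k" "a + b = k + 2" "a + s \<le> k" "s \<le> b" for a b s
      using that
    proof (induct s)
      case (Suc s)
      have "T (a + s) (Suc (b - Suc s)) + T (Suc (a + s)) (b - Suc s) + T (a + s) (b - Suc s) = 0"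
        using T Suc.prems unfolding pair_rel_def by auto
      moreover have "T (a + s) (b - Suc s) = ?t" using Suc.prems by (intro Tt) auto
      moreover have "Suc (b - Suc s) = b - s" using Suc.prems by simp
      ultimately have "T (a + Suc s) (b - Suc s) + (T (a + s) (b - s) + ?t) = 0" by (simp add: add_ac)
      then have "T (a + Suc s) (b - Suc s) = T (a + s) (b - s) + ?t" by (rule eq_if_add_zero)
      then show ?case using Suc by (simp add: algebra_simps)
    qed simp
    have De: "T a b = T a' b'"
      if "a \<le> k" "b \<le> k" "a + b = k + 2" "a' \<le> k" "b' \<le> k" "a' + b' = k + 2" "even (a + a')" "a \<le> a'" for a b a' b'
    proof -
      have "a' = a + (a' - a)" "b' = b - (a' - a)" using that by auto
      moreover have "even (a' - a)" using that by presburger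
      ultimately show ?thesis using D[of a b "a' - a"] that of_nat_even[of "a' - a"] by simp
    qed
    have e2: "j = Suc (j - 1)" "j - 1 < k" using c ij by auto
    have "T' (i - e) j = T j (i - e) + T (j - 1) (i - e)" using T'[of "j - 1" "i - e"] e2 ij by simp
    moreover have "T (j - 1) (i - e) = ?t" using c ij by (intro Tt) auto
    moreover have "T i (j - e) = T j (i - e)"
    proof (cases "i \<le> j")
      case True
      show ?thesis using c ij ev True by (intro De) auto
    next
      case False
      then have "T j (i - e) = T i (j - e)" using c ij ev by (intro De) (auto simp: add.commute)
      then show ?thesis by simp
    qed
    ultimately show "T i (j - e) + T' (i - e) j = ?t"
      by (metis add.assoc add_0 add_self)
  }
qed

end

locale alg_closed_char_2 = char_2 ty for ty :: "'a :: alg_closed_field itself"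
begin

lemma quadratic_root:
  assumes "t \<noteq> (0 :: 'a)"
  shows "\<exists>a. g + a * t + a * a * h = 0"
proof (cases "h = 0")
  case True
  then show ?thesis using assms by (intro exI[of _ "- g / t"]) simp
next
  case False
  have "degree [:g, t, h:] > 0" using False by simp
  from alg_closed_imp_poly_has_root[OF this] obtain a where "poly [:g, t, h:] a = 0" by blast
  then show ?thesis by (intro exI[of _ a]) (simp add: algebra_simps)
qed

lemma chain_gram_rel:
  fixes A :: "'a mat"
  assumes "chain A 1 k x"
  shows "gram_rel k (\<lambda>i j. bf A (x i) (x j))"
  unfolding gram_rel_def using chain_0[OF assms] chain_1D[OF assms] by (intro conjI allI impI) simp_all

lemma chain_pair_rel:
  fixes A :: "'a mat"
  assumes x: "chain A 1 k x" and y: "chain A 1 k y"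
  shows "pair_rel k (\<lambda>i j. bf A (x i) (y j))"
  unfolding pair_rel_def
proof (intro conjI allI impI)
  note xs = chain_1D[OF x] and ys = chain_1D[OF y]
  show "bf A (x 0) (y j) = 0" "bf A (x j) (y 0) = 0" for j by (simp_all add: chain_0[OF x] chain_0[OF y])
  fix i j assume ij: "i < k" "j < k"
  show "bf A (x i) (y (Suc j)) + bf A (x (Suc i)) (y j) + bf A (x i) (y j) = 0"
    using ys[OF ij(2), of "x (Suc i)"] xs[OF ij(1), of "y (Suc j)"] xs[OF ij(1), of "y j"]
    by (simp add: algebra_simps)
qed

text \<open>Truncated subtraction is what is wanted: the members with index up to e become
  \<open>y 0 = 0\<close>, and the shifted family is again a chain.\<close>

lemma chain_add_shift:
  fixes A :: "'a mat"
  assumes x: "chain A 1 k x" and y: "chain A 1 k y"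
  shows "chain A 1 k (\<lambda>j i. x j i + a * y (j - e) i)"
  unfolding chain_def
proof (intro conjI allI impI)
  note y0 = chain_0[OF y]
  show "(\<lambda>i. x 0 i + a * y (0 - e) i) = (\<lambda>_. 0)" by (simp add: chain_0[OF x] chain_0[OF y])
  fix j w assume j: "j < k"
  note xs = chain_1D[OF x j, of w]
  have ys: "bf A w (y (Suc j - e)) = bf A (y (Suc j - e)) w + bf A (y (j - e)) w"
  proof (cases "e \<le> j")
    case True
    then have "Suc j - e = Suc (j - e)" "j - e < k" using j by auto
    then show ?thesis using chain_1D[OF y, of "j - e" w] by simp
  qed (simp add: y0)
  show "bf A w (\<lambda>i. x (Suc j) i + a * y (Suc j - e) i) =
    1 * bf A (\<lambda>i. x (Suc j) i + a * y (Suc j - e) i) w + bf A (\<lambda>i. x j i + a * y (j - e) i) w"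
    unfolding bf_add_left bf_add_right xs ys by (simp add: algebra_simps)
qed

text \<open>Hensel step: since \<open>c\<close> is even, the trace part of the perturbation meets the antidiagonal \<open>c\<close>
  in its leading term, so a suitable multiple corrects the Gram matrix there.\<close>

lemma hensel_step:
  fixes A :: "'a mat"
  assumes x: "chain A 1 k x" and y: "chain A 1 k y" and k: "1 \<le> k"
    and t: "bf A (x 1) (y k) \<noteq> 0" and c: "c = k + 2 + e" "even c"
    and d: "gram_rel k d" and V: "vanish_below k c (\<lambda>i j. d i j + bf A (x i) (x j))"
    and Y: "\<And>i j. i \<le> k \<Longrightarrow> j \<le> k \<Longrightarrow> i + j + 2 * e < c \<Longrightarrow> bf A (y i) (y j) = 0"
  shows "\<exists>a. vanish_below k (Suc c) (\<lambda>i j. d i j +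
    bf A (\<lambda>l. x i l + a * y (i - e) l) (\<lambda>l. x j l + a * y (j - e) l))"
proof -
  define D where "D = (\<lambda>i j. d i j + bf A (x i) (x j))"
  let ?T = "\<lambda>i j. bf A (x i) (y j)"
  let ?T' = "\<lambda>i j. bf A (y i) (x j)"
  let ?Y = "\<lambda>i j. bf A (y i) (y j)"
  note y0 = chain_0[OF y]
  note x0 = chain_0[OF x]
  have "gram_rel k D"
    unfolding D_def by (rule gram_rel_add[OF d chain_gram_rel[OF x]])
  then have D: "pair_rel k D" by (rule gram_rel_imp_pair_rel)
  have VD: "vanish_below k c D" using V unfolding D_def .
  note PY = chain_pair_rel[OF y y]
  \<comment> \<open>The equation is imposed at one entry of the antidiagonal c; all three of its
    coefficients are constant along this antidiagonal.\<close>
  obtain a where a: "D k (c - k) + a * ?T 1 k + a * a * ?Y (k - e) (c - k - e) = 0"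
    using quadratic_root[OF t] by blast
  have expand: "d i j + bf A (\<lambda>l. x i l + a * y (i - e) l) (\<lambda>l. x j l + a * y (j - e) l)
    = D i j + a * (?T i (j - e) + ?T' (i - e) j) + a * a * ?Y (i - e) (j - e)" for i j
    unfolding bf_add_left bf_add_right D_def by (simp add: algebra_simps)
  have tr: "i + j < k + 2 + e \<Longrightarrow> ?T i (j - e) + ?T' (i - e) j = 0"
    "i + j = k + 2 + e \<Longrightarrow> ?T i (j - e) + ?T' (i - e) j = ?T 1 k" if "i \<le> k" "j \<le> k" for i j
  proof -
    have "?T' j (Suc i) = ?T (Suc i) j + ?T i j" if "i < k" "j \<le> k" for i j
      using chain_1D[OF x that(1)] .
    note tl = trace_leading_term[where T = "\<lambda>i j. bf A (x i) (y j)" and T' = "\<lambda>i j. bf A (y i) (x j)" and e = e,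
        OF chain_pair_rel[OF x y] k _ _ this _ that]
    show "i + j < k + 2 + e \<Longrightarrow> ?T i (j - e) + ?T' (i - e) j = 0"
      using tl(1) c x0 y0 by simp
    show "i + j = k + 2 + e \<Longrightarrow> ?T i (j - e) + ?T' (i - e) j = ?T 1 k"
      using tl(2) c x0 y0 by simp
  qed
  have "d i j + bf A (\<lambda>l. x i l + a * y (i - e) l) (\<lambda>l. x j l + a * y (j - e) l) = 0"
    if ij: "i \<le> k" "j \<le> k" "i + j < Suc c" for i j
  proof (cases "i + j = c")
    case False
    then have lt: "i + j < c" using ij by simp
    have "?Y (i - e) (j - e) = 0"
    proof (cases "e \<le> i \<and> e \<le> j")
      case True
      then show ?thesis using ij lt by (intro Y) auto
    next
      case False
      then have "y (i - e) = (\<lambda>_. 0) \<or> y (j - e) = (\<lambda>_. 0)" using y0 by auto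
      then show ?thesis by auto
    qed
    moreover have "D i j = 0" using VD ij lt unfolding vanish_below_def by auto
    ultimately show ?thesis unfolding expand using tr(1)[OF ij(1,2)] lt c by simp
  next
    case True
    have "D i j = D k (c - k)" using ij True c(1) by (intro antidiagonal_const[OF D VD]) auto
    moreover have "?Y (i - e) (j - e) = ?Y (k - e) (c - k - e)"
    proof (rule antidiagonal_const[OF PY, of "c - 2 * e"])
      show "vanish_below k (c - 2 * e) ?Y"
        unfolding vanish_below_def using Y ij True c by auto
    qed (use ij True c in auto)
    ultimately show ?thesis unfolding expand using tr(2)[OF ij(1,2)] True c a by simp
  qed
  then show ?thesis unfolding vanish_below_def by blast
qed

text \<open>Assumption \<open>b\<close> clears the antidiagonal k + 1 of every chain of length k. It
  is needed for y as well: in the correction with e = 0 the quadratic term must not reach below the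
  antidiagonal k + 2.\<close>

lemma isotropic_chain:
  fixes A :: "'a mat"
  assumes x: "chain A 1 k x" and y: "chain A 1 k y" and k: "1 \<le> k"
    and t: "bf A (x 1) (y k) \<noteq> 0"
    and b: "\<And>z. chain A 1 k z \<Longrightarrow> bf A (z 1) (z k) = 0"
  shows "\<exists>x'. chain A 1 k x' \<and> bf A (x' 1) (y k) = bf A (x 1) (y k) \<and>
    (\<forall>i\<le>k. \<forall>j\<le>k. bf A (x' i) (x' j) = 0)"
proof -
  have V2: "vanish_below k (k + 2) (\<lambda>i j. bf A (z i) (z j))" if z: "chain A 1 k z" for z
    using vanish_below_Suc[OF chain_pair_rel[OF z z] pair_rel_vanish_below[OF chain_pair_rel[OF z z]], of 1 k]
      b[OF z] k by simp
  have "\<exists>x'. chain A 1 k x' \<and> bf A (x' 1) (y k) = bf A (x 1) (y k) \<and>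
    vanish_below k (k + 2 + s) (\<lambda>i j. bf A (x' i) (x' j))" for s
  proof (induct s)
    case 0
    then show ?case using x V2[OF x] by auto
  next
    case (Suc e)
    then obtain x' where x': "chain A 1 k x'" "bf A (x' 1) (y k) = bf A (x 1) (y k)"
      "vanish_below k (k + 2 + e) (\<lambda>i j. bf A (x' i) (x' j))" by blast
    show ?case
    proof (cases "even (k + 2 + e)")
      case False
      then have "vanish_below k (Suc (k + 2 + e)) (\<lambda>i j. bf A (x' i) (x' j))"
        using vanish_below_odd[OF chain_gram_rel[OF x'(1)] x'(3)] by simp
      then show ?thesis using x' by auto
    next
      case True
      have "\<exists>a. vanish_below k (Suc (k + 2 + e)) (\<lambda>i j. (\<lambda>_ _. 0) i j +
        bf A (\<lambda>l. x' i l + a * y (i - e) l) (\<lambda>l. x' j l + a * y (j - e) l))"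
      proof (rule hensel_step[OF x'(1) y k _ refl True])
        show "bf A (x' 1) (y k) \<noteq> 0" using t x' by simp
        show "gram_rel k (\<lambda>_ _. 0 :: 'a)" unfolding gram_rel_def by simp
        show "vanish_below k (k + 2 + e) (\<lambda>i j. 0 + bf A (x' i) (x' j))" using x' by simp
        show "bf A (y i) (y j) = 0" if "i \<le> k" "j \<le> k" "i + j + 2 * e < k + 2 + e" for i j
          using V2[OF y] that unfolding vanish_below_def by auto
      qed
      then obtain a where a: "vanish_below k (Suc (k + 2 + e)) (\<lambda>i j.
        bf A (\<lambda>l. x' i l + a * y (i - e) l) (\<lambda>l. x' j l + a * y (j - e) l))" by auto
      define x2 where "x2 = (\<lambda>j i. x' j i + a * y (j - e) i)"
      have "chain A 1 k x2" unfolding x2_def by (rule chain_add_shift[OF x'(1) y])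
      moreover have "bf A (x2 1) (y k) = bf A (x' 1) (y k)"
      proof -
        \<comment> \<open>For e = 0 this is \<open>b\<close>, for larger e the first factor is
          \<open>y 0\<close>; hence the leading pairing with y survives every correction.\<close>
        have "bf A (y (1 - e)) (y k) = 0"
          using b[OF y] chain_0[OF y] by (cases e) auto
        then show ?thesis unfolding x2_def bf_add_left by simp
      qed
      moreover have "vanish_below k (k + 2 + Suc e) (\<lambda>i j. bf A (x2 i) (x2 j))"
        using a unfolding x2_def by simp
      ultimately show ?thesis using x' by auto
    qed
  qed
  from this[of k] obtain x' where x': "chain A 1 k x'" "bf A (x' 1) (y k) = bf A (x 1) (y k)"
    "vanish_below k (k + 2 + k) (\<lambda>i j. bf A (x' i) (x' j))" by blast
  have "bf A (x' i) (x' j) = 0" if "i \<le> k" "j \<le> k" for i j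
    using x'(3) that unfolding vanish_below_def by auto
  then show ?thesis using x' by blast
qed

text \<open>Interchanging the arguments by the last link of x costs an entry below the leading
  antidiagonal, which is 0, and along the leading antidiagonal the pairing is constant.\<close>

lemma chain_leading_sym:
  fixes A :: "'a mat"
  assumes x: "chain A 1 k x" and y: "chain A 1 k y" and k: "1 \<le> k"
  shows "bf A (y 1) (x k) = bf A (x 1) (y k)"
proof -
  note P = chain_pair_rel[OF x y]
  note V = pair_rel_vanish_below[OF P]
  have "bf A (y 1) (x (Suc (k - 1))) = bf A (x (Suc (k - 1))) (y 1) + bf A (x (k - 1)) (y 1)"
  proof -
    have "k - 1 < k" using k by simp
    then show ?thesis by (rule chain_1D[OF x])
  qed
  moreover have "bf A (x (k - 1)) (y 1) = 0" using V k unfolding vanish_below_def by auto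
  moreover have "bf A (x k) (y 1) = bf A (x 1) (y k)"
    using k antidiagonal_const[OF P V, of k 1 1 k] by simp
  ultimately show ?thesis using k by simp
qed

text \<open>First x is corrected along y, then y along the new x; symmetry of the leading pairing
  keeps it nonzero throughout.\<close>

lemma isotropic_chain_pair:
  fixes A :: "'a mat"
  assumes x: "chain A 1 k x" and y: "chain A 1 k y" and k: "1 \<le> k"
    and t: "bf A (x 1) (y k) \<noteq> 0"
    and b: "\<And>z. chain A 1 k z \<Longrightarrow> bf A (z 1) (z k) = 0"
  shows "\<exists>x' y'. chain A 1 k x' \<and> chain A 1 k y' \<and> bf A (x' 1) (y' k) \<noteq> 0 \<and>
    (\<forall>i\<le>k. \<forall>j\<le>k. bf A (x' i) (x' j) = 0 \<and> bf A (y' i) (y' j) = 0)"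
proof -
  from isotropic_chain[OF x y k t b] obtain x' where x': "chain A 1 k x'"
    "bf A (x' 1) (y k) \<noteq> 0" "\<And>i j. i \<le> k \<Longrightarrow> j \<le> k \<Longrightarrow> bf A (x' i) (x' j) = 0"
    using t by auto
  have nz: "bf A (y 1) (x' k) \<noteq> 0" using chain_leading_sym[OF x'(1) y k] x'(2) by simp
  from isotropic_chain[OF y x'(1) k nz b] obtain y' where y': "chain A 1 k y'"
    "bf A (y' 1) (x' k) \<noteq> 0" "\<And>i j. i \<le> k \<Longrightarrow> j \<le> k \<Longrightarrow> bf A (y' i) (y' j) = 0"
    using nz by auto
  have "bf A (x' 1) (y' k) \<noteq> 0" using chain_leading_sym[OF x'(1) y'(1) k] y'(2) by simp
  then show ?thesis using x' y' by blast
qed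

text \<open>For even k the leading antidiagonal k + 1 is odd and vanishes by itself.\<close>

lemma gram_leading_odd:
  fixes A :: "'a mat"
  assumes x: "chain A 1 k x" and k: "1 \<le> k" and b: "bf A (x 1) (x k) \<noteq> 0"
  shows "odd k"
proof (rule ccontr)
  assume "\<not> odd k"
  then have "vanish_below k (Suc (Suc k)) (\<lambda>i j. bf A (x i) (x j))"
    using vanish_below_odd[OF chain_gram_rel[OF x] pair_rel_vanish_below[OF chain_pair_rel[OF x x]]] by simp
  then show False using b k unfolding vanish_below_def by auto
qed

lemma chain_smult:
  fixes A :: "'a mat"
  assumes "chain A l k x"
  shows "chain A l k (\<lambda>j i. a * x j i)"
  using assms unfolding chain_def bf_smult_left bf_smult_right by (auto simp: algebra_simps)

text \<open>In characteristic 2 the sum of the target d and the Gram matrix is their difference, and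
  it obeys \<open>gram_rel\<close> too. It is cleared antidiagonal by antidiagonal, correcting the
  chain along its own shifts.\<close>

lemma chain_realize_gram:
  fixes A :: "'a mat"
  assumes x: "chain A 1 k x" and k: "odd k" and t: "bf A (x 1) (x k) \<noteq> 0"
    and d: "gram_rel k d" and dk: "d 1 k \<noteq> 0"
  shows "\<exists>x'. chain A 1 k x' \<and> (\<forall>i\<le>k. \<forall>j\<le>k. bf A (x' i) (x' j) = d i j)"
proof -
  have k1: "1 \<le> k" using k by (cases k) auto
  note Vd = pair_rel_vanish_below[OF gram_rel_imp_pair_rel[OF d]]
  \<comment> \<open>Scaling the chain by r multiplies its Gram matrix by the square of r and matches
    the leading antidiagonal; the following one, k + 2, is odd and comes for free.\<close>
  obtain r where r: "r ^ 2 = d 1 k / bf A (x 1) (x k)" using nth_root_exists[of 2] by auto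
  define x1 where "x1 = (\<lambda>j i. r * x j i)"
  have x1: "chain A 1 k x1" unfolding x1_def by (rule chain_smult[OF x])
  have x1k: "bf A (x1 1) (x1 k) = d 1 k"
    unfolding x1_def bf_smult_left bf_smult_right using r t by (simp add: power2_eq_square field_simps)
  have gs: "gram_rel k (\<lambda>i j. d i j + bf A (z i) (z j))" if "chain A 1 k z" for z
    by (rule gram_rel_add[OF d chain_gram_rel[OF that]])
  have "\<exists>z. chain A 1 k z \<and> vanish_below k (k + 3 + s) (\<lambda>i j. d i j + bf A (z i) (z j))" for s
  proof (induct s)
    case 0
    have "vanish_below k (Suc (Suc k)) (\<lambda>i j. d i j + bf A (x1 i) (x1 j))"
      using vanish_below_Suc[OF gram_rel_imp_pair_rel[OF gs[OF x1]] pair_rel_vanish_below[OF gram_rel_imp_pair_rel[OF gs[OF x1]]], of 1 k]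
        x1k k1 add_self by simp
    from vanish_below_odd[OF gs[OF x1] this] k
    have "vanish_below k (k + 3) (\<lambda>i j. d i j + bf A (x1 i) (x1 j))" by (simp add: numeral_3_eq_3)
    then show ?case using x1 by auto
  next
    case (Suc s)
    then obtain z where z: "chain A 1 k z" "vanish_below k (k + 3 + s) (\<lambda>i j. d i j + bf A (z i) (z j))" by blast
    show ?case
    proof (cases "even (k + 3 + s)")
      case False
      then have "vanish_below k (Suc (k + 3 + s)) (\<lambda>i j. d i j + bf A (z i) (z j))"
        using vanish_below_odd[OF gs[OF z(1)] z(2)] by simp
      then show ?thesis using z by auto
    next
      case True
      have "d 1 k + bf A (z 1) (z k) = 0" using z(2) k1 unfolding vanish_below_def by auto
      then have zk: "bf A (z 1) (z k) \<noteq> 0" using dk by (metis add.right_neutral)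
      \<comment> \<open>The antidiagonal k + 3 + s calls for the shift e = Suc s. The antitriangular
        shape alone keeps the quadratic term from interfering earlier.\<close>
      have "\<exists>a. vanish_below k (Suc (k + 3 + s)) (\<lambda>i j. d i j +
        bf A (\<lambda>l. z i l + a * z (i - Suc s) l) (\<lambda>l. z j l + a * z (j - Suc s) l))"
      proof (rule hensel_step[OF z(1) z(1) k1 zk _ True d z(2)])
        show "k + 3 + s = k + 2 + Suc s" by simp
        show "bf A (z i) (z j) = 0" if "i \<le> k" "j \<le> k" "i + j + 2 * Suc s < k + 3 + s" for i j
          using pair_rel_vanish_below[OF chain_pair_rel[OF z(1) z(1)]] that unfolding vanish_below_def by auto
      qed
      then obtain a where a: "vanish_below k (Suc (k + 3 + s)) (\<lambda>i j. d i j +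
        bf A (\<lambda>l. z i l + a * z (i - Suc s) l) (\<lambda>l. z j l + a * z (j - Suc s) l))" by blast
      have "chain A 1 k (\<lambda>j i. z j i + a * z (j - Suc s) i)" by (rule chain_add_shift[OF z(1) z(1)])
      then show ?thesis using a by (intro exI[of _ "\<lambda>j i. z j i + a * z (j - Suc s) i"]) simp
    qed
  qed
  from this[of k] obtain z where z: "chain A 1 k z" "vanish_below k (k + 3 + k) (\<lambda>i j. d i j + bf A (z i) (z j))" by blast
  have "bf A (z i) (z j) = d i j" if "i \<le> k" "j \<le> k" for i j
  proof -
    have "d i j + bf A (z i) (z j) = 0" using z(2) that unfolding vanish_below_def by auto
    then show ?thesis using eq_if_add_zero by metis
  qed
  then show ?thesis using z by blast
qed

end

section \<open>Matrices with unipotent cosquare\<close>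

lemma mat_inv_inverts:
  fixes C :: "'a :: field mat"
  assumes C: "C \<in> carrier_mat n n" and inv: "invertible_mat C"
  shows "mat_inv C \<in> carrier_mat n n" "C * mat_inv C = 1\<^sub>m n" "mat_inv C * C = 1\<^sub>m n"
proof -
  from inv have "\<exists>B. inverts_mat C B \<and> inverts_mat B C" unfolding invertible_mat_def by auto
  then have "inverts_mat C (mat_inv C) \<and> inverts_mat (mat_inv C) C"
    unfolding mat_inv_def by (rule someI_ex)
  then have B: "C * mat_inv C = 1\<^sub>m (dim_row C)" "mat_inv C * C = 1\<^sub>m (dim_row (mat_inv C))"
    unfolding inverts_mat_def by auto
  have "dim_col (mat_inv C) = n" using arg_cong[OF B(1), of dim_col] C by simp
  moreover have "dim_row (mat_inv C) = n" using arg_cong[OF B(2), of dim_col] C by simp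
  ultimately show "mat_inv C \<in> carrier_mat n n" "C * mat_inv C = 1\<^sub>m n" "mat_inv C * C = 1\<^sub>m n"
    using B C by auto
qed

lemma cosquare_carrier:
  fixes C :: "'a :: field mat"
  assumes C: "C \<in> carrier_mat n n" and inv: "invertible_mat C"
  shows "cosquare C \<in> carrier_mat n n"
  using mat_inv_inverts[of "transpose_mat C" n] C inv unfolding cosquare_def
  by (auto simp: invertible_mat_transpose[OF C])

lemma transpose_mult_cosquare:
  fixes C :: "'a :: field mat"
  assumes C: "C \<in> carrier_mat n n" and inv: "invertible_mat C"
  shows "transpose_mat C * cosquare C = C"
proof -
  have i: "mat_inv (transpose_mat C) \<in> carrier_mat n n" "transpose_mat C * mat_inv (transpose_mat C) = 1\<^sub>m n"
    using mat_inv_inverts[of "transpose_mat C" n] C inv by (auto simp: invertible_mat_transpose[OF C])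
  have "transpose_mat C * cosquare C = (transpose_mat C * mat_inv (transpose_mat C)) * C"
    unfolding cosquare_def using C i(1) by (simp add: assoc_mult_mat[of _ n n _ n _ n])
  also have "\<dots> = C" unfolding i(2) using C by simp
  finally show ?thesis .
qed

lemma cosquare_eqI:
  fixes C :: "'a :: field mat"
  assumes C: "C \<in> carrier_mat n n" and inv: "invertible_mat C" and P: "P \<in> carrier_mat n n"
    and eq: "C = transpose_mat C * P"
  shows "cosquare C = P"
proof -
  have i: "mat_inv (transpose_mat C) \<in> carrier_mat n n" "mat_inv (transpose_mat C) * transpose_mat C = 1\<^sub>m n"
    using mat_inv_inverts[of "transpose_mat C" n] C inv by (auto simp: invertible_mat_transpose[OF C])
  have "cosquare C = mat_inv (transpose_mat C) * (transpose_mat C * P)"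
    unfolding cosquare_def using eq by simp
  also have "\<dots> = (mat_inv (transpose_mat C) * transpose_mat C) * P"
    using C i(1) P by (simp add: assoc_mult_mat[of _ n n _ n _ n])
  also have "\<dots> = P" unfolding i(2) using P by simp
  finally show ?thesis .
qed

text \<open>The cosquare is \<open>J_n(1)\<close> itself and not only similar to it, written without
  an inverse; in this form the standard basis is a chain of length n for l = 1.\<close>

definition root_form :: "nat \<Rightarrow> 'a :: field mat \<Rightarrow> bool" where
  "root_form n C \<longleftrightarrow> C \<in> carrier_mat n n \<and> invertible_mat C \<and> C = transpose_mat C * jordan_block n 1"

lemma root_form_cosquare: "root_form n C \<Longrightarrow> cosquare C = jordan_block n 1"
  unfolding root_form_def by (intro cosquare_eqI[of C n]) auto

text \<open>A congruence by P conjugates the cosquare by P, so the matrix of the similarity serves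
  as the matrix of a congruence.\<close>

lemma congruent_root_form:
  fixes C :: "'a :: field mat"
  assumes C: "C \<in> carrier_mat n n" and inv: "invertible_mat C"
    and sim: "similar_mat (cosquare C) (jordan_block n 1)"
  shows "\<exists>C'. congruent_mat C C' \<and> root_form n C'"
proof -
  let ?J = "jordan_block n (1 :: 'a)"
  have J: "?J \<in> carrier_mat n n" by simp
  from sim obtain P Q where "similar_mat_wit (cosquare C) ?J P Q" unfolding similar_mat_def by blast
  note w = similar_mat_witD2[OF cosquare_carrier[OF C inv] this]
  note PQ = w(1,2,3,6,7)
  let ?C = "transpose_mat P * C * P"
  have invP: "invertible_mat P" unfolding invertible_mat_iff[OF PQ(4)] using PQ by auto
  have cong: "congruent_mat C ?C" by (rule congruent_matI[OF C PQ(4) invP refl])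
  have C': "?C \<in> carrier_mat n n" using C PQ by simp
  have tr: "transpose_mat ?C = transpose_mat P * transpose_mat C * P"
    using C PQ by (simp add: transpose_mult[of _ n n _ n] assoc_mult_mat[of _ n n _ n _ n])
  have "?C = transpose_mat P * (transpose_mat C * (P * ?J * Q)) * P"
    using transpose_mult_cosquare[OF C inv] PQ(3) by simp
  also have "\<dots> = (transpose_mat P * transpose_mat C * P) * ?J * (Q * P)"
    using C PQ(4,5) J by (simp add: assoc_mult_mat[of _ n n _ n _ n] mult_carrier_mat[of _ n n _ n])
  also have "\<dots> = transpose_mat ?C * ?J"
    unfolding tr PQ(2) using C PQ(4,5) J
    by (simp add: assoc_mult_mat[of _ n n _ n _ n] mult_carrier_mat[of _ n n _ n])
  finally have "?C = transpose_mat ?C * ?J" .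
  moreover have "invertible_mat ?C" using congruent_mat_invertible[OF cong C] inv by simp
  ultimately show ?thesis using cong C' unfolding root_form_def by blast
qed

lemma mult_jordan_block_index:
  fixes M :: "'a :: comm_ring_1 mat"
  assumes M: "M \<in> carrier_mat m n" and i: "i < m" and j: "j < n"
  shows "(M * jordan_block n l) $$ (i,j) = l * M $$ (i,j) + (if j = 0 then 0 else M $$ (i, j - 1))"
proof -
  have "(M * jordan_block n l) $$ (i,j) = (\<Sum>k<n. M $$ (i,k) * jordan_block n l $$ (k,j))"
    using M i j by (simp add: scalar_prod_def lessThan_atLeast0)
  also have "\<dots> = (\<Sum>k<n. (if k = j then l * M $$ (i,j) else 0) + (if Suc k = j then M $$ (i, j - 1) else 0))"
    using j by (intro sum.cong) (auto simp: jordan_block_def)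
  also have "\<dots> = (\<Sum>k<n. if k = j then l * M $$ (i,j) else 0) + (\<Sum>k<n. if Suc k = j then M $$ (i, j - 1) else 0)"
    by (rule sum.distrib)
  also have "(\<Sum>k<n. if Suc k = j then M $$ (i, j - 1) else 0) = (if j = 0 then 0 else M $$ (i, j - 1))"
    using j by (cases j) auto
  finally show ?thesis using j by simp
qed

definition std_chain :: "nat \<Rightarrow> nat \<Rightarrow> nat \<Rightarrow> 'a :: comm_ring_1" where
  "std_chain n j = (if 1 \<le> j \<and> j \<le> n then ue (j - 1) else (\<lambda>_. 0))"

lemma chain_std:
  fixes C :: "'a :: field mat"
  assumes C: "C \<in> carrier_mat n n" and eq: "C = transpose_mat C * jordan_block n l"
  shows "chain C l n (std_chain n)"
  unfolding chain_def
proof (intro conjI allI impI)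
  show "std_chain n 0 = (\<lambda>_. 0 :: 'a)" unfolding std_chain_def by simp
  fix j w assume j: "j < n"
  have dim: "dim_row C = n" using C by simp
  have "bf C (ue i) (std_chain n (Suc j)) = l * bf C (std_chain n (Suc j)) (ue i) + bf C (std_chain n j) (ue i)"
    if i: "i < n" for i
  proof -
    have "C $$ (i,j) = (transpose_mat C * jordan_block n l) $$ (i,j)" using eq by simp
    also have "\<dots> = l * C $$ (j,i) + (if j = 0 then 0 else C $$ (j - 1, i))"
      using mult_jordan_block_index[of "transpose_mat C" n n i j l] C i j by auto
    finally show ?thesis
      using i j by (auto simp: std_chain_def bf_ue_ue dim)
  qed
  then have "(\<Sum>i<n. w i * bf C (ue i) (std_chain n (Suc j))) =
      (\<Sum>i<n. w i * (l * bf C (std_chain n (Suc j)) (ue i) + bf C (std_chain n j) (ue i)))"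
    by (intro sum.cong) auto
  then show "bf C w (std_chain n (Suc j)) = l * bf C (std_chain n (Suc j)) w + bf C (std_chain n j) w"
    unfolding bf_expand_left[of C w] bf_expand_right[of C _ w] dim
    by (simp add: algebra_simps sum.distrib sum_distrib_left)
qed

text \<open>Row i annihilates the coordinate k - 1 - i of a kernel vector once the later coordinates
  are known to be 0.\<close>

lemma anti_triangular_invertible:
  fixes M :: "'a :: field mat"
  assumes M: "M \<in> carrier_mat k k" and z: "\<And>i j. i < k \<Longrightarrow> j < k \<Longrightarrow> i + j + 1 < k \<Longrightarrow> M $$ (i,j) = 0"
    and nz: "\<And>i j. i < k \<Longrightarrow> j < k \<Longrightarrow> i + j + 1 = k \<Longrightarrow> M $$ (i,j) \<noteq> 0"
  shows "invertible_mat M"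
proof (rule invertible_mat_if_inj[OF M])
  fix v assume v: "v \<in> carrier_vec k" "M *\<^sub>v v = 0\<^sub>v k"
  have "v $ (k - 1 - i) = 0" if "i < k" for i
    using that
  proof (induct i rule: less_induct)
    case (less i)
    have "M $$ (i,j) * v $ j = (if j = k - 1 - i then M $$ (i,j) * v $ j else 0)" if j: "j < k" for j
    proof -
      consider "i + j + 1 < k" | "i + j + 1 = k" | "i + j + 1 > k" by linarith
      then show ?thesis
      proof cases
        case 1
        then show ?thesis using z less.prems j by auto
      next
        case 2
        then show ?thesis by auto
      next
        case 3
        then have "k - 1 - j < i" "k - 1 - (k - 1 - j) = j" using j by auto
        then have "v $ j = 0" using less.hyps[of "k - 1 - j"] less.prems by auto
        moreover have "j \<noteq> k - 1 - i" using 3 less.prems by auto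
        ultimately show ?thesis by simp
      qed
    qed
    then have "(\<Sum>j<k. M $$ (i,j) * v $ j) = (\<Sum>j<k. if j = k - 1 - i then M $$ (i,j) * v $ j else 0)"
      by (intro sum.cong) auto
    also have "\<dots> = M $$ (i, k - 1 - i) * v $ (k - 1 - i)" using less.prems by simp
    also have "(\<Sum>j<k. M $$ (i,j) * v $ j) = (M *\<^sub>v v) $ i"
      using M v(1) less.prems by (simp add: scalar_prod_def lessThan_atLeast0)
    finally have "(M *\<^sub>v v) $ i = M $$ (i, k - 1 - i) * v $ (k - 1 - i)" .
    moreover have "(M *\<^sub>v v) $ i = 0" using v less.prems by simp
    ultimately show ?case using nz[of i "k - 1 - i"] less.prems by auto
  qed
  note * = this
  have "v $ j = 0" if "j < k" for j
  proof -
    have "k - 1 - (k - 1 - j) = j" using that by simp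
    then show ?thesis using *[of "k - 1 - j"] that by simp
  qed
  then show "v = 0\<^sub>v k" using v by (intro eq_vecI) auto
qed

context alg_closed_char_2
begin

lemma two_eq_zero: "(2 :: 'a) = 0"
  using add_self[of 1] by simp

text \<open>If the corner were 0, the whole leading antidiagonal would vanish, and with it the first
  row of the invertible matrix C.\<close>

lemma root_form_corner:
  fixes C :: "'a mat"
  assumes C: "root_form n C" and n: "1 \<le> n"
  shows "bf C (std_chain n 1) (std_chain n n) \<noteq> 0"
proof
  have Cc: "C \<in> carrier_mat n n" and inv: "invertible_mat C" and eq: "C = transpose_mat C * jordan_block n 1"
    using C unfolding root_form_def by auto
  note ch = chain_std[OF Cc eq]
  assume 0: "bf C (std_chain n 1) (std_chain n n) = 0"
  have V: "vanish_below n (Suc (Suc n)) (\<lambda>i j. bf C (std_chain n i) (std_chain n j))"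
    using vanish_below_Suc[OF chain_pair_rel[OF ch ch] pair_rel_vanish_below[OF chain_pair_rel[OF ch ch]], of 1 n] 0 n
    by simp
  have row: "C $$ (0,j) = 0" if "j < n" for j
  proof -
    have "bf C (std_chain n 1) (std_chain n (Suc j)) = 0" using V that n unfolding vanish_below_def by auto
    then show ?thesis using that n Cc by (simp add: std_chain_def bf_ue_ue)
  qed
  obtain B where B: "B \<in> carrier_mat n n" "C * B = 1\<^sub>m n" using inv invertible_mat_iff[OF Cc] by auto
  have "(C * B) $$ (0,0) = (\<Sum>j<n. C $$ (0,j) * B $$ (j,0))"
    using Cc B(1) n by (simp add: scalar_prod_def lessThan_atLeast0)
  also have "\<dots> = 0" using row by simp
  finally show False using B(2) n by simp
qed

text \<open>The Gram matrix of the standard chain of D is realised by a chain of the form C, and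
  this chain is the new basis.\<close>

lemma congruent_root_forms:
  fixes C D :: "'a mat"
  assumes n: "odd n" and C: "root_form n C" and D: "root_form n D"
  shows "congruent_mat C D"
proof -
  have n1: "1 \<le> n" using n by (cases n) auto
  have Cc: "C \<in> carrier_mat n n" and Ceq: "C = transpose_mat C * jordan_block n 1"
    using C unfolding root_form_def by auto
  have Dc: "D \<in> carrier_mat n n" and Deq: "D = transpose_mat D * jordan_block n 1" and Di: "invertible_mat D"
    using D unfolding root_form_def by auto
  let ?s = "std_chain n :: nat \<Rightarrow> nat \<Rightarrow> 'a"
  obtain x where x: "\<And>i j. i \<le> n \<Longrightarrow> j \<le> n \<Longrightarrow> bf C (x i) (x j) = bf D (?s i) (?s j)"
    using chain_realize_gram[OF chain_std[OF Cc Ceq] n root_form_corner[OF C n1]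
        chain_gram_rel[OF chain_std[OF Dc Deq]] root_form_corner[OF D n1]] by blast
  show ?thesis
  proof (rule congruent_matI_gram[OF Cc Dc Di])
    show "bf C (x (Suc i)) (x (Suc j)) = D $$ (i,j)" if "i < n" "j < n" for i j
      using x[of "Suc i" "Suc j"] that Dc by (simp add: std_chain_def bf_ue_ue)
  qed
qed

lemma congruent_if_cosquare_similar:
  fixes C D :: "'a mat"
  assumes n: "odd n" and C: "C \<in> carrier_mat n n" "invertible_mat C" "similar_mat (cosquare C) (jordan_block n 1)"
    and D: "D \<in> carrier_mat n n" "invertible_mat D" "similar_mat (cosquare D) (jordan_block n 1)"
  shows "congruent_mat C D"
proof -
  obtain C' D' where "congruent_mat C C'" "root_form n C'" "congruent_mat D D'" "root_form n D'"
    using congruent_root_form[OF C] congruent_root_form[OF D] by blast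
  then show ?thesis
    using congruent_root_forms[OF n] congruent_mat_trans congruent_mat_sym by blast
qed

text \<open>The columns of a matrix \<open>X\<close> with \<open>\<Gamma>' X = \<Gamma>'\<^sup>T X J\<^sub>n(1)\<close>, \<open>n = 2 h + 1\<close>, found by solving for one column after the other.\<close>

fun gamma_chain :: "nat \<Rightarrow> nat \<Rightarrow> nat \<Rightarrow> 'a" where
  "gamma_chain h 0 = (\<lambda>_. 0)"
| "gamma_chain h (Suc 0) = ue 0"
| "gamma_chain h (Suc (Suc j)) = (\<lambda>l. (if l = 0 then 0 else gamma_chain h (Suc j) (l - 1)) +
     (if Suc h \<le> l then gamma_chain h (Suc j) l else 0))"

lemma gamma_chain_zero: "j \<le> l \<Longrightarrow> gamma_chain h j l = 0"
proof (induct j arbitrary: l)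
  case (Suc j)
  show ?case
  proof (cases j)
    case 0
    then show ?thesis using Suc.prems by (simp add: ue_def)
  next
    case (Suc b)
    have "gamma_chain h j (l - 1) = 0" "gamma_chain h j l = 0"
      using Suc.hyps[of "l - 1"] Suc.hyps[of l] Suc.prems by auto
    then show ?thesis using Suc by simp
  qed
qed simp

lemma gamma_chain_diag: "gamma_chain h (Suc j) j = 1"
proof (induct j)
  case 0
  then show ?case by (simp add: ue_def)
next
  case (Suc j)
  then show ?case by (simp add: gamma_chain_zero)
qed

lemma Gamma'_index:
  assumes n: "n = 2 * h + 1" and ij: "i < n" "j < n"
  shows "(Gamma' n :: 'a mat) $$ (i,j) = (if i + j + 1 = n \<or> (i + j = n \<and> h < i) then 1 else 0)"
  using ij n unfolding Gamma'_def by (auto simp: Let_def)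

lemma Gamma'_invertible:
  assumes n: "odd n"
  shows "invertible_mat (Gamma' n :: 'a mat)"
proof -
  obtain h where h: "n = 2 * h + 1" using n by (elim oddE)
  show ?thesis
    by (rule anti_triangular_invertible[of _ n]) (auto simp: Gamma'_index[OF h] Gamma'_def)
qed

text \<open>X is unitriangular and satisfies \<open>?G * X = transpose_mat ?G * X * ?J\<close>;
  cancelling the transpose shows that X conjugates the cosquare to \<open>?J\<close>.\<close>

lemma Gamma'_cosquare_similar:
  assumes n: "odd n"
  shows "similar_mat (cosquare (Gamma' n :: 'a mat)) (jordan_block n 1)"
proof -
  obtain h where h: "n = 2 * h + 1" using n by (elim oddE)
  let ?G = "Gamma' n :: 'a mat"
  let ?J = "jordan_block n (1 :: 'a)"
  let ?g = "gamma_chain h"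
  have G: "?G \<in> carrier_mat n n" unfolding Gamma'_def by simp
  define X where "X = mat n n (\<lambda>(l,j). ?g (Suc j) l)"
  have X: "X \<in> carrier_mat n n" unfolding X_def by simp
  have "upper_triangular X" unfolding upper_triangular_def X_def by (auto simp: gamma_chain_zero)
  then have "det X = prod_list (diag_mat X)" by (rule det_upper_triangular[OF _ X])
  moreover have "diag_mat X = map (\<lambda>_. 1) [0..<n]"
    unfolding diag_mat_def X_def by (auto simp: gamma_chain_diag)
  ultimately have "det X = 1" by (simp add: map_replicate_const)
  then have iX: "invertible_mat X" using invertible_mat_iff_det[OF X] by simp
  have Gr: "(?G * X) $$ (i,j) = ?g (Suc j) (n - 1 - i) + (if h < i then ?g (Suc j) (n - i) else 0)"
    if ij: "i < n" "j < n" for i j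
  proof -
    have "(?G * X) $$ (i,j) = (\<Sum>l<n. ?G $$ (i,l) * ?g (Suc j) l)"
      using G ij by (simp add: scalar_prod_def lessThan_atLeast0 X_def)
    also have "\<dots> = (\<Sum>l<n. (if l = n - 1 - i then ?g (Suc j) l else 0) + (if l = n - i then (if h < i then ?g (Suc j) l else 0) else 0))"
      using ij by (intro sum.cong) (auto simp: Gamma'_index[OF h])
    also have "\<dots> = ?g (Suc j) (n - 1 - i) + (if h < i then ?g (Suc j) (n - i) else 0)"
      using ij by (auto simp: sum.distrib)
    finally show ?thesis .
  qed
  have GTr: "(transpose_mat ?G * X) $$ (i,j) = ?g (Suc j) (n - 1 - i) + (if 0 < i \<and> i \<le> h then ?g (Suc j) (n - i) else 0)"
    if ij: "i < n" "j < n" for i j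
  proof -
    have "(transpose_mat ?G * X) $$ (i,j) = (\<Sum>l<n. ?G $$ (l,i) * ?g (Suc j) l)"
      using G ij by (simp add: scalar_prod_def lessThan_atLeast0 X_def)
    also have "\<dots> = (\<Sum>l<n. (if l = n - 1 - i then ?g (Suc j) l else 0) + (if l = n - i then (if 0 < i \<and> i \<le> h then ?g (Suc j) l else 0) else 0))"
    proof (intro sum.cong refl)
      fix l assume "l \<in> {..<n}"
      then have l: "l < n" by simp
      have a: "l + i + 1 = n \<longleftrightarrow> l = n - 1 - i" using ij l by auto
      have b: "l + i = n \<and> h < l \<longleftrightarrow> l = n - i \<and> 0 < i \<and> i \<le> h" using ij l h by auto
      show "?G $$ (l,i) * ?g (Suc j) l = (if l = n - 1 - i then ?g (Suc j) l else 0) +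
        (if l = n - i then (if 0 < i \<and> i \<le> h then ?g (Suc j) l else 0) else 0)"
        unfolding Gamma'_index[OF h l ij(1)] a b using ij by auto
    qed
    also have "\<dots> = ?g (Suc j) (n - 1 - i) + (if 0 < i \<and> i \<le> h then ?g (Suc j) (n - i) else 0)"
      using ij by (auto simp: sum.distrib)
    finally show ?thesis .
  qed
  have GX: "?G * X = transpose_mat ?G * X * ?J"
  proof (rule eq_matI)
    fix i j assume "i < dim_row (transpose_mat ?G * X * ?J)" "j < dim_col (transpose_mat ?G * X * ?J)"
    then have ij: "i < n" "j < n" using G by auto
    have M: "transpose_mat ?G * X \<in> carrier_mat n n" using G X by simp
    have R: "(transpose_mat ?G * X * ?J) $$ (i,j) = (transpose_mat ?G * X) $$ (i,j) +
      (if j = 0 then 0 else (transpose_mat ?G * X) $$ (i, j - 1))"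
      using mult_jordan_block_index[OF M ij, of 1] by simp
    show "(?G * X) $$ (i,j) = (transpose_mat ?G * X * ?J) $$ (i,j)"
    proof (cases j)
      case 0
      then show ?thesis unfolding R using Gr[OF ij] GTr[OF ij] ij by (auto simp: gamma_chain_zero ue_def)
    next
      case (Suc b)
      have b: "b < n" using ij Suc by simp
      have eq: "(transpose_mat ?G * X * ?J) $$ (i,j) = ?g (Suc j) (n - 1 - i) + (if 0 < i \<and> i \<le> h then ?g (Suc j) (n - i) else 0)
        + (?g (Suc b) (n - 1 - i) + (if 0 < i \<and> i \<le> h then ?g (Suc b) (n - i) else 0))"
        unfolding R using GTr[OF ij] GTr[OF ij(1) b] Suc by simp
      show ?thesis
      proof (cases "i = 0")
        case True
        have "?g (Suc b) (n - 1) = 0" using ij Suc by (intro gamma_chain_zero) auto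
        then show ?thesis unfolding eq using Gr[OF ij] True by simp
      next
        case False
        \<comment> \<open>The recursion of \<open>gamma_chain\<close> at position n - i. For i \<le>
          h the right-hand side contains this value twice and characteristic 2 removes it; for i > h
          it is the second term of the left-hand side.\<close>
        have rec: "?g (Suc j) (n - i) = ?g (Suc b) (n - 1 - i) + (if i \<le> h then ?g (Suc b) (n - i) else 0)"
          unfolding Suc using False ij h by auto
        show ?thesis
        proof (cases "i \<le> h")
          case True
          then show ?thesis unfolding eq Gr[OF ij] using rec False two_eq_zero by simp
        next
          case F: False
          then show ?thesis unfolding eq Gr[OF ij] using rec False by simp
        qed
      qed
    qed
  qed (use G X in auto)
  let ?P = "cosquare ?G"
  note iG = Gamma'_invertible[OF n]
  have P: "?P \<in> carrier_mat n n" by (rule cosquare_carrier[OF G iG])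
  let ?I = "mat_inv (transpose_mat ?G)"
  have I: "?I \<in> carrier_mat n n" "?I * transpose_mat ?G = 1\<^sub>m n"
    using mat_inv_inverts[of "transpose_mat ?G" n] G iG by (auto simp: invertible_mat_transpose[OF G])
  obtain Y where Y: "Y \<in> carrier_mat n n" "X * Y = 1\<^sub>m n" "Y * X = 1\<^sub>m n"
    using iX invertible_mat_iff[OF X] by auto
  have J: "?J \<in> carrier_mat n n" by simp
  have "?P = ?P * (X * Y)" using P Y by simp
  also have "\<dots> = ?I * (?G * X) * Y" unfolding cosquare_def using G X Y(1) I(1)
    by (simp add: assoc_mult_mat[of _ n n _ n _ n])
  also have "\<dots> = (?I * transpose_mat ?G) * X * ?J * Y" unfolding GX using G X Y(1) I(1) J
    by (simp add: assoc_mult_mat[of _ n n _ n _ n])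
  also have "\<dots> = X * ?J * Y" using I X by simp
  finally have e: "?P = X * ?J * Y" .
  have "similar_mat_wit ?P ?J X Y" by (rule similar_mat_witI[OF Y(2,3) e P J X Y(1)])
  then show ?thesis unfolding similar_mat_def by blast
qed

lemma exists_root_form:
  assumes n: "odd n"
  shows "\<exists>C :: 'a mat. root_form n C"
  using congruent_root_form[of "Gamma' n" n] Gamma'_invertible[OF n] Gamma'_cosquare_similar[OF n]
  by (auto simp: Gamma'_def)

end

section \<open>Existence\<close>

text \<open>The inverse H of the Gram matrix turns products with the family into coordinates. Their
  kernel is orthogonal to the family on one side, and \<open>orth\<close> supplies the other
  side.\<close>

lemma gram_split:
  fixes A :: "'a :: field mat"
  defines "G \<equiv> \<lambda>n s. mat n n (\<lambda>(i,j). bf A (s i) (s j))"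
  assumes A: "A \<in> carrier_mat m m" and inv: "invertible_mat (G n s)"
    and orth: "\<And>v. (\<And>j. j < n \<Longrightarrow> bf A (s j) v = 0) \<Longrightarrow> (\<And>j. j < n \<Longrightarrow> bf A v (s j) = 0)"
  shows "\<exists>d A2. m = n + d \<and> A2 \<in> carrier_mat d d \<and> congruent_mat A (dsum (G n s) A2)"
proof -
  define S where "S = mat m n (\<lambda>(i,j). s j i)"
  have S: "S \<in> carrier_mat m n" unfolding S_def by auto
  have G: "G n s \<in> carrier_mat n n" unfolding G_def by auto
  have SAS: "transpose_mat S * A * S = G n s"
  proof (rule eq_matI)
    fix i j assume "i < dim_row (G n s)" "j < dim_col (G n s)"
    then have ij: "i < n" "j < n" using G by auto
    have "bf A (\<lambda>l. S $$ (l,i)) (\<lambda>l. S $$ (l,j)) = bf A (s i) (s j)"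
      using A ij by (intro bf_cong) (auto simp: S_def)
    then show "(transpose_mat S * A * S) $$ (i,j) = G n s $$ (i,j)"
      using gram_index[OF A S S ij] ij unfolding G_def by simp
  qed (use S G in auto)
  obtain H where H: "H \<in> carrier_mat n n" "G n s * H = 1\<^sub>m n" "H * G n s = 1\<^sub>m n"
    using inv invertible_mat_iff[OF G] by auto
  define X where "X = transpose_mat S * A"
  have X: "X \<in> carrier_mat n m" unfolding X_def using S A by simp
  have HX: "H * X \<in> carrier_mat n m" using H X by simp
  have LS: "H * X * S = 1\<^sub>m n"
  proof -
    have "H * X * S = H * (X * S)" using H(1) X S by (rule assoc_mult_mat)
    then show ?thesis unfolding X_def SAS H(3) .
  qed
  have o: "X *\<^sub>v v = 0\<^sub>v n \<and> transpose_mat S * transpose_mat A *\<^sub>v v = 0\<^sub>v n"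
    if v: "v \<in> carrier_vec m" and 0: "H * X *\<^sub>v v = 0\<^sub>v n" for v
  proof -
    have Xv: "X *\<^sub>v v \<in> carrier_vec n" using X v by simp
    have "X *\<^sub>v v = (G n s * H) *\<^sub>v (X *\<^sub>v v)" unfolding H(2) using Xv by simp
    also have "\<dots> = G n s *\<^sub>v (H *\<^sub>v (X *\<^sub>v v))" using G H(1) Xv by (rule assoc_mult_mat_vec)
    also have "H *\<^sub>v (X *\<^sub>v v) = 0\<^sub>v n" using 0 assoc_mult_mat_vec[OF H(1) X v] by simp
    also have "G n s *\<^sub>v 0\<^sub>v n = 0\<^sub>v n" using G by (rule mult_mat_vec_zero)
    finally have X0: "X *\<^sub>v v = 0\<^sub>v n" .
    have "bf A (s j) (\<lambda>l. v $ l) = 0" if "j < n" for j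
      using gram_vec_index[OF A v that, of s] X0 that unfolding X_def S_def by simp
    then have r: "bf A (\<lambda>l. v $ l) (s j) = 0" if "j < n" for j using orth that by blast
    have "transpose_mat S * transpose_mat A *\<^sub>v v = 0\<^sub>v n"
    proof (rule eq_vecI)
      fix i assume "i < dim_vec (0\<^sub>v n :: 'a vec)"
      then have i: "i < n" by simp
      show "(transpose_mat S * transpose_mat A *\<^sub>v v) $ i = 0\<^sub>v n $ i"
        using gram_vec_index[of "transpose_mat A" m v i n s] A v i r[OF i] bf_transpose[OF A]
        unfolding S_def by simp
    qed (use S in simp)
    then show ?thesis using X0 by simp
  qed
  show ?thesis
    using congruent_mat_split[OF A S HX LS o[unfolded X_def]] unfolding SAS X_def by blast
qed

section \<open>Blocks \<open>[0 I; J 0]\<close> as summands\<close>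

lemma pair_block_invertible:
  fixes l :: "'a :: field"
  assumes "l \<noteq> 0"
  shows "invertible_mat (four_block_mat (0\<^sub>m k k) (1\<^sub>m k) (jordan_block k l) (0\<^sub>m k k))"
proof -
  let ?J = "jordan_block k l"
  have J: "?J \<in> carrier_mat k k" by simp
  have "upper_triangular ?J" unfolding upper_triangular_def by auto
  then have "det ?J = prod_list (diag_mat ?J)" by (rule det_upper_triangular[OF _ J])
  moreover have "diag_mat ?J = map (\<lambda>_. l) [0..<k]" unfolding diag_mat_def by auto
  ultimately have "det ?J = l ^ k" by (simp add: map_replicate_const prod_list_replicate)
  then have "invertible_mat ?J" using invertible_mat_iff_det[OF J] assms by simp
  then obtain I where I: "I \<in> carrier_mat k k" "?J * I = 1\<^sub>m k" "I * ?J = 1\<^sub>m k"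
    using invertible_mat_iff[OF J] by auto
  let ?B = "four_block_mat (0\<^sub>m k k) (1\<^sub>m k) ?J (0\<^sub>m k k)"
  let ?C = "four_block_mat (0\<^sub>m k k) I (1\<^sub>m k) (0\<^sub>m k k)"
  have B: "?B \<in> carrier_mat (k + k) (k + k)" and C: "?C \<in> carrier_mat (k + k) (k + k)"
    by (auto intro!: four_block_carrier_mat)
  have "?B * ?C = 1\<^sub>m (k + k)" "?C * ?B = 1\<^sub>m (k + k)"
    using I by (auto simp: mult_four_block_mat[of _ k k _ k _ k _ _ k _ k])
  then show ?thesis unfolding invertible_mat_iff[OF B] using C by blast
qed

text \<open>A change of basis in the second half by the inverse of T normalises both off-diagonal
  blocks at once.\<close>

lemma congruent_pair_block:
  fixes T :: "'a :: field mat"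
  assumes T: "T \<in> carrier_mat k k" and inv: "invertible_mat T"
  shows "congruent_mat (four_block_mat (0\<^sub>m k k) T (transpose_mat T * jordan_block k l) (0\<^sub>m k k))
    (four_block_mat (0\<^sub>m k k) (1\<^sub>m k) (jordan_block k l) (0\<^sub>m k k))"
proof -
  let ?J = "jordan_block k l"
  have J: "?J \<in> carrier_mat k k" by simp
  obtain I where I: "I \<in> carrier_mat k k" "T * I = 1\<^sub>m k" "I * T = 1\<^sub>m k"
    using inv invertible_mat_iff[OF T] by auto
  have It: "transpose_mat I * transpose_mat T = 1\<^sub>m k" using transpose_mult[OF T I(1)] I(2) by simp
  let ?G = "four_block_mat (0\<^sub>m k k) T (transpose_mat T * ?J) (0\<^sub>m k k)"
  let ?P = "four_block_mat (1\<^sub>m k) (0\<^sub>m k k) (0\<^sub>m k k) I"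
  have G: "?G \<in> carrier_mat (k + k) (k + k)" and P: "?P \<in> carrier_mat (k + k) (k + k)"
    using I by (auto intro!: four_block_carrier_mat)
  have iP: "invertible_mat ?P"
  proof -
    let ?Q = "four_block_mat (1\<^sub>m k) (0\<^sub>m k k) (0\<^sub>m k k) T"
    have "?P * ?Q = 1\<^sub>m (k + k)" "?Q * ?P = 1\<^sub>m (k + k)"
      using I T by (auto simp: mult_four_block_mat[of _ k k _ k _ k _ _ k _ k])
    moreover have "?Q \<in> carrier_mat (k + k) (k + k)" using T by (auto intro!: four_block_carrier_mat)
    ultimately show ?thesis unfolding invertible_mat_iff[OF P] by blast
  qed
  have e: "transpose_mat I * (transpose_mat T * ?J) = ?J"
  proof -
    have "transpose_mat I * (transpose_mat T * ?J) = (transpose_mat I * transpose_mat T) * ?J"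
      using I(1) T J by (simp add: assoc_mult_mat[of _ k k _ k _ k])
    then show ?thesis unfolding It using J by simp
  qed
  have "transpose_mat ?P = four_block_mat (1\<^sub>m k) (0\<^sub>m k k) (0\<^sub>m k k) (transpose_mat I)"
    using I by (subst transpose_four_block_mat[of _ k k _ k _ k]) auto
  moreover have "four_block_mat (1\<^sub>m k) (0\<^sub>m k k) (0\<^sub>m k k) (transpose_mat I) * ?G =
      four_block_mat (0\<^sub>m k k) T ?J (0\<^sub>m k k)"
    using I(1) T e by (simp add: mult_four_block_mat[of _ k k _ k _ k _ _ k _ k])
  moreover have "four_block_mat (0\<^sub>m k k) T ?J (0\<^sub>m k k) * ?P =
      four_block_mat (0\<^sub>m k k) (1\<^sub>m k) ?J (0\<^sub>m k k)"
    using I T J by (simp add: mult_four_block_mat[of _ k k _ k _ k _ _ k _ k])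
  ultimately have "transpose_mat ?P * ?G * ?P = four_block_mat (0\<^sub>m k k) (1\<^sub>m k) ?J (0\<^sub>m k k)" by simp
  then show ?thesis by (rule congruent_matI[OF G P iP])
qed

text \<open>The chain relation of x turns the lower left Gram block into
  \<open>transpose_mat Tm * jordan_block k l\<close>, so only invertibility of Tm matters.
  Orthogonality to x becomes two-sided by the chain relation; for y this is an assumption, because y
  is a dual chain for l \<noteq> 1 but a chain for l = 1.\<close>

lemma chain_pair_split:
  fixes A :: "'a :: field mat"
  assumes A: "A \<in> carrier_mat m m" and x: "chain A l k x" and l: "l \<noteq> 0"
    and xx: "\<And>i j. i \<le> k \<Longrightarrow> j \<le> k \<Longrightarrow> bf A (x i) (x j) = 0"
    and yy: "\<And>i j. 1 \<le> i \<Longrightarrow> i \<le> k \<Longrightarrow> 1 \<le> j \<Longrightarrow> j \<le> k \<Longrightarrow> bf A (y i) (y j) = 0"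
    and T: "invertible_mat (mat k k (\<lambda>(i,j). bf A (x (Suc i)) (y (Suc j))))"
    and orth: "\<And>v. (\<And>j. 1 \<le> j \<Longrightarrow> j \<le> k \<Longrightarrow> bf A (y j) v = 0) \<Longrightarrow> (\<And>j. 1 \<le> j \<Longrightarrow> j \<le> k \<Longrightarrow> bf A v (y j) = 0)"
  shows "\<exists>d A2. m = 2 * k + d \<and> A2 \<in> carrier_mat d d \<and>
    congruent_mat A (dsum (four_block_mat (0\<^sub>m k k) (1\<^sub>m k) (jordan_block k l) (0\<^sub>m k k)) A2)"
proof -
  let ?B = "four_block_mat (0\<^sub>m k k) (1\<^sub>m k) (jordan_block k l) (0\<^sub>m k k)"
  define s where "s = (\<lambda>j. if j < k then x (Suc j) else y (Suc (j - k)))"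
  define Tm where "Tm = mat k k (\<lambda>(i,j). bf A (x (Suc i)) (y (Suc j)))"
  have Tm: "Tm \<in> carrier_mat k k" unfolding Tm_def by simp
  have G: "mat (2 * k) (2 * k) (\<lambda>(i,j). bf A (s i) (s j)) =
    four_block_mat (0\<^sub>m k k) Tm (transpose_mat Tm * jordan_block k l) (0\<^sub>m k k)" (is "?G = ?F")
  proof (rule eq_matI)
    fix i j assume "i < dim_row ?F" "j < dim_col ?F"
    then have ij: "i < 2 * k" "j < 2 * k" using Tm by auto
    consider "i < k" "j < k" | "i < k" "\<not> j < k" | "\<not> i < k" "j < k" | "\<not> i < k" "\<not> j < k" by blast
    then show "?G $$ (i,j) = ?F $$ (i,j)"
    proof cases
      case 1
      then show ?thesis using ij xx Tm by (simp add: s_def)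
    next
      case 2
      then show ?thesis using ij Tm by (auto simp: s_def Tm_def)
    next
      case 3
      let ?i = "i - k"
      have i: "?i < k" using 3 ij by simp
      have "(transpose_mat Tm * jordan_block k l) $$ (?i,j) =
        l * transpose_mat Tm $$ (?i,j) + (if j = 0 then 0 else transpose_mat Tm $$ (?i, j - 1))"
        using mult_jordan_block_index[of "transpose_mat Tm" k k ?i j l] Tm i 3 by simp
      also have "\<dots> = l * bf A (x (Suc j)) (y (Suc ?i)) + bf A (x j) (y (Suc ?i))"
        using Tm i 3 chain_0[OF x] by (auto simp: Tm_def)
      also have "\<dots> = bf A (y (Suc ?i)) (x (Suc j))" using chainD[OF x 3(2)] by simp
      finally show ?thesis using 3 ij Tm by (auto simp: s_def simp del: index_mult_mat(1))
    next
      case 4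
      then show ?thesis using ij yy[of "Suc (i - k)" "Suc (j - k)"] Tm by (auto simp: s_def)
    qed
  qed (use Tm in auto)
  have F: "?F \<in> carrier_mat (2 * k) (2 * k)" using Tm by (auto simp: mult_2 intro!: four_block_carrier_mat)
  have cong: "congruent_mat ?F ?B" using congruent_pair_block[OF Tm] T unfolding Tm_def by blast
  have inv: "invertible_mat ?G"
    unfolding G using congruent_mat_invertible[OF cong F] pair_block_invertible[OF l] by blast
  have "\<exists>d A2. m = 2 * k + d \<and> A2 \<in> carrier_mat d d \<and> congruent_mat A (dsum ?G A2)"
  proof (rule gram_split[OF A inv])
    fix v j assume h: "\<And>j. j < 2 * k \<Longrightarrow> bf A (s j) v = 0" and j: "j < 2 * k"
    have hx: "bf A (x i) v = 0" if "i \<le> k" for i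
      using h[of "i - 1"] that chain_0[OF x] by (cases i) (auto simp: s_def)
    have hy: "bf A (y i) v = 0" if "1 \<le> i" "i \<le> k" for i
      using h[of "k + (i - 1)"] that by (cases i) (auto simp: s_def)
    show "bf A v (s j) = 0"
    proof (cases "j < k")
      case True
      then show ?thesis using chainD[OF x True, of v] hx by (simp add: s_def)
    next
      case False
      then show ?thesis using orth[OF hy, of "Suc (j - k)"] j by (simp add: s_def)
    qed
  qed
  then obtain d A2 where 1: "m = 2 * k + d" "A2 \<in> carrier_mat d d" "congruent_mat A (dsum ?F A2)"
    unfolding G by blast
  have "congruent_mat (dsum ?F A2) (dsum ?B A2)"
    by (rule congruent_mat_dsum[OF cong congruent_mat_refl[OF 1(2)]])
  then show ?thesis using 1 congruent_mat_trans by blast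
qed

text \<open>Applying the chain relation to one argument and then to the other returns to the same
  product with the factor l * l, up to products with smaller index sum.\<close>

lemma chain_isotropic:
  fixes A :: "'a :: field mat"
  assumes x: "chain A l k x" and l: "l * l \<noteq> 1" and ij: "i \<le> k" "j \<le> k"
  shows "bf A (x i) (x j) = 0"
  using ij
proof (induct "i + j" arbitrary: i j rule: less_induct)
  case less
  show ?case
  proof (cases "i = 0 \<or> j = 0")
    case True
    then show ?thesis using chain_0[OF x] by auto
  next
    case False
    then obtain a b where ab: "i = Suc a" "j = Suc b" by (metis not0_implies_Suc)
    have "bf A (x i) (x j) = l * bf A (x j) (x i) + bf A (x b) (x i)"
      unfolding ab(2) using less.prems ab by (intro chainD[OF x]) auto
    also have "bf A (x b) (x i) = 0" using less.hyps[of b i] less.prems ab by simp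
    also have "bf A (x j) (x i) = l * bf A (x i) (x j) + bf A (x a) (x j)"
      unfolding ab(1) using less.prems ab by (intro chainD[OF x]) auto
    also have "bf A (x a) (x j) = 0" using less.hyps[of a j] less.prems ab by simp
    finally have "(1 - l * l) * bf A (x i) (x j) = 0" by (simp add: algebra_simps)
    then show ?thesis using l by simp
  qed
qed

text \<open>As for chains, but the links of a dual chain raise the indices, so the induction runs
  downwards from the zero members beyond k.\<close>

lemma dual_chain_isotropic:
  fixes A :: "'a :: field mat"
  assumes y0: "\<And>j. k < j \<Longrightarrow> y j = (\<lambda>_. 0)"
    and ys: "\<And>j w. 1 \<le> j \<Longrightarrow> bf A (y j) w = l * bf A w (y j) + bf A w (y (Suc j))"
    and l: "l * l \<noteq> 1" and ij: "1 \<le> i" "1 \<le> j"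
  shows "bf A (y i) (y j) = 0"
  using ij
proof (induct "2 * k + 2 - (i + j)" arbitrary: i j rule: less_induct)
  case less
  show ?case
  proof (cases "i \<le> k \<and> j \<le> k")
    case False
    then have "y i = (\<lambda>_. 0) \<or> y j = (\<lambda>_. 0)" using y0 by auto
    then show ?thesis by auto
  next
    case True
    have "bf A (y i) (y j) = l * bf A (y j) (y i) + bf A (y j) (y (Suc i))"
      by (rule ys[OF less.prems(1)])
    also have "bf A (y j) (y (Suc i)) = 0" using less.prems True by (intro less.hyps) auto
    also have "bf A (y j) (y i) = l * bf A (y i) (y j) + bf A (y i) (y (Suc j))"
      by (rule ys[OF less.prems(2)])
    also have "bf A (y i) (y (Suc j)) = 0" using less.prems True by (intro less.hyps) auto
    finally have "(1 - l * l) * bf A (y i) (y j) = 0" by (simp add: algebra_simps)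
    then show ?thesis using l by simp
  qed
qed

context alg_closed_char_2
begin

text \<open>Let sigma map each y_j to y_(j+1). The dual links say A^T = A (1 + sigma) on the span of
  y, hence A = A^T (1 + nu) with nu = (1 + sigma)^(-1) - 1, which in characteristic 2 is sigma +
  sigma^2 + .... Since sigma is nilpotent, the powers of nu applied to y_1 form a chain ending in
  y_1.\<close>

lemma dual_chain_to_chain:
  fixes A :: "'a mat"
  assumes y0: "\<And>j. j = 0 \<or> k < j \<Longrightarrow> y j = (\<lambda>_. 0)" and k: "1 \<le> k"
    and ys: "\<And>j w. 1 \<le> j \<Longrightarrow> bf A (y j) w = bf A w (y j) + bf A w (y (Suc j))"
  shows "\<exists>z. chain A 1 k z \<and> z k = y 1"
proof -
  define lin where "lin = (\<lambda>(a :: nat \<Rightarrow> 'a) i. \<Sum>j\<in>{1..k}. a j * y j i)"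
  \<comment> \<open>The action of nu on coefficient vectors: each y_i is sent to the sum of all
    later members.\<close>
  define N where "N = (\<lambda>(a :: nat \<Rightarrow> 'a) j. \<Sum>i\<in>{1..<j}. a i)"
  have tele: "(\<Sum>j\<in>{Suc i..k}. bf A (y j) w) = bf A w (y (Suc i))" if "1 \<le> i" for i w
  proof (induct "k - i" arbitrary: i)
    case 0
    then show ?case using y0[of "Suc i"] by simp
  next
    case (Suc d)
    then have "{Suc i..k} = insert (Suc i) {Suc (Suc i)..k}" by auto
    then have "(\<Sum>j\<in>{Suc i..k}. bf A (y j) w) = bf A (y (Suc i)) w + (\<Sum>j\<in>{Suc (Suc i)..k}. bf A (y j) w)" by simp
    also have "\<dots> = bf A (y (Suc i)) w + bf A w (y (Suc (Suc i)))" using Suc.hyps(1)[of "Suc i"] Suc.hyps(2) by simp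
    also have "\<dots> = bf A w (y (Suc i))" using ys[of "Suc i" w] add_self by (simp add: add.assoc)
    finally show ?case .
  qed
  have step: "bf A w (lin a) = bf A (lin a) w + bf A (lin (N a)) w" for a w
  proof -
    have "bf A (lin (N a)) w = (\<Sum>j\<in>{1..k}. \<Sum>i\<in>{1..<j}. a i * bf A (y j) w)"
      unfolding lin_def N_def bf_sum_left by (simp add: sum_distrib_right)
    also have "\<dots> = (\<Sum>i\<in>{1..k}. \<Sum>j\<in>{Suc i..k}. a i * bf A (y j) w)"
      by (subst sum.Sigma, simp, simp, subst sum.Sigma, simp, simp,
          rule sum.reindex_bij_witness[of _ "\<lambda>(i,j). (j,i)" "\<lambda>(i,j). (j,i)"]) auto
    also have "\<dots> = (\<Sum>i\<in>{1..k}. a i * bf A w (y (Suc i)))"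
      by (intro sum.cong refl) (simp add: tele sum_distrib_left[symmetric])
    finally have n: "bf A (lin (N a)) w = (\<Sum>i\<in>{1..k}. a i * bf A w (y (Suc i)))" .
    have "bf A (lin a) w = (\<Sum>i\<in>{1..k}. a i * (bf A w (y i) + bf A w (y (Suc i))))"
      unfolding lin_def bf_sum_left by (intro sum.cong refl) (simp add: ys)
    also have "\<dots> = (\<Sum>i\<in>{1..k}. a i * bf A w (y i)) + bf A (lin (N a)) w"
      unfolding n by (simp add: algebra_simps sum.distrib)
    also have "(\<Sum>i\<in>{1..k}. a i * bf A w (y i)) = bf A w (lin a)"
      unfolding lin_def bf_sum_right ..
    finally show ?thesis using add_self[of "bf A (lin (N a)) w"] by (simp add: add.assoc)
  qed
  define a0 where "a0 = (\<lambda>j :: nat. if j = 1 then 1 else 0 :: 'a)"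
  have supp: "(N ^^ s) a0 j = 0" if "j \<le> s" "1 \<le> j" for s j
    using that
  proof (induct s arbitrary: j)
    case (Suc s)
    have "(N ^^ Suc s) a0 j = (\<Sum>i\<in>{1..<j}. (N ^^ s) a0 i)" by (simp only: funpow.simps comp_apply N_def)
    also have "\<dots> = 0" using Suc by (intro sum.neutral) auto
    finally show ?case .
  qed simp
  define z where "z = (\<lambda>j. lin ((N ^^ (k - j)) a0))"
  have "chain A 1 k z"
    unfolding chain_def
  proof (intro conjI allI impI)
    show "z 0 = (\<lambda>_. 0)" unfolding z_def lin_def using supp[of _ k] by (intro ext) (auto intro!: sum.neutral)
    fix j w assume j: "j < k"
    have "z j = lin (N ((N ^^ (k - Suc j)) a0))"
      unfolding z_def using j by (metis Suc_diff_Suc comp_apply funpow.simps(2))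
    then show "bf A w (z (Suc j)) = 1 * bf A (z (Suc j)) w + bf A (z j) w"
      using step[of w "(N ^^ (k - Suc j)) a0"] unfolding z_def by simp
  qed
  moreover have "z k = y 1"
  proof
    fix i
    have "z k = lin a0" unfolding z_def by simp
    then have "z k i = (\<Sum>j\<in>{1..k}. a0 j * y j i)" unfolding lin_def by simp
    also have "\<dots> = (\<Sum>j\<in>{1..k}. if j = 1 then y j i else 0)"
      by (rule sum.cong) (auto simp: a0_def)
    finally have "z k i = (\<Sum>j\<in>{1..k}. if j = 1 then y j i else 0)" .
    then show "z k i = y 1 i" using k by simp
  qed
  ultimately show ?thesis by blast
qed

end

section \<open>Splitting one block off an arbitrary square matrix\<close>

lemma block_size_pos: "block_ok b \<Longrightarrow> 0 < block_size b"
  by (cases b) (auto elim: oddE)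

lemma invertible_mat_kernel:
  fixes A :: "'a :: field mat"
  assumes "A \<in> carrier_mat n n" "invertible_mat A" "v \<in> carrier_vec n" "A *\<^sub>v v = 0\<^sub>v n"
  shows "v = 0\<^sub>v n"
  using assms invertible_mat_iff_det[of A n] det_0_iff_vec_prod_zero_field[of A n] by auto

lemma bf_nondegenerate:
  fixes A :: "'a :: field mat"
  assumes A: "A \<in> carrier_mat m m" and inv: "invertible_mat A" and x: "\<And>w. bf A x w = 0"
  shows "null A x"
proof -
  let ?u = "vec m x"
  have "transpose_mat A *\<^sub>v ?u = 0\<^sub>v m"
  proof (rule eq_vecI)
    fix i assume "i < dim_vec (0\<^sub>v m :: 'a vec)"
    then have i: "i < m" by simp
    have "(transpose_mat A *\<^sub>v ?u) $ i = bf (transpose_mat A) (ue i) (\<lambda>j. ?u $ j)"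
      using A i by (intro mult_mat_vec_index_bf) auto
    also have "\<dots> = bf (transpose_mat A) (ue i) x" using A by (intro bf_cong) auto
    also have "\<dots> = 0" using x by (simp add: bf_transpose[OF A])
    finally show "(transpose_mat A *\<^sub>v ?u) $ i = 0\<^sub>v m $ i" using i by simp
  qed (use A in simp)
  then have "?u = 0\<^sub>v m"
    using invertible_mat_kernel[of "transpose_mat A" m ?u] A inv by (simp add: invertible_mat_transpose[OF A])
  then have "x i = 0" if "i < dim_row A" for i using that A by (metis carrier_matD(1) index_vec index_zero_vec(1))
  then have "bf A w x = bf A w (\<lambda>_. 0)" for w by (intro bf_cong) auto
  then show ?thesis using x unfolding null_def by simp
qed

lemma bf_eigenvector:
  fixes A :: "'a :: field mat"
  assumes A: "A \<in> carrier_mat m m" and v: "v \<in> carrier_vec m"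
    and e: "A *\<^sub>v v = l \<cdot>\<^sub>v (transpose_mat A *\<^sub>v v)"
  shows "bf A w (\<lambda>i. v $ i) = l * bf A (\<lambda>i. v $ i) w"
proof -
  let ?x = "\<lambda>i. v $ i"
  have "bf A (ue i) ?x = l * bf A ?x (ue i)" if i: "i < m" for i
  proof -
    have "bf A (ue i) ?x = (A *\<^sub>v v) $ i" using mult_mat_vec_index_bf[OF A v i] by simp
    also have "\<dots> = l * (transpose_mat A *\<^sub>v v) $ i" unfolding e using i A by simp
    also have "(transpose_mat A *\<^sub>v v) $ i = bf A ?x (ue i)"
      using mult_mat_vec_index_bf[of "transpose_mat A" m v i] A v i by (simp add: bf_transpose[OF A])
    finally show ?thesis .
  qed
  then have "(\<Sum>i<m. w i * bf A (ue i) ?x) = (\<Sum>i<m. w i * (l * bf A ?x (ue i)))"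
    by (intro sum.cong) auto
  then show ?thesis
    unfolding bf_expand_left[of A w] bf_expand_right[of A _ w] using A
    by (simp add: sum_distrib_left mult_ac)
qed

lemma null_vec_iff:
  fixes A :: "'a :: field mat"
  assumes A: "A \<in> carrier_mat m m" and v: "v \<in> carrier_vec m"
  shows "null A (\<lambda>i. v $ i) \<longleftrightarrow> A *\<^sub>v v = 0\<^sub>v m \<and> transpose_mat A *\<^sub>v v = 0\<^sub>v m"
proof -
  let ?x = "\<lambda>i. v $ i"
  have 1: "(A *\<^sub>v v) $ i = bf A (ue i) ?x" if "i < m" for i using mult_mat_vec_index_bf[OF A v that] .
  have 2: "(transpose_mat A *\<^sub>v v) $ i = bf A ?x (ue i)" if "i < m" for i
    using mult_mat_vec_index_bf[of "transpose_mat A" m v i] A v that by (simp add: bf_transpose[OF A])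
  have 3: "A *\<^sub>v v = 0\<^sub>v m \<longleftrightarrow> (\<forall>i<m. bf A (ue i) ?x = 0)"
    using A 1 by (metis eq_vecI index_zero_vec carrier_matD(1) dim_mult_mat_vec)
  have 4: "transpose_mat A *\<^sub>v v = 0\<^sub>v m \<longleftrightarrow> (\<forall>i<m. bf A ?x (ue i) = 0)"
    using A 2 by (metis eq_vecI index_zero_vec carrier_matD(2) dim_mult_mat_vec index_transpose_mat(2))
  have "null A ?x \<longleftrightarrow> (\<forall>i<m. bf A (ue i) ?x = 0) \<and> (\<forall>i<m. bf A ?x (ue i) = 0)"
  proof
    assume h: "(\<forall>i<m. bf A (ue i) ?x = 0) \<and> (\<forall>i<m. bf A ?x (ue i) = 0)"
    show "null A ?x"
      unfolding null_def
    proof (intro allI conjI)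
      fix w
      have "bf A w ?x = (\<Sum>l<dim_row A. w l * bf A (ue l) ?x)" by (rule bf_expand_left)
      then show "bf A w ?x = 0" using A h by simp
      have "bf A ?x w = (\<Sum>l<dim_row A. w l * bf A ?x (ue l))" by (rule bf_expand_right)
      then show "bf A ?x w = 0" using A h by simp
    qed
  qed (auto simp: null_def)
  then show ?thesis using 3 4 by simp
qed

text \<open>Everything is orthogonal to a vector of the common kernel, so any complement will do; L
  reads a coordinate at which v is nonzero.\<close>

lemma split_zero_block:
  fixes A :: "'a :: field mat"
  assumes A: "A \<in> carrier_mat m m" and v: "v \<in> carrier_vec m" "v \<noteq> 0\<^sub>v m"
    and Av: "A *\<^sub>v v = 0\<^sub>v m" "transpose_mat A *\<^sub>v v = 0\<^sub>v m"
  shows "\<exists>d A2. m = 1 + d \<and> A2 \<in> carrier_mat d d \<and> congruent_mat A (dsum (jordan_block 1 0) A2)"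
proof -
  obtain i where i: "i < m" "v $ i \<noteq> 0" using v by (metis carrier_vecD eq_vecI index_zero_vec)
  have nl: "null A (\<lambda>i. v $ i)" using null_vec_iff[OF A v(1)] Av by simp
  define S where "S = mat m 1 (\<lambda>(j,_). v $ j)"
  define L where "L = mat 1 m (\<lambda>(_,j). if j = i then inverse (v $ i) else 0)"
  have S: "S \<in> carrier_mat m 1" and L: "L \<in> carrier_mat 1 m" unfolding S_def L_def by auto
  have LS: "L * S = 1\<^sub>m 1"
  proof (rule eq_matI)
    fix a b assume "a < dim_row (1\<^sub>m 1 :: 'a mat)" "b < dim_col (1\<^sub>m 1 :: 'a mat)"
    then have ab: "a = 0" "b = 0" by auto
    have "(L * S) $$ (0,0) = (\<Sum>j<m. (if j = i then inverse (v $ i) else 0) * v $ j)"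
      using L S by (simp add: scalar_prod_def lessThan_atLeast0 L_def S_def)
    also have "\<dots> = (\<Sum>j<m. if j = i then inverse (v $ i) * v $ j else 0)" by (intro sum.cong) auto
    also have "\<dots> = 1" using i by simp
    finally show "(L * S) $$ (a,b) = 1\<^sub>m 1 $$ (a,b)" using ab by simp
  qed (use L S in auto)
  have Sf: "S = mat m 1 (\<lambda>(a,j). (\<lambda>_ l. v $ l) j a)" unfolding S_def by simp
  have o: "transpose_mat S * A *\<^sub>v u = 0\<^sub>v 1 \<and> transpose_mat S * transpose_mat A *\<^sub>v u = 0\<^sub>v 1"
    if u: "u \<in> carrier_vec m" for u
  proof -
    have "(transpose_mat S * A *\<^sub>v u) $ a = 0" "(transpose_mat S * transpose_mat A *\<^sub>v u) $ a = 0" if "a < 1" for a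
      unfolding Sf using gram_vec_index[of A m u a 1 "\<lambda>_ l. v $ l"] gram_vec_index[of "transpose_mat A" m u a 1 "\<lambda>_ l. v $ l"]
        A u that nl unfolding null_def by (simp_all add: bf_transpose[OF A])
    then show ?thesis using S by (auto intro!: eq_vecI simp del: index_mult_mat_vec)
  qed
  have "transpose_mat S * A * S = jordan_block 1 0"
  proof (rule eq_matI)
    fix a b assume "a < dim_row (jordan_block 1 (0::'a))" "b < dim_col (jordan_block 1 (0::'a))"
    then have ab: "a = 0" "b = 0" by auto
    have "(transpose_mat S * A * S) $$ (0,0) = bf A (\<lambda>l. S $$ (l,0)) (\<lambda>l. S $$ (l,0))"
      using gram_index[OF A S S, of 0 0] by simp
    also have "\<dots> = bf A (\<lambda>l. v $ l) (\<lambda>l. v $ l)" using A by (intro bf_cong) (auto simp: S_def)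
    also have "\<dots> = 0" using nl unfolding null_def by simp
    finally show "(transpose_mat S * A * S) $$ (a,b) = jordan_block 1 0 $$ (a,b)" using ab by simp
  qed (use S in auto)
  then show ?thesis using congruent_mat_split[OF A S L LS o] by simp
qed

text \<open>A kernel vector outside the radical starts a chain for l = 0. If some singular chain
  leaves the radical, it gives an odd block; otherwise the chains for l = 0 are bounded and give an
  even one.\<close>

lemma split_singular:
  fixes A :: "'a :: field mat"
  assumes A: "A \<in> carrier_mat m m" and sing: "\<not> invertible_mat A"
  shows "\<exists>n d A2. 1 \<le> n \<and> m = n + d \<and> A2 \<in> carrier_mat d d \<and> congruent_mat A (dsum (jordan_block n 0) A2)"
proof -
  obtain v where v: "v \<in> carrier_vec m" "v \<noteq> 0\<^sub>v m" "A *\<^sub>v v = 0\<^sub>v m"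
    using sing invertible_mat_if_inj[OF A] by blast
  show ?thesis
  proof (cases "transpose_mat A *\<^sub>v v = 0\<^sub>v m")
    case True
    then show ?thesis using split_zero_block[OF A v(1,2,3)] by blast
  next
    case False
    let ?x = "\<lambda>i. v $ i"
    have nn: "\<not> null A ?x" using null_vec_iff[OF A v(1)] False by simp
    have z: "bf A w ?x = 0" for w
    proof -
      have "bf A (ue i) ?x = 0" if "i < m" for i using mult_mat_vec_index_bf[OF A v(1) that] v(3) that by simp
      then show ?thesis unfolding bf_expand_left[of A w ?x] using A by simp
    qed
    have "\<exists>n e. n \<ge> 2 \<and> jordan_family A n e"
      using jordan_family_odd[of A] jordan_family_even[OF nn z] by blast
    then obtain n e where "n \<ge> 2" "jordan_family A n e" by blast
    then show ?thesis using jordan_family_split[OF A] by (metis one_le_numeral order_trans)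
  qed
qed

lemma sum_lessThan_add:
  fixes f :: "nat \<Rightarrow> 'b :: comm_monoid_add"
  shows "(\<Sum>i<a + b. f i) = (\<Sum>i<a. f i) + (\<Sum>i<b. f (i + a))"
  by (induct b) (simp_all add: add_ac)

lemma bf_dsum:
  assumes A: "A \<in> carrier_mat a a" and B: "B \<in> carrier_mat b b"
  shows "bf (dsum A B) x y = bf A x y + bf B (\<lambda>i. x (i + a)) (\<lambda>i. y (i + a))"
proof -
  have "bf (dsum A B) x y = (\<Sum>i<a. \<Sum>j<a. x i * dsum A B $$ (i,j) * y j) + (\<Sum>i<a. \<Sum>j<b. x i * dsum A B $$ (i,j + a) * y (j + a))
    + ((\<Sum>i<b. \<Sum>j<a. x (i + a) * dsum A B $$ (i + a,j) * y j) + (\<Sum>i<b. \<Sum>j<b. x (i + a) * dsum A B $$ (i + a,j + a) * y (j + a)))"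
    unfolding bf_def using A B by (simp add: sum_lessThan_add sum.distrib)
  also have "(\<Sum>i<a. \<Sum>j<a. x i * dsum A B $$ (i,j) * y j) = bf A x y"
    unfolding bf_def dsum_def using A B by (auto intro!: sum.cong)
  also have "(\<Sum>i<a. \<Sum>j<b. x i * dsum A B $$ (i,j + a) * y (j + a)) = 0"
    unfolding dsum_def using A B by (auto intro!: sum.neutral)
  also have "(\<Sum>i<b. \<Sum>j<a. x (i + a) * dsum A B $$ (i + a,j) * y j) = 0"
    unfolding dsum_def using A B by (auto intro!: sum.neutral)
  also have "(\<Sum>i<b. \<Sum>j<b. x (i + a) * dsum A B $$ (i + a,j + a) * y (j + a)) = bf B (\<lambda>i. x (i + a)) (\<lambda>i. y (i + a))"
    unfolding bf_def dsum_def using A B by (auto intro!: sum.cong)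
  finally show ?thesis by simp
qed

lemma bf_antidiag:
  assumes C: "C \<in> carrier_mat a a" and D: "D \<in> carrier_mat a a"
  shows "bf (four_block_mat (0\<^sub>m a a) C D (0\<^sub>m a a)) x y = bf C x (\<lambda>i. y (i + a)) + bf D (\<lambda>i. x (i + a)) y"
proof -
  let ?M = "four_block_mat (0\<^sub>m a a) C D (0\<^sub>m a a)"
  have "bf ?M x y = (\<Sum>i<a. \<Sum>j<a. x i * ?M $$ (i,j) * y j) + (\<Sum>i<a. \<Sum>j<a. x i * ?M $$ (i,j + a) * y (j + a))
    + ((\<Sum>i<a. \<Sum>j<a. x (i + a) * ?M $$ (i + a,j) * y j) + (\<Sum>i<a. \<Sum>j<a. x (i + a) * ?M $$ (i + a,j + a) * y (j + a)))"
    unfolding bf_def using C D by (simp add: sum_lessThan_add sum.distrib)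
  also have "(\<Sum>i<a. \<Sum>j<a. x i * ?M $$ (i,j) * y j) = 0"
    using C D by (auto intro!: sum.neutral)
  also have "(\<Sum>i<a. \<Sum>j<a. x i * ?M $$ (i,j + a) * y (j + a)) = bf C x (\<lambda>i. y (i + a))"
    unfolding bf_def using C D by (auto intro!: sum.cong)
  also have "(\<Sum>i<a. \<Sum>j<a. x (i + a) * ?M $$ (i + a,j) * y j) = bf D (\<lambda>i. x (i + a)) y"
    unfolding bf_def using C D by (auto intro!: sum.cong)
  also have "(\<Sum>i<a. \<Sum>j<a. x (i + a) * ?M $$ (i + a,j + a) * y (j + a)) = 0"
    using C D by (auto intro!: sum.neutral)
  finally show ?thesis by simp
qed

context alg_closed_char_2
begin

text \<open>An eigenvector of the cosquare for l is a chain of length 1, and l \<noteq> 0 because A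
  is nonsingular. The chain is then taken of greatest length, together with its dual.\<close>

lemma split_nonsingular:
  fixes A :: "'a mat"
  assumes A: "A \<in> carrier_mat m m" and inv: "invertible_mat A" and m: "0 < m" and R: "valid_root_choice R"
  shows "\<exists>b d A2. block_ok b \<and> m = block_size b + d \<and> A2 \<in> carrier_mat d d \<and> congruent_mat A (dsum (block_mat R b) A2)"
proof -
  let ?P = "cosquare A"
  have P: "?P \<in> carrier_mat m m" by (rule cosquare_carrier[OF A inv])
  have "degree (char_poly ?P) > 0" using degree_monic_char_poly[OF P] m by simp
  from alg_closed_imp_poly_has_root[OF this] obtain l where "poly (char_poly ?P) l = 0" by blast
  then have "eigenvalue ?P l" using eigenvalue_root_char_poly[OF P] by simp
  then obtain v where v: "v \<in> carrier_vec m" "v \<noteq> 0\<^sub>v m" "?P *\<^sub>v v = l \<cdot>\<^sub>v v"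
    unfolding eigenvalue_def eigenvector_def using P by auto
  have AT: "transpose_mat A \<in> carrier_mat m m" using A by simp
  have Av: "A *\<^sub>v v = l \<cdot>\<^sub>v (transpose_mat A *\<^sub>v v)"
  proof -
    have "A *\<^sub>v v = (transpose_mat A * ?P) *\<^sub>v v" using transpose_mult_cosquare[OF A inv] by simp
    also have "\<dots> = transpose_mat A *\<^sub>v (l \<cdot>\<^sub>v v)" using assoc_mult_mat_vec[OF AT P v(1)] v(3) by simp
    also have "\<dots> = l \<cdot>\<^sub>v (transpose_mat A *\<^sub>v v)" using mult_mat_vec[OF AT v(1)] by simp
    finally show ?thesis .
  qed
  have Av0: "A *\<^sub>v v \<noteq> 0\<^sub>v m" using invertible_mat_kernel[OF A inv v(1)] v(2) by blast
  have l0: "l \<noteq> 0"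
  proof
    assume "l = 0"
    then have "A *\<^sub>v v = 0\<^sub>v m" unfolding Av using AT v by (intro eq_vecI) auto
    with Av0 show False ..
  qed
  let ?x = "\<lambda>i. v $ i"
  have nn: "\<not> null A ?x" using null_vec_iff[OF A v(1)] Av0 by simp
  have nd: "\<forall>x. (\<forall>w. bf A x w = 0) \<longrightarrow> null A x" using bf_nondegenerate[OF A inv] by blast
  obtain k x y where *: "1 \<le> k \<and> chain A l k x \<and> (\<forall>j. j = 0 \<or> k < j \<longrightarrow> y j = (\<lambda>_. 0)) \<and>
     (\<forall>j w. 1 \<le> j \<longrightarrow> bf A (y j) w = l * bf A w (y j) + bf A w (y (Suc j))) \<and> bf A (x 1) (y 1) \<noteq> 0"
    using maximal_chain_dual[OF nn bf_eigenvector[OF A v(1) Av]] nd by blast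
  have k: "1 \<le> k" and x: "chain A l k x" and y0: "\<And>j. j = 0 \<or> k < j \<Longrightarrow> y j = (\<lambda>_. 0)"
    and ys: "\<And>j w. 1 \<le> j \<Longrightarrow> bf A (y j) w = l * bf A w (y j) + bf A w (y (Suc j))"
    and xy: "bf A (x 1) (y 1) \<noteq> 0" using * by blast+
  have pair: ?thesis if "\<exists>d A2. m = 2 * k + d \<and> A2 \<in> carrier_mat d d \<and>
    congruent_mat A (dsum (four_block_mat (0\<^sub>m k k) (1\<^sub>m k) (jordan_block k l) (0\<^sub>m k k)) A2)"
  proof -
    from that obtain d A2 where "m = 2 * k + d" "A2 \<in> carrier_mat d d"
      "congruent_mat A (dsum (block_mat R (BPair k l)) A2)" by auto
    then show ?thesis using k l0 by (intro exI[of _ "BPair k l"] exI[of _ d] exI[of _ A2]) auto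
  qed
  show ?thesis
  proof (cases "l = 1")
    case False
    \<comment> \<open>In characteristic 2 the only square root of 1 is 1 itself, so all l \<noteq> 1
      fall under automatic isotropy.\<close>
    have l2: "l * l \<noteq> 1"
    proof
      assume "l * l = 1"
      then have "(l - 1) * (l + 1) = 0" by (simp add: algebra_simps)
      then have "l = 1 \<or> l + 1 = 0" by simp
      then show False using False eq_if_add_zero by blast
    qed
    let ?T = "mat k k (\<lambda>(i,j). bf A (x (Suc i)) (y (Suc j)))"
    have toep: "bf A (x i) (y j) = (if j \<le> i then bf A (x (Suc (i - j))) (y 1) else 0)" if "1 \<le> j" "i \<le> k" for i j
      using chain_dual_toeplitz[where l = l and A = A and k = k and x = x and y = y, OF x ys that] by simp
    have T: "?T \<in> carrier_mat k k" by simp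
    define t where "t = bf A (x 1) (y 1)"
    have d: "bf A (x (Suc i)) (y (Suc i)) = t" if "i < k" for i
      unfolding t_def using toep[of "Suc i" "Suc i"] that by simp
    have "det ?T = prod_list (diag_mat ?T)" using toep by (intro det_lower_triangular[OF _ T]) auto
    also have "diag_mat ?T = map (\<lambda>_. t) [0..<k]" unfolding diag_mat_def using d by auto
    finally have "det ?T = t ^ k" by (simp add: map_replicate_const prod_list_replicate)
    then have iT: "invertible_mat ?T" using invertible_mat_iff_det[OF T] xy unfolding t_def by simp
    show ?thesis
    proof (rule pair, rule chain_pair_split[OF A x l0 chain_isotropic[OF x l2] _ iT])
      show "bf A (y i) (y j) = 0" if "1 \<le> i" "i \<le> k" "1 \<le> j" "j \<le> k" for i j
        by (rule dual_chain_isotropic[where k = k and y = y and l = l and A = A, OF _ ys l2 that(1,3)]) (use y0 in auto)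
      fix u j assume h: "\<And>j. 1 \<le> j \<Longrightarrow> j \<le> k \<Longrightarrow> bf A (y j) u = 0" and j: "1 \<le> j" "j \<le> k"
      have hy: "bf A (y j) u = 0" if "1 \<le> j" for j using h[of j] y0[of j] that by (cases "j \<le> k") auto
      \<comment> \<open>Downwards from the zero members beyond k: a dual link passes orthogonality
        from one side to the other as l \<noteq> 0.\<close>
      have "bf A u (y j) = 0" if "1 \<le> j" for j
        using that
      proof (induct "k + 1 - j" arbitrary: j)
        case 0
        then show ?case using y0[of j] by simp
      next
        case (Suc d)
        then have "bf A u (y (Suc j)) = 0" by simp
        then show ?case using ys[OF Suc.prems, of u] hy[OF Suc.prems] l0 by simp
      qed
      then show "bf A u (y j) = 0" using j by simp
    qed
  next
    case True
    have x: "chain A 1 k x" using x True by simp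
    have ys1: "bf A (y j) w = bf A w (y j) + bf A w (y (Suc j))" if "1 \<le> j" for j w using ys[OF that, of w] True by simp
    obtain z where z: "chain A 1 k z" "z k = y 1" using dual_chain_to_chain[where y = y and A = A and k = k, OF y0 k ys1] by blast
    have xz: "bf A (x 1) (z k) \<noteq> 0" using z xy by simp
    have anti: "invertible_mat (mat k k (\<lambda>(i,j). bf A (p (Suc i)) (q (Suc j))))"
      if p: "chain A 1 k p" and q: "chain A 1 k q" and pq: "bf A (p 1) (q k) \<noteq> 0" for p q
    proof (rule anti_triangular_invertible[of _ k])
      note V = pair_rel_vanish_below[OF chain_pair_rel[OF p q]]
      show "mat k k (\<lambda>(i,j). bf A (p (Suc i)) (q (Suc j))) $$ (i,j) = 0" if "i < k" "j < k" "i + j + 1 < k" for i j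
        using V that unfolding vanish_below_def by auto
      show "mat k k (\<lambda>(i,j). bf A (p (Suc i)) (q (Suc j))) $$ (i,j) \<noteq> 0" if "i < k" "j < k" "i + j + 1 = k" for i j
        using antidiagonal_const[OF chain_pair_rel[OF p q] V, of "Suc i" "Suc j" 1 k] that pq by auto
    qed simp
    \<comment> \<open>A chain of length k with nonzero leading Gram entry spans a root block on its
      own. If there is none, x and the chain made from its dual can be replaced by isotropic ones
      and span a pair.\<close>
    show ?thesis
    proof (cases "\<exists>z. chain A 1 k z \<and> bf A (z 1) (z k) \<noteq> 0")
      case True
      then obtain z where z: "chain A 1 k z" "bf A (z 1) (z k) \<noteq> 0" by blast
      have kodd: "odd k" by (rule gram_leading_odd[OF z(1) k z(2)])
      let ?G = "mat k k (\<lambda>(i,j). bf A (z (Suc i)) (z (Suc j)))"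
      have iG: "invertible_mat ?G" by (rule anti[OF z(1) z(1) z(2)])
      have G: "?G \<in> carrier_mat k k" by simp
      have "?G = transpose_mat ?G * jordan_block k 1"
      proof (rule eq_matI)
        fix i j assume "i < dim_row (transpose_mat ?G * jordan_block k 1)" "j < dim_col (transpose_mat ?G * jordan_block k 1)"
        then have ij: "i < k" "j < k" by auto
        have "(transpose_mat ?G * jordan_block k 1) $$ (i,j) =
          transpose_mat ?G $$ (i,j) + (if j = 0 then 0 else transpose_mat ?G $$ (i, j - 1))"
          using mult_jordan_block_index[of "transpose_mat ?G" k k i j 1] ij by simp
        also have "\<dots> = bf A (z (Suc j)) (z (Suc i)) + bf A (z j) (z (Suc i))"
          using ij chain_0[OF z(1)] by auto
        also have "\<dots> = bf A (z (Suc i)) (z (Suc j))" using chain_1D[OF z(1) ij(2)] by simp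
        finally show "?G $$ (i,j) = (transpose_mat ?G * jordan_block k 1) $$ (i,j)"
          using ij by (simp del: index_mult_mat(1))
      qed auto
      then have rf: "root_form k ?G" using iG G unfolding root_form_def by blast
      have Rk: "R k \<in> carrier_mat k k" "invertible_mat (R k)" "similar_mat (cosquare (R k)) (jordan_block k 1)"
        using R kodd unfolding valid_root_choice_def by auto
      have cong: "congruent_mat ?G (R k)"
        using congruent_if_cosquare_similar[OF kodd G iG _ Rk] root_form_cosquare[OF rf]
        by (simp add: similar_mat_refl[of _ k])
      have "\<exists>d A2. m = k + d \<and> A2 \<in> carrier_mat d d \<and> congruent_mat A (dsum ?G A2)"
      proof (rule gram_split[OF A iG])
        fix u j assume h: "\<And>j. j < k \<Longrightarrow> bf A (z (Suc j)) u = 0" and j: "j < k"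
        have "bf A (z j) u = 0" using h[of "j - 1"] j chain_0[OF z(1)] by (cases j) auto
        then show "bf A u (z (Suc j)) = 0" using chain_1D[OF z(1) j, of u] h[OF j] by simp
      qed
      then obtain d A2 where 1: "m = k + d" "A2 \<in> carrier_mat d d" "congruent_mat A (dsum ?G A2)" by blast
      have "congruent_mat (dsum ?G A2) (dsum (R k) A2)"
        by (rule congruent_mat_dsum[OF cong congruent_mat_refl[OF 1(2)]])
      then have "congruent_mat A (dsum (block_mat R (BRoot k)) A2)"
        using 1(3) congruent_mat_trans by auto
      then show ?thesis using 1 kodd by (intro exI[of _ "BRoot k"] exI[of _ d] exI[of _ A2]) auto
    next
      case F: False
      then have b: "bf A (z 1) (z k) = 0" if "chain A 1 k z" for z using that by blast
      obtain p q where *: "chain A 1 k p \<and> chain A 1 k q \<and> bf A (p 1) (q k) \<noteq> 0 \<and>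
        (\<forall>i\<le>k. \<forall>j\<le>k. bf A (p i) (p j) = 0 \<and> bf A (q i) (q j) = 0)"
        using isotropic_chain_pair[OF x z(1) k xz b] by blast
      have p: "chain A 1 k p" and q: "chain A 1 k q" and pq: "bf A (p 1) (q k) \<noteq> 0"
        and pp: "\<And>i j. i \<le> k \<Longrightarrow> j \<le> k \<Longrightarrow> bf A (p i) (p j) = 0"
        and qq: "\<And>i j. i \<le> k \<Longrightarrow> j \<le> k \<Longrightarrow> bf A (q i) (q j) = 0" using * by blast+
      have pl: "chain A l k p" using p True by simp
      show ?thesis
      proof (rule pair, rule chain_pair_split[OF A pl l0 pp _ anti[OF p q pq]])
        show "bf A (q i) (q j) = 0" if "1 \<le> i" "i \<le> k" "1 \<le> j" "j \<le> k" for i j using qq that by simp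
        fix u j assume h: "\<And>j. 1 \<le> j \<Longrightarrow> j \<le> k \<Longrightarrow> bf A (q j) u = 0" and j: "1 \<le> j" "j \<le> k"
        obtain i where i: "j = Suc i" "i < k" using j by (cases j) auto
        have "bf A (q i) u = 0" using h[of i] i chain_0[OF q] by (cases "i = 0") auto
        then show "bf A u (q j) = 0" using chain_1D[OF q i(2), of u] h[of j] j i by simp
      qed
    qed
  qed
qed

lemma exists_block_sum:
  fixes A :: "'a mat"
  assumes R: "valid_root_choice R" and A: "A \<in> carrier_mat m m"
  shows "\<exists>bs. (\<forall>b\<in>set bs. block_ok b) \<and> congruent_mat A (direct_sum R bs)"
  using A
proof (induct m arbitrary: A rule: less_induct)
  case (less m)
  note A = less.prems
  show ?case
  proof (cases "m = 0")
    case True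
    then have "A = direct_sum R []" using A by (intro eq_matI) auto
    then show ?thesis using congruent_mat_refl[OF A] by (intro exI[of _ "[]"]) simp
  next
    case False
    have "\<exists>b d A2. block_ok b \<and> m = block_size b + d \<and> A2 \<in> carrier_mat d d \<and> congruent_mat A (dsum (block_mat R b) A2)"
    proof (cases "invertible_mat A")
      case True
      then show ?thesis using split_nonsingular[OF A True _ R] False by simp
    next
      case False
      from split_singular[OF A this] obtain n d A2 where "1 \<le> n" "m = n + d" "A2 \<in> carrier_mat d d"
        "congruent_mat A (dsum (jordan_block n 0) A2)" by blast
      then show ?thesis by (intro exI[of _ "BJ0 n"] exI[of _ d] exI[of _ A2]) auto
    qed
    then obtain b d A2 where b: "block_ok b" "m = block_size b + d" "A2 \<in> carrier_mat d d"
      "congruent_mat A (dsum (block_mat R b) A2)" by blast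
    have "d < m" using b block_size_pos[OF b(1)] by simp
    from less.hyps[OF this b(3)] obtain bs where bs: "\<forall>b\<in>set bs. block_ok b" "congruent_mat A2 (direct_sum R bs)"
      by blast
    have "congruent_mat (dsum (block_mat R b) A2) (direct_sum R (b # bs))"
      unfolding direct_sum_Cons
      by (rule congruent_mat_dsum[OF congruent_mat_refl[OF block_mat_carrier[OF R b(1)]] bs(2)])
    then show ?thesis using b bs congruent_mat_trans by (intro exI[of _ "b # bs"]) auto
  qed
qed

end

section \<open>From a sum of blocks to an admissible one\<close>

context alg_closed_char_2
begin

text \<open>\<open>[0 I; J 0]\<close> is congruent to \<open>C \<otimes> H\<close> with \<open>H\<close> the hyperbolic plane, so the claim reduces to
  the congruence of the scalar forms \<open>1 \<oplus> H\<close> and \<open>I\<^sub>3\<close> in characteristic 2.\<close>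

lemma congruent_root_pair:
  fixes C :: "'a mat"
  assumes C: "root_form n C"
  shows "congruent_mat (dsum C (four_block_mat (0\<^sub>m n n) (1\<^sub>m n) (jordan_block n 1) (0\<^sub>m n n))) (dsum C (dsum C C))"
proof -
  have Cc: "C \<in> carrier_mat n n" and inv: "invertible_mat C" and eq: "transpose_mat C * jordan_block n 1 = C"
    using C unfolding root_form_def by auto
  let ?H = "four_block_mat (0\<^sub>m n n) C C (0\<^sub>m n n)"
  let ?B = "four_block_mat (0\<^sub>m n n) (1\<^sub>m n) (jordan_block n (1 :: 'a)) (0\<^sub>m n n)"
  have HB: "congruent_mat ?H ?B" using congruent_pair_block[OF Cc inv, of 1] unfolding eq .
  have 1: "congruent_mat (dsum C ?B) (dsum C ?H)"
    by (rule congruent_mat_dsum[OF congruent_mat_refl[OF Cc] congruent_mat_sym[OF HB]])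
  \<comment> \<open>The tensor of the unit vector r with the scalar vector (p, q, t), on which the
    form is p p' + q t' + t q' times an entry of C.\<close>
  define comb where "comb = (\<lambda>(p :: 'a) q t r i. if i < n then p * ue r i else if i < 2 * n then q * ue r (i - n) else t * ue r (i - 2 * n))"
  \<comment> \<open>The scalar vectors (1,1,0), (1,0,1), (1,1,1) are orthonormal for p p' + q t' + t
    q' in characteristic 2.\<close>
  define s where "s = (\<lambda>j. if j < n then comb 1 1 0 j else if j < 2 * n then comb 1 0 1 (j - n) else comb 1 1 1 (j - 2 * n))"
  have H: "?H \<in> carrier_mat (n + n) (n + n)" by (intro four_block_carrier_mat) auto
  have g: "bf (dsum C ?H) (comb p q t r) (comb p' q' t' r') = (p * p' + q * t' + t * q') * C $$ (r,r')"
    if r: "r < n" "r' < n" for p q t r p' q' t' r'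
  proof -
    have sm: "bf C f w = p * bf C (ue r) w" "bf C w f = p * bf C w (ue r)"
      if "\<And>i. i < n \<Longrightarrow> f i = p * ue r i" for f p r w
    proof -
      have "bf C f w = bf C (\<lambda>i. p * ue r i) w" "bf C w f = bf C w (\<lambda>i. p * ue r i)"
        using that Cc by (auto intro!: bf_cong)
      then show "bf C f w = p * bf C (ue r) w" "bf C w f = p * bf C w (ue r)"
        by (simp_all add: bf_smult_left bf_smult_right)
    qed
    have a: "bf C (comb p q t r) w = p * bf C (ue r) w" "bf C w (comb p q t r) = p * bf C w (ue r)" for p q t r w
      by (rule sm; simp add: comb_def)+
    have b: "bf C (\<lambda>i. comb p q t r (i + n)) w = q * bf C (ue r) w"
      "bf C w (\<lambda>i. comb p q t r (i + n)) = q * bf C w (ue r)" for p q t r w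
      by (rule sm; simp add: comb_def)+
    have c: "bf C (\<lambda>i. comb p q t r (i + n + n)) w = t * bf C (ue r) w"
      "bf C w (\<lambda>i. comb p q t r (i + n + n)) = t * bf C w (ue r)" for p q t r w
      by (rule sm; simp add: comb_def)+
    have u: "bf C (ue r) (ue r') = C $$ (r,r')" using r Cc by (intro bf_ue_ue) auto
    show ?thesis
      unfolding bf_dsum[OF Cc H] bf_antidiag[OF Cc Cc] a b c u by (simp add: algebra_simps)
  qed
  have CC: "dsum C C \<in> carrier_mat (n + n) (n + n)" using Cc by simp
  have 2: "congruent_mat (dsum C ?H) (dsum C (dsum C C))"
  proof (rule congruent_matI_gram)
    show "dsum C ?H \<in> carrier_mat (n + (n + n)) (n + (n + n))" by (rule dsum_carrier[OF Cc H])
    show "dsum C (dsum C C) \<in> carrier_mat (n + (n + n)) (n + (n + n))" by (rule dsum_carrier[OF Cc CC])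
    show "invertible_mat (dsum C (dsum C C))"
      using inv invertible_mat_dsum[OF Cc CC] invertible_mat_dsum[OF Cc Cc] by simp
    fix i j assume ij: "i < n + (n + n)" "j < n + (n + n)"
    have s1: "i < n \<Longrightarrow> s i = comb 1 1 0 i" "n \<le> i \<Longrightarrow> i < 2 * n \<Longrightarrow> s i = comb 1 0 1 (i - n)"
      "2 * n \<le> i \<Longrightarrow> s i = comb 1 1 1 (i - 2 * n)" for i unfolding s_def by auto
    have D: "dsum C (dsum C C) $$ (i,j) = (if i < n then if j < n then C $$ (i,j) else 0
      else if j < n then 0 else if i < 2 * n then if j < 2 * n then C $$ (i - n, j - n) else 0
      else if j < 2 * n then 0 else C $$ (i - 2 * n, j - 2 * n))"
      using ij Cc unfolding dsum_def by (auto simp: mult_2)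
    consider "i < n" | "n \<le> i" "i < 2 * n" | "2 * n \<le> i" by linarith
    then show "bf (dsum C ?H) (s i) (s j) = dsum C (dsum C C) $$ (i,j)"
    proof cases
      case i: 1
      consider "j < n" | "n \<le> j" "j < 2 * n" | "2 * n \<le> j" by linarith
      then show ?thesis
        by cases (use ij i in \<open>simp_all add: s1 g D two_eq_zero\<close>)
    next
      case i: 2
      consider "j < n" | "n \<le> j" "j < 2 * n" | "2 * n \<le> j" by linarith
      then show ?thesis
        by cases (use ij i in \<open>simp_all add: s1 g D two_eq_zero\<close>)
    next
      case i: 3
      consider "j < n" | "n \<le> j" "j < 2 * n" | "2 * n \<le> j" by linarith
      then show ?thesis
        by cases (use ij i in \<open>simp_all add: s1 g D two_eq_zero\<close>)
    qed
  qed
  show ?thesis by (rule congruent_mat_trans[OF 1 2])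
qed

lemma congruent_three_roots:
  fixes R :: "nat \<Rightarrow> 'a mat"
  assumes R: "valid_root_choice R" and n: "odd n"
  shows "congruent_mat (direct_sum R [BRoot n, BPair n 1]) (direct_sum R [BRoot n, BRoot n, BRoot n])"
proof -
  have Rn: "R n \<in> carrier_mat n n" "invertible_mat (R n)" "similar_mat (cosquare (R n)) (jordan_block n 1)"
    using R n unfolding valid_root_choice_def by auto
  obtain C where C: "congruent_mat (R n) C" "root_form n C" using congruent_root_form[OF Rn] by blast
  let ?B = "four_block_mat (0\<^sub>m n n) (1\<^sub>m n) (jordan_block n (1 :: 'a)) (0\<^sub>m n n)"
  have B: "?B \<in> carrier_mat (n + n) (n + n)" by (intro four_block_carrier_mat) auto
  have 1: "congruent_mat (dsum (R n) ?B) (dsum C ?B)"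
    by (rule congruent_mat_dsum[OF C(1) congruent_mat_refl[OF B]])
  have 2: "congruent_mat (dsum (R n) (dsum (R n) (R n))) (dsum C (dsum C C))"
    by (intro congruent_mat_dsum C(1))
  have d: "direct_sum R [a, b] = dsum (block_mat R a) (block_mat R b)"
    "direct_sum R [a, b, c] = dsum (block_mat R a) (dsum (block_mat R b) (block_mat R c))" for a b c
    using direct_sum_Cons[of R a "[b]"] direct_sum_Cons[of R a "[b,c]"] direct_sum_Cons[of R b "[c]"] by simp_all
  show ?thesis
    unfolding d block_mat.simps
    using congruent_mat_trans[OF congruent_mat_trans[OF 1 congruent_root_pair[OF C(2)]] congruent_mat_sym[OF 2]] .
qed

text \<open>Replacing a forbidden pair by two more roots lowers the number of pairs at 1 and never
  creates a new one, so the process stops.\<close>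

lemma exists_admissible:
  fixes R :: "nat \<Rightarrow> 'a mat"
  assumes R: "valid_root_choice R" and ok: "\<forall>b\<in>set bs. block_ok b"
  shows "\<exists>cs. admissible cs \<and> congruent_mat (direct_sum R bs) (direct_sum R cs)"
  using ok
proof (induct "length (filter (\<lambda>b. \<exists>n. b = BPair n 1) bs)" arbitrary: bs rule: less_induct)
  case less
  show ?case
  proof (cases "admissible bs")
    case True
    then show ?thesis using congruent_mat_refl[OF direct_sum_carrier[OF R less.prems]] by blast
  next
    case False
    then obtain n where n: "odd n" "BRoot n \<in> set bs" "BPair n 1 \<in> set bs"
      using less.prems unfolding admissible_def by blast
    have "BRoot n \<in># mset bs" using n by simp
    then obtain M where M: "mset bs = add_mset (BRoot n) M" by (blast dest: multi_member_split)
    have "BPair n 1 \<in># mset bs" using n by simp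
    then have "BPair n 1 \<in># M" unfolding M by simp
    then obtain M' where M': "M = add_mset (BPair n 1) M'" by (blast dest: multi_member_split)
    obtain bs' where bs': "mset bs' = M'" using ex_mset by blast
    have m': "mset bs = mset ([BRoot n, BPair n 1] @ bs')" using M M' bs' by simp
    have ok': "\<forall>b\<in>set ([BRoot n, BPair n 1] @ bs'). block_ok b"
      using less.prems m' by (metis set_mset_mset)
    let ?cs = "[BRoot n, BRoot n, BRoot n] @ bs'"
    have "length (filter (\<lambda>b. \<exists>n. b = BPair n 1) bs) = length (filter (\<lambda>b. \<exists>n. b = BPair n 1) ([BRoot n, BPair n 1] @ bs'))"
      using m' by (metis mset_filter size_mset)
    then have lt: "length (filter (\<lambda>b. \<exists>n. b = BPair n 1) ?cs) < length (filter (\<lambda>b. \<exists>n. b = BPair n 1) bs)"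
      by simp
    have okc: "\<forall>b\<in>set ?cs. block_ok b" using ok' n by auto
    have "congruent_mat (direct_sum R bs) (direct_sum R ([BRoot n, BPair n 1] @ bs'))"
      by (rule congruent_direct_sum_perm[OF R less.prems m'])
    moreover have "congruent_mat (direct_sum R ([BRoot n, BPair n 1] @ bs')) (direct_sum R ?cs)"
      unfolding direct_sum_append
      using ok' by (intro congruent_mat_dsum congruent_three_roots[OF R n(1)] congruent_mat_refl[OF direct_sum_carrier[OF R]]) auto
    ultimately show ?thesis using less.hyps[OF lt okc] congruent_mat_trans by blast
  qed
qed

lemma exists_canonical_form:
  fixes A :: "'a mat"
  assumes "valid_root_choice R" "A \<in> carrier_mat m m"
  shows "\<exists>bs. admissible bs \<and> congruent_mat A (direct_sum R bs)"
  using exists_block_sum[OF assms] exists_admissible[OF assms(1)] congruent_mat_trans by blast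

end

section \<open>Invariants of the chain spaces\<close>

lemma chain_iff_ue:
  fixes A :: "'a :: field mat"
  shows "chain A l k x \<longleftrightarrow> x 0 = (\<lambda>_. 0) \<and> (\<forall>j<k. \<forall>i<dim_row A.
    bf A (ue i) (x (Suc j)) = l * bf A (x (Suc j)) (ue i) + bf A (x j) (ue i))"
proof
  assume h: "x 0 = (\<lambda>_. 0) \<and> (\<forall>j<k. \<forall>i<dim_row A.
    bf A (ue i) (x (Suc j)) = l * bf A (x (Suc j)) (ue i) + bf A (x j) (ue i))"
  show "chain A l k x"
    unfolding chain_def
  proof (intro conjI allI impI)
    show "x 0 = (\<lambda>_. 0)" using h by blast
    fix j w assume j: "j < k"
    have "(\<Sum>i<dim_row A. w i * bf A (ue i) (x (Suc j))) =
        (\<Sum>i<dim_row A. w i * (l * bf A (x (Suc j)) (ue i) + bf A (x j) (ue i)))"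
      using h j by (intro sum.cong) auto
    then show "bf A w (x (Suc j)) = l * bf A (x (Suc j)) w + bf A (x j) w"
      unfolding bf_expand_left[of A w] bf_expand_right[of A _ w]
      by (simp add: algebra_simps sum.distrib sum_distrib_left)
  qed
qed (auto simp: chain_def)

lemma chain_add:
  fixes A :: "'a :: field mat"
  assumes "chain A l k x" "chain A l k y"
  shows "chain A l k (\<lambda>j i. x j i + c * y j i)"
  unfolding chain_def bf_add_left bf_add_right
proof (intro conjI allI impI)
  show "(\<lambda>i. x 0 i + c * y 0 i) = (\<lambda>_. 0)" by (simp add: chain_0[OF assms(1)] chain_0[OF assms(2)])
  show "bf A w (x (Suc j)) + c * bf A w (y (Suc j)) =
    l * (bf A (x (Suc j)) w + c * bf A (y (Suc j)) w) + (bf A (x j) w + c * bf A (y j) w)" if "j < k" for j w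
    using chainD[OF assms(1) that, of w] chainD[OF assms(2) that, of w] by (simp add: algebra_simps)
qed

lemma chain_zero: "chain A l k (\<lambda>_ _. 0)"
  unfolding chain_def by simp

lemma chain_dsum:
  fixes A :: "'a :: field mat"
  assumes A: "A \<in> carrier_mat a a" and B: "B \<in> carrier_mat b b" and x: "chain (dsum A B) l k x"
  shows "chain A l k x" "chain B l k (\<lambda>j i. x j (i + a))"
proof -
  have x0: "x 0 = (\<lambda>_. 0)" using chain_0[OF x] .
  show "chain A l k x"
    unfolding chain_def
  proof (intro conjI allI impI)
    fix j w assume j: "j < k"
    define u :: "nat \<Rightarrow> 'a" where "u = (\<lambda>i. if i < a then w i else 0)"
    have u: "bf A u z = bf A w z" "bf A z u = bf A z w" for z using A by (auto intro!: bf_cong simp: u_def)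
    have "(\<lambda>i. u (i + a)) = (\<lambda>_. 0)" unfolding u_def by auto
    then show "bf A w (x (Suc j)) = l * bf A (x (Suc j)) w + bf A (x j) w"
      using chainD[OF x j, of u] unfolding bf_dsum[OF A B] by (simp add: u)
  qed (rule x0)
  show "chain B l k (\<lambda>j i. x j (i + a))"
    unfolding chain_def
  proof (intro conjI allI impI)
    fix j w assume j: "j < k"
    define u :: "nat \<Rightarrow> 'a" where "u = (\<lambda>i. if i < a then 0 else w (i - a))"
    have u: "bf A u z = 0" "bf A z u = 0" for z
      using A bf_cong[of A u "\<lambda>_. 0" z z] bf_cong[of A z z u "\<lambda>_. 0"] by (auto simp: u_def)
    have "(\<lambda>i. u (i + a)) = w" unfolding u_def by auto
    then show "bf B w (\<lambda>i. x (Suc j) (i + a)) = l * bf B (\<lambda>i. x (Suc j) (i + a)) w + bf B (\<lambda>i. x j (i + a)) w"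
      using chainD[OF x j, of u] unfolding bf_dsum[OF A B] by (simp add: u)
  qed (simp add: x0)
qed

lemma chain_dsumI:
  fixes A :: "'a :: field mat"
  assumes A: "A \<in> carrier_mat a a" and B: "B \<in> carrier_mat b b" and x: "chain A l k x" and y: "chain B l k y"
  shows "chain (dsum A B) l k (\<lambda>j i. if i < a then x j i else y j (i - a))"
    (is "chain _ l k ?z")
  unfolding chain_def
proof (intro conjI allI impI)
  show "?z 0 = (\<lambda>_. 0)" by (intro ext) (simp add: chain_0[OF x] chain_0[OF y])
  have z: "bf A (?z j) w = bf A (x j) w" "bf A w (?z j) = bf A w (x j)" for j w
    using A by (auto intro!: bf_cong)
  have z': "(\<lambda>i. ?z j (i + a)) = y j" for j by auto
  fix j w assume j: "j < k"
  show "bf (dsum A B) w (?z (Suc j)) = l * bf (dsum A B) (?z (Suc j)) w + bf (dsum A B) (?z j) w"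
    unfolding bf_dsum[OF A B] z z' using chainD[OF x j, of w] chainD[OF y j, of "\<lambda>i. w (i + a)"]
    by (simp add: algebra_simps)
qed

section \<open>Dimensions of chain spaces as invariants of congruence\<close>

definition apply_mat :: "'a :: comm_ring_1 mat \<Rightarrow> (nat \<Rightarrow> 'a) \<Rightarrow> nat \<Rightarrow> 'a" where
  "apply_mat S x = (\<lambda>i. if i < dim_row S then \<Sum>c<dim_col S. S $$ (i,c) * x c else 0)"

lemma apply_mat_zero [simp]: "apply_mat S (\<lambda>_. 0) = (\<lambda>_. 0)"
  unfolding apply_mat_def by auto

lemma vec_apply_mat: "S \<in> carrier_mat m m \<Longrightarrow> vec m (apply_mat S x) = S *\<^sub>v vec m x"
  by (intro eq_vecI) (auto simp: apply_mat_def scalar_prod_def lessThan_atLeast0)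

lemma bf_apply_mat:
  fixes A :: "'a :: comm_ring_1 mat"
  assumes A: "A \<in> carrier_mat m m" and S: "S \<in> carrier_mat m m"
  shows "bf (transpose_mat S * A * S) x y = bf A (apply_mat S x) (apply_mat S y)"
proof -
  have "bf A (apply_mat S x) (apply_mat S y) = bf A (\<lambda>i. \<Sum>c<m. x c * S $$ (i,c)) (\<lambda>i. \<Sum>c<m. y c * S $$ (i,c))"
    using A S by (intro bf_cong) (auto simp: apply_mat_def mult.commute)
  also have "\<dots> = (\<Sum>c<m. \<Sum>d<m. x c * bf A (\<lambda>i. S $$ (i,c)) (\<lambda>i. S $$ (i,d)) * y d)"
    by (simp add: bf_sum_left bf_sum_right sum_distrib_left mult_ac)
  also have "\<dots> = (\<Sum>c<m. \<Sum>d<m. x c * (transpose_mat S * A * S) $$ (c,d) * y d)"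
    by (intro sum.cong refl) (simp add: gram_index[OF A S S])
  also have "\<dots> = bf (transpose_mat S * A * S) x y" unfolding bf_def using S by simp
  finally show ?thesis by simp
qed

lemma apply_mat_inverse:
  assumes "S \<in> carrier_mat m m" "T \<in> carrier_mat m m" "S * T = 1\<^sub>m m" "i < m"
  shows "apply_mat S (apply_mat T x) i = x i"
proof -
  have "vec m (apply_mat S (apply_mat T x)) = S *\<^sub>v (T *\<^sub>v vec m x)"
    using assms by (simp add: vec_apply_mat)
  also have "\<dots> = vec m x" using assoc_mult_mat_vec[OF assms(1,2), of "vec m x"] assms(3) by simp
  finally show ?thesis using assms(4) by (metis index_vec)
qed

lemma chain_apply_mat:
  fixes A :: "'a :: field mat"
  assumes A: "A \<in> carrier_mat m m" and S: "S \<in> carrier_mat m m" "invertible_mat S"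
    and x: "chain (transpose_mat S * A * S) l k x"
  shows "chain A l k (\<lambda>j. apply_mat S (x j))"
  unfolding chain_def
proof (intro conjI allI impI)
  show "apply_mat S (x 0) = (\<lambda>_. 0)" by (simp add: chain_0[OF x])
  obtain T where T: "T \<in> carrier_mat m m" "S * T = 1\<^sub>m m" using S invertible_mat_iff[OF S(1)] by auto
  fix j w assume j: "j < k"
  let ?w = "apply_mat S (apply_mat T w)"
  have w: "bf A ?w z = bf A w z" "bf A z ?w = bf A z w" for z
    using A by (auto intro!: bf_cong simp: apply_mat_inverse[OF S(1) T])
  show "bf A w (apply_mat S (x (Suc j))) = l * bf A (apply_mat S (x (Suc j))) w + bf A (apply_mat S (x j)) w"
    using chainD[OF x j, of "apply_mat T w"] unfolding bf_apply_mat[OF A S(1)] w .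
qed

text \<open>The end points of chains of length k. The flag f keeps those with vanishing left
  products; for l = 0 this separates the block sizes 2 h + 1 and 2 h + 2, whose unflagged spaces
  have the same dimension.\<close>

definition csp :: "'a :: field mat \<Rightarrow> 'a \<Rightarrow> nat \<Rightarrow> bool \<Rightarrow> 'a vec set" where
  "csp A l k f = {vec (dim_row A) (x k) | x. chain A l k x \<and> (f \<longrightarrow> (\<forall>w. bf A (x k) w = 0))}"

lemma csp_memI:
  "chain A l k x \<Longrightarrow> (\<And>w. f \<Longrightarrow> bf A (x k) w = 0) \<Longrightarrow> v = vec (dim_row A) (x k) \<Longrightarrow> v \<in> csp A l k f"
  unfolding csp_def by blast

lemma vsubspace_csp:
  fixes A :: "'a :: field mat"
  shows "vsubspace (dim_row A) (csp A l k f)"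
  unfolding vsubspace_def
proof (intro conjI ballI allI)
  show "csp A l k f \<subseteq> carrier_vec (dim_row A)" unfolding csp_def by auto
  show "0\<^sub>v (dim_row A) \<in> csp A l k f"
    unfolding csp_def using chain_zero by (auto intro!: exI[of _ "\<lambda>_ _. 0"])
  fix u v c assume "u \<in> csp A l k f" "v \<in> csp A l k f"
  then obtain x y where x: "u = vec (dim_row A) (x k)" "chain A l k x" "f \<longrightarrow> (\<forall>w. bf A (x k) w = 0)"
    and y: "v = vec (dim_row A) (y k)" "chain A l k y" "f \<longrightarrow> (\<forall>w. bf A (y k) w = 0)" unfolding csp_def by auto
  let ?z = "\<lambda>j i. x j i + c * y j i"
  show "u + c \<cdot>\<^sub>v v \<in> csp A l k f"
  proof (rule csp_memI[OF chain_add[OF x(2) y(2), of c]])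
    show "bf A (?z k) w = 0" if f for w using x y that by (simp add: bf_add_left)
    show "u + c \<cdot>\<^sub>v v = vec (dim_row A) (?z k)" using x y by (intro eq_vecI) auto
  qed
qed

definition cdim :: "'a :: field mat \<Rightarrow> 'a \<Rightarrow> nat \<Rightarrow> bool \<Rightarrow> nat" where
  "cdim A l k f = (THE d. hasdim (dim_row A) (csp A l k f) d)"

lemma hasdim_cdim: "hasdim (dim_row A) (csp A l k f) (cdim A l k f)"
  unfolding cdim_def using vsubspace_hasdim[OF vsubspace_csp] hasdim_unique by (metis theI)

lemma cdim_eqI: "hasdim (dim_row A) (csp A l k f) d \<Longrightarrow> cdim A l k f = d"
  using hasdim_cdim hasdim_unique by blast

lemma csp_apply_mat:
  fixes A :: "'a :: field mat"
  assumes A: "A \<in> carrier_mat m m" and S: "S \<in> carrier_mat m m" "invertible_mat S"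
    and v: "v \<in> csp (transpose_mat S * A * S) l k f"
  shows "S *\<^sub>v v \<in> csp A l k f"
proof -
  obtain x where x: "v = vec m (x k)" "chain (transpose_mat S * A * S) l k x"
    "f \<longrightarrow> (\<forall>w. bf (transpose_mat S * A * S) (x k) w = 0)"
    using v S unfolding csp_def by auto
  obtain T where T: "T \<in> carrier_mat m m" "S * T = 1\<^sub>m m" using S invertible_mat_iff[OF S(1)] by auto
  show ?thesis
  proof (rule csp_memI[OF chain_apply_mat[OF A S x(2)]])
    fix w assume f
    have "bf A (apply_mat S (x k)) w = bf A (apply_mat S (x k)) (apply_mat S (apply_mat T w))"
      using A by (intro bf_cong) (auto simp: apply_mat_inverse[OF S(1) T])
    also have "\<dots> = 0" using x(3) \<open>f\<close> unfolding bf_apply_mat[OF A S(1)] by blast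
    finally show "bf A (apply_mat S (x k)) w = 0" .
  next
    show "S *\<^sub>v v = vec (dim_row A) (apply_mat S (x k))" using x S A by (simp add: vec_apply_mat)
  qed
qed

lemma cdim_congruent:
  fixes A :: "'a :: field mat"
  assumes AB: "congruent_mat A B"
  shows "cdim A l k f = cdim B l k f"
proof -
  define m where "m = dim_row A"
  have A: "A \<in> carrier_mat m m" unfolding m_def by (rule congruent_mat_square[OF AB])
  obtain S where S: "S \<in> carrier_mat m m" "invertible_mat S" "B = transpose_mat S * A * S" and B: "B \<in> carrier_mat m m"
    by (rule congruent_matE[OF AB A])
  obtain T where T: "T \<in> carrier_mat m m" "S * T = 1\<^sub>m m" "T * S = 1\<^sub>m m"
    using S invertible_mat_iff[OF S(1)] by auto
  have iT: "invertible_mat T" using T S(1) invertible_mat_iff[OF T(1)] by auto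
  have AT: "A = transpose_mat T * B * T"
  proof -
    have TS: "transpose_mat T * transpose_mat S = 1\<^sub>m m" using transpose_mult[OF S(1) T(1)] T(2) by simp
    have "transpose_mat T * B * T = (transpose_mat T * transpose_mat S) * A * (S * T)"
      unfolding S(3) using S(1) T(1) A by (simp add: assoc_mult_mat[of _ m m _ m _ m])
    also have "\<dots> = A" unfolding TS T(2) using A by simp
    finally show ?thesis by simp
  qed
  have "csp A l k f = (\<lambda>v. S *\<^sub>v v) ` csp B l k f"
  proof (intro equalityI subsetI)
    fix v assume v: "v \<in> csp A l k f"
    then have "T *\<^sub>v v \<in> csp B l k f" using csp_apply_mat[OF B T(1) iT] AT by simp
    moreover have "S *\<^sub>v (T *\<^sub>v v) = v"
      using assoc_mult_mat_vec[OF S(1) T(1), of v] T(2) v A unfolding csp_def by auto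
    ultimately show "v \<in> (\<lambda>v. S *\<^sub>v v) ` csp B l k f" by (metis image_eqI)
  next
    fix v assume "v \<in> (\<lambda>v. S *\<^sub>v v) ` csp B l k f"
    then show "v \<in> csp A l k f" using csp_apply_mat[OF A S(1,2)] S(3) by auto
  qed
  moreover have "hasdim m (csp B l k f) (cdim B l k f)" using hasdim_cdim[of B] B by simp
  ultimately have "hasdim m (csp A l k f) (cdim B l k f)"
    using hasdim_image_invertible[OF _ S(1,2)] by simp
  then show ?thesis using cdim_eqI[of A] A by simp
qed

lemma cdim_dsum:
  fixes A :: "'a :: field mat"
  assumes A: "A \<in> carrier_mat a a" and B: "B \<in> carrier_mat b b"
  shows "cdim (dsum A B) l k f = cdim A l k f + cdim B l k f"
proof (rule cdim_eqI)
  have sub: "vec (a + b) z = vec a z @\<^sub>v vec b (\<lambda>i. z (i + a))" for z :: "nat \<Rightarrow> 'a"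
    by (intro eq_vecI) auto
  have "csp (dsum A B) l k f = {v @\<^sub>v w | v w. v \<in> csp A l k f \<and> w \<in> csp B l k f}"
  proof (intro equalityI subsetI)
    fix u assume "u \<in> csp (dsum A B) l k f"
    then obtain x where x: "u = vec (a + b) (x k)" "chain (dsum A B) l k x" "f \<longrightarrow> (\<forall>w. bf (dsum A B) (x k) w = 0)"
      unfolding csp_def using A B by auto
    have 1: "bf A (x k) w = 0" if f for w
    proof -
      define u :: "nat \<Rightarrow> 'a" where "u = (\<lambda>i. if i < a then w i else 0)"
      have u: "bf A z u = bf A z w" for z using A by (auto intro!: bf_cong simp: u_def)
      have "(\<lambda>i. u (i + a)) = (\<lambda>_. 0)" unfolding u_def by auto
      then show ?thesis using x(3) that unfolding bf_dsum[OF A B] by (metis add.right_neutral bf_zero_right u)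
    qed
    have 2: "bf B (\<lambda>i. x k (i + a)) w = 0" if f for w
    proof -
      define u :: "nat \<Rightarrow> 'a" where "u = (\<lambda>i. if i < a then 0 else w (i - a))"
      have u: "bf A z u = 0" for z
        using A bf_cong[of A z z u "\<lambda>_. 0"] by (auto simp: u_def)
      have "(\<lambda>i. u (i + a)) = w" unfolding u_def by auto
      then show ?thesis using x(3) that unfolding bf_dsum[OF A B] by (metis add_0 u)
    qed
    have "vec a (x k) \<in> csp A l k f" using A 1 by (intro csp_memI[OF chain_dsum(1)[OF A B x(2)]]) auto
    moreover have "vec b (\<lambda>i. x k (i + a)) \<in> csp B l k f"
      using B 2 by (intro csp_memI[OF chain_dsum(2)[OF A B x(2)]]) auto
    ultimately show "u \<in> {v @\<^sub>v w | v w. v \<in> csp A l k f \<and> w \<in> csp B l k f}" using x(1) sub by blast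
  next
    fix u assume "u \<in> {v @\<^sub>v w | v w. v \<in> csp A l k f \<and> w \<in> csp B l k f}"
    then obtain x y where u: "u = vec a (x k) @\<^sub>v vec b (y k)" and x: "chain A l k x" "f \<longrightarrow> (\<forall>w. bf A (x k) w = 0)"
      and y: "chain B l k y" "f \<longrightarrow> (\<forall>w. bf B (y k) w = 0)" unfolding csp_def using A B by auto
    let ?z = "\<lambda>j i. if i < a then x j i else y j (i - a)"
    show "u \<in> csp (dsum A B) l k f"
    proof (rule csp_memI[OF chain_dsumI[OF A B x(1) y(1)]])
      show "u = vec (dim_row (dsum A B)) (?z k)" unfolding u using A B by (intro eq_vecI) auto
      fix w assume f
      have "bf A (?z k) w = bf A (x k) w" using A by (auto intro!: bf_cong)
      then show "bf (dsum A B) (?z k) w = 0" unfolding bf_dsum[OF A B] using x y \<open>f\<close> by simp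
    qed
  qed
  moreover have "hasdim a (csp A l k f) (cdim A l k f)" "hasdim b (csp B l k f) (cdim B l k f)"
    using hasdim_cdim[of A] hasdim_cdim[of B] A B by auto
  ultimately show "hasdim (dim_row (dsum A B)) (csp (dsum A B) l k f) (cdim A l k f + cdim B l k f)"
    using hasdim_append A B by simp
qed

lemma cdim_direct_sum:
  fixes R :: "nat \<Rightarrow> 'a :: field mat"
  assumes R: "valid_root_choice R" and ok: "\<forall>b\<in>set bs. block_ok b"
  shows "cdim (direct_sum R bs) l k f = (\<Sum>b\<in>#mset bs. cdim (block_mat R b) l k f)"
  using ok
proof (induct bs)
  case Nil
  have "hasdim 0 (csp (0\<^sub>m 0 0) l k f) d \<Longrightarrow> d = 0" for d
  proof -
    assume h: "hasdim 0 (csp (0\<^sub>m 0 0) l k f) d"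
    then obtain P :: "'a mat" where P: "P \<in> carrier_mat 0 d" "inj_mat P" unfolding hasdim_def by auto
    then have "range_mat P \<subseteq> range_mat (1\<^sub>m 0)" using range_mat_subset[OF P(1)] by (simp add: range_mat_one)
    then have "d \<le> 0" by (intro range_mat_mono_dim[OF P, of "1\<^sub>m 0" 0]) auto
    then show "d = 0" by simp
  qed
  then show ?case using hasdim_cdim[of "0\<^sub>m 0 0 :: 'a mat" l k f] by simp
next
  case (Cons b bs)
  have "cdim (direct_sum R (b # bs)) l k f = cdim (block_mat R b) l k f + cdim (direct_sum R bs) l k f"
    unfolding direct_sum_Cons using Cons.prems
    by (intro cdim_dsum[OF block_mat_carrier[OF R] direct_sum_carrier[OF R]]) auto
  then show ?case using Cons by simp
qed

section \<open>The invariant that detects root blocks\<close>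

definition has_root :: "nat \<Rightarrow> 'a :: field mat \<Rightarrow> bool" where
  "has_root n A \<longleftrightarrow> (\<exists>x. chain A 1 n x \<and> bf A (x 1) (x n) \<noteq> 0)"

lemma has_root_congruent:
  fixes A :: "'a :: field mat"
  assumes AB: "congruent_mat A B" and B: "has_root n B"
  shows "has_root n A"
proof -
  define m where "m = dim_row A"
  have A: "A \<in> carrier_mat m m" unfolding m_def by (rule congruent_mat_square[OF AB])
  obtain S where S: "S \<in> carrier_mat m m" "invertible_mat S" "B = transpose_mat S * A * S" "B \<in> carrier_mat m m"
    by (rule congruent_matE[OF AB A])
  from B obtain x where x: "chain B 1 n x" "bf B (x 1) (x n) \<noteq> 0" unfolding has_root_def by blast
  show ?thesis
    unfolding has_root_def
    using chain_apply_mat[OF A S(1,2)] x bf_apply_mat[OF A S(1)] unfolding S(3) by auto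
qed

lemma has_root_dsum:
  fixes A :: "'a :: field mat"
  assumes A: "A \<in> carrier_mat a a" and B: "B \<in> carrier_mat b b"
  shows "has_root n (dsum A B) \<longleftrightarrow> has_root n A \<or> has_root n B"
proof
  assume "has_root n (dsum A B)"
  then obtain x where x: "chain (dsum A B) 1 n x" "bf (dsum A B) (x 1) (x n) \<noteq> 0" unfolding has_root_def by blast
  then have "bf A (x 1) (x n) \<noteq> 0 \<or> bf B (\<lambda>i. x 1 (i + a)) (\<lambda>i. x n (i + a)) \<noteq> 0"
    unfolding bf_dsum[OF A B] by auto
  then show "has_root n A \<or> has_root n B" unfolding has_root_def using chain_dsum[OF A B x(1)] by blast
next
  have z: "bf A (\<lambda>i. if i < a then u i else w i) (\<lambda>i. if i < a then u' i else w' i) = bf A u u'" for u w u' w'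
    using A by (intro bf_cong) auto
  assume "has_root n A \<or> has_root n B"
  then show "has_root n (dsum A B)"
  proof
    assume "has_root n A"
    then obtain x where x: "chain A 1 n x" "bf A (x 1) (x n) \<noteq> 0" unfolding has_root_def by blast
    show ?thesis unfolding has_root_def
      using chain_dsumI[OF A B x(1) chain_zero] x(2)
      by (intro exI[of _ "\<lambda>j i. if i < a then x j i else 0"]) (simp add: bf_dsum[OF A B] z)
  next
    assume "has_root n B"
    then obtain x where x: "chain B 1 n x" "bf B (x 1) (x n) \<noteq> 0" unfolding has_root_def by blast
    show ?thesis unfolding has_root_def
      using chain_dsumI[OF A B chain_zero x(1)] x(2)
      by (intro exI[of _ "\<lambda>j i. if i < a then 0 else x j (i - a)"]) (simp add: bf_dsum[OF A B] z)
  qed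
qed

lemma has_root_direct_sum:
  fixes R :: "nat \<Rightarrow> 'a :: field mat"
  assumes R: "valid_root_choice R" and ok: "\<forall>b\<in>set bs. block_ok b"
  shows "has_root n (direct_sum R bs) \<longleftrightarrow> (\<exists>b\<in>set bs. has_root n (block_mat R b))"
  using ok
proof (induct bs)
  case Nil
  then show ?case unfolding has_root_def by (simp add: bf_def)
next
  case (Cons b bs)
  have "has_root n (direct_sum R (b # bs)) \<longleftrightarrow> has_root n (block_mat R b) \<or> has_root n (direct_sum R bs)"
    unfolding direct_sum_Cons using Cons.prems
    by (intro has_root_dsum[OF block_mat_carrier[OF R] direct_sum_carrier[OF R]]) auto
  then show ?case using Cons by simp
qed

section \<open>Chain spaces of the canonical blocks\<close>

lemma bf_jordan_block_left:
  fixes x :: "nat \<Rightarrow> 'a :: field"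
  assumes "i < n"
  shows "bf (jordan_block n mu) (ue i) x = mu * x i + (if Suc i < n then x (Suc i) else 0)"
proof -
  have "bf (jordan_block n mu) (ue i) x = (\<Sum>j<n. x j * bf (jordan_block n mu) (ue i) (ue j))"
    using bf_expand_right[of "jordan_block n mu" "ue i" x] by simp
  also have "\<dots> = (\<Sum>j<n. (if j = i then mu * x i else 0) + (if j = Suc i then x (Suc i) else 0))"
    using assms by (intro sum.cong) (auto simp: bf_ue_ue)
  finally show ?thesis using assms by (simp add: sum.distrib)
qed

lemma bf_jordan_block_right:
  fixes x :: "nat \<Rightarrow> 'a :: field"
  assumes "i < n"
  shows "bf (jordan_block n mu) x (ue i) = mu * x i + (if 0 < i then x (i - 1) else 0)"
proof -
  have "bf (jordan_block n mu) x (ue i) = (\<Sum>j<n. x j * bf (jordan_block n mu) (ue j) (ue i))"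
    using bf_expand_left[of "jordan_block n mu" x "ue i"] by simp
  also have "\<dots> = (\<Sum>j<n. (if j = i then mu * x i else 0) + (if j = i - 1 then (if 0 < i then x (i - 1) else 0) else 0))"
    using assms by (intro sum.cong) (auto simp: bf_ue_ue)
  finally show ?thesis using assms by (auto simp: sum.distrib)
qed

lemma bf_one_left:
  fixes x :: "nat \<Rightarrow> 'a :: field"
  assumes "i < n"
  shows "bf (1\<^sub>m n) (ue i) x = x i"
proof -
  have "bf (1\<^sub>m n) (ue i) x = (\<Sum>j<n. x j * bf (1\<^sub>m n) (ue i) (ue j))"
    using bf_expand_right[of "1\<^sub>m n" "ue i" x] by simp
  also have "\<dots> = (\<Sum>j<n. if j = i then x i else 0)"
    using assms by (intro sum.cong) (auto simp: bf_ue_ue)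
  finally show ?thesis using assms by simp
qed

lemma bf_one_right:
  fixes x :: "nat \<Rightarrow> 'a :: field"
  assumes "i < n"
  shows "bf (1\<^sub>m n) x (ue i) = x i"
  using bf_one_left[OF assms, of x] bf_transpose[of "1\<^sub>m n :: 'a mat" n x "ue i"] by simp

lemma chain_jordan_zero_iff:
  fixes x :: "nat \<Rightarrow> nat \<Rightarrow> 'a :: field"
  shows "chain (jordan_block n 0) l k x \<longleftrightarrow> x 0 = (\<lambda>_. 0) \<and> (\<forall>j<k. \<forall>i<n.
    (if Suc i < n then x (Suc j) (Suc i) else 0) = l * (if 0 < i then x (Suc j) (i - 1) else 0) + (if 0 < i then x j (i - 1) else 0))"
  unfolding chain_iff_ue by (simp add: bf_jordan_block_left bf_jordan_block_right cong: conj_cong)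

text \<open>A link moves coordinates by two positions. Starting from 0, only even positions below 2
  * k can be reached, and conversely such an end point can be shifted back to 0 in k steps.\<close>

lemma csp_jordan_zero:
  assumes n: "1 \<le> n"
  shows "csp (jordan_block n (0 :: 'a :: field)) 0 k f =
    {v \<in> carrier_vec n. \<forall>i<n. i \<notin> {i. i < n \<and> even i \<and> i < 2 * k \<and> (f \<longrightarrow> i = n - 1)} \<longrightarrow> v $ i = 0}"
proof (intro equalityI subsetI)
  fix v assume "v \<in> csp (jordan_block n (0 :: 'a)) 0 k f"
  then obtain x where v: "v = vec n (x k)" and x: "chain (jordan_block n (0 :: 'a)) 0 k x"
    and f: "f \<longrightarrow> (\<forall>w. bf (jordan_block n 0) (x k) w = 0)" unfolding csp_def by auto
  have x0: "x 0 = (\<lambda>_. 0)" using chain_0[OF x] .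
  have xs: "(if Suc i < n then x (Suc j) (Suc i) else 0) = (if 0 < i then x j (i - 1) else 0)" if "j < k" "i < n" for i j
    using x that unfolding chain_jordan_zero_iff by auto
  have supp: "even p \<and> p < 2 * j" if "j \<le> k" "p < n" "x j p \<noteq> 0" for j p
    using that
  proof (induct j arbitrary: p)
    case 0
    then show ?case using x0 by simp
  next
    case (Suc j)
    consider "p = 0" | "p = 1" | "2 \<le> p" by linarith
    then show ?case
    proof cases
      case 1
      then show ?thesis by simp
    next
      case 2
      then show ?thesis using xs[of j 0] Suc.prems by auto
    next
      case 3
      then have "x (Suc j) p = x j (p - 2)" using xs[of j "p - 1"] Suc.prems by (auto simp: numeral_2_eq_2)
      then have "x j (p - 2) \<noteq> 0" using Suc.prems by simp
      then have "even (p - 2) \<and> p - 2 < 2 * j" using Suc.prems by (intro Suc.hyps) auto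
      then show ?thesis using 3 by auto
    qed
  qed
  \<comment> \<open>The left product with the unit vector i + 1 is the coordinate i, so the flag
    kills all coordinates but the last.\<close>
  have fz: "x k i = 0" if f "i < n" "i \<noteq> n - 1" for i
    using f that bf_jordan_block_right[of "Suc i" n 0 "x k"] by auto
  show "v \<in> {v \<in> carrier_vec n. \<forall>i<n. i \<notin> {i. i < n \<and> even i \<and> i < 2 * k \<and> (f \<longrightarrow> i = n - 1)} \<longrightarrow> v $ i = 0}"
    unfolding v using supp[of k] fz by auto
next
  fix v :: "'a vec" assume "v \<in> {v \<in> carrier_vec n. \<forall>i<n. i \<notin> {i. i < n \<and> even i \<and> i < 2 * k \<and> (f \<longrightarrow> i = n - 1)} \<longrightarrow> v $ i = 0}"
  then have v: "v \<in> carrier_vec n" and vz: "\<And>i. i < n \<Longrightarrow> odd i \<or> 2 * k \<le> i \<or> (f \<and> i \<noteq> n - 1) \<Longrightarrow> v $ i = 0" by auto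
  define w where "w = (\<lambda>i. if i < n then v $ i else 0)"
  have wz: "w i = 0" if "odd i \<or> 2 * k \<le> i \<or> n \<le> i" for i using vz that unfolding w_def by auto
  define x where "x = (\<lambda>j p. w (p + 2 * (k - j)))"
  show "v \<in> csp (jordan_block n 0) 0 k f"
  proof (rule csp_memI)
    show "chain (jordan_block n 0) 0 k x"
      unfolding chain_jordan_zero_iff
    proof (intro conjI allI impI)
      show "x 0 = (\<lambda>_. 0)" unfolding x_def using wz by auto
      fix j i assume ji: "j < k" "i < n"
      have e: "Suc i + 2 * (k - Suc j) = i - 1 + 2 * (k - j)" if "0 < i" using that ji by auto
      have "Suc i < n \<Longrightarrow> 0 < i \<Longrightarrow> x (Suc j) (Suc i) = x j (i - 1)" unfolding x_def by (simp only: e)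
      moreover have "Suc i < n \<Longrightarrow> i = 0 \<Longrightarrow> x (Suc j) (Suc i) = 0" unfolding x_def by (intro wz) auto
      moreover have "\<not> Suc i < n \<Longrightarrow> 0 < i \<Longrightarrow> x j (i - 1) = 0" unfolding x_def using ji by (intro wz) auto
      ultimately show "(if Suc i < n then x (Suc j) (Suc i) else 0) = 0 * (if 0 < i then x (Suc j) (i - 1) else 0) + (if 0 < i then x j (i - 1) else 0)"
        by auto
    qed
    show "v = vec (dim_row (jordan_block n (0 :: 'a))) (x k)" using v by (intro eq_vecI) (auto simp: x_def w_def)
    fix u assume f
    have z: "bf (jordan_block n 0) (x k) (ue i) = 0" if "i < n" for i
    proof -
      have "v $ (i - 1) = 0" if "0 < i" using that \<open>f\<close> \<open>i < n\<close> by (intro vz) auto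
      then show ?thesis using bf_jordan_block_right[OF that, of 0 "x k"] that by (auto simp: x_def w_def)
    qed
    have "bf (jordan_block n 0) (x k) u = (\<Sum>i<dim_row (jordan_block n (0 :: 'a)). u i * bf (jordan_block n 0) (x k) (ue i))"
      by (rule bf_expand_right)
    then show "bf (jordan_block n 0) (x k) u = 0" using z by simp
  qed
qed

lemma cdim_jordan_zero:
  assumes n: "1 \<le> n"
  shows "cdim (jordan_block n (0 :: 'a :: field)) 0 k False = min k ((n + 1) div 2)"
    and "cdim (jordan_block n (0 :: 'a :: field)) 0 k True = (if odd n \<and> n < 2 * k then 1 else 0)"
proof -
  have h: "hasdim n (csp (jordan_block n (0 :: 'a)) 0 k f) (card {i. i < n \<and> even i \<and> i < 2 * k \<and> (f \<longrightarrow> i = n - 1)})" for f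
    unfolding csp_jordan_zero[OF n] by (rule hasdim_coordinate) auto
  have "{i. i < n \<and> even i \<and> i < 2 * k} = (\<lambda>a. 2 * a) ` {..<min k ((n + 1) div 2)}"
    by (auto elim!: evenE)
  then have "card {i. i < n \<and> even i \<and> i < 2 * k} = min k ((n + 1) div 2)"
    by (simp add: card_image inj_on_def)
  then show "cdim (jordan_block n (0 :: 'a)) 0 k False = min k ((n + 1) div 2)"
    using h[of False] by (intro cdim_eqI) simp
  have "{i. i < n \<and> even i \<and> i < 2 * k \<and> i = n - 1} = (if odd n \<and> n < 2 * k then {n - 1} else {})"
    using n by (auto, presburger+)
  then have "card {i. i < n \<and> even i \<and> i < 2 * k \<and> (True \<longrightarrow> i = n - 1)} = (if odd n \<and> n < 2 * k then 1 else 0)"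
    by auto
  then show "cdim (jordan_block n (0 :: 'a)) 0 k True = (if odd n \<and> n < 2 * k then 1 else 0)"
    using h[of True] by (intro cdim_eqI) simp
qed

lemma bf_right_nondegenerate:
  fixes A :: "'a :: field mat"
  assumes A: "A \<in> carrier_mat m m" and inv: "invertible_mat A" and x: "\<And>w. bf A w x = 0" and i: "i < m"
  shows "x i = 0"
proof -
  have "A *\<^sub>v vec m x = 0\<^sub>v m"
  proof (rule eq_vecI)
    fix i assume "i < dim_vec (0\<^sub>v m :: 'a vec)"
    then have i: "i < m" by simp
    have "(A *\<^sub>v vec m x) $ i = bf A (ue i) (\<lambda>j. vec m x $ j)" using A i by (intro mult_mat_vec_index_bf) auto
    also have "\<dots> = bf A (ue i) x" using A by (intro bf_cong) auto
    finally show "(A *\<^sub>v vec m x) $ i = 0\<^sub>v m $ i" using x i by simp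
  qed (use A in simp)
  then have "vec m x = 0\<^sub>v m" using invertible_mat_kernel[OF A inv] by simp
  then show ?thesis using i by (metis index_vec index_zero_vec(1))
qed

text \<open>For l = 0 each member of a chain is determined by its predecessor through A, so all are
  0 and nonsingular blocks are invisible at l = 0.\<close>

lemma cdim_nonsingular:
  fixes A :: "'a :: field mat"
  assumes A: "A \<in> carrier_mat m m" and inv: "invertible_mat A"
  shows "cdim A 0 k f = 0"
proof (rule cdim_eqI)
  have "csp A 0 k f = {v \<in> carrier_vec m. \<forall>i<m. i \<notin> {} \<longrightarrow> v $ i = 0}"
  proof (intro equalityI subsetI)
    fix v assume "v \<in> csp A 0 k f"
    then obtain x where v: "v = vec m (x k)" and x: "chain A 0 k x" using A unfolding csp_def by auto
    have "x j i = 0" if "j \<le> k" "i < m" for i j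
      using that
    proof (induct j arbitrary: i)
      case 0
      then show ?case using chain_0[OF x] by simp
    next
      case (Suc j)
      have "bf A w (x (Suc j)) = 0" for w
      proof -
        have "bf A (x j) w = bf A (\<lambda>_. 0) w" using A Suc by (intro bf_cong) auto
        then show ?thesis using chainD[OF x, of j w] Suc.prems by simp
      qed
      then show ?case using bf_right_nondegenerate[OF A inv] Suc.prems by blast
    qed
    then show "v \<in> {v \<in> carrier_vec m. \<forall>i<m. i \<notin> {} \<longrightarrow> v $ i = 0}" using v by simp
  next
    fix v :: "'a vec" assume "v \<in> {v \<in> carrier_vec m. \<forall>i<m. i \<notin> {} \<longrightarrow> v $ i = 0}"
    then show "v \<in> csp A 0 k f"
      using A by (intro csp_memI[OF chain_zero]) auto
  qed
  then show "hasdim (dim_row A) (csp A 0 k f) 0"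
    using A hasdim_coordinate[of "{}" m] by simp
qed

text \<open>The chain condition for \<open>[0 I; J 0]\<close> falls apart into \<open>J p' = l p' + p\<close> on the first half and
  \<open>q' = J\<^sup>T (l q' + q)\<close> on the second, where \<open>J = J\<^sub>n(\<mu>)\<close>.\<close>

definition upper_rel :: "nat \<Rightarrow> 'a :: field \<Rightarrow> 'a \<Rightarrow> nat \<Rightarrow> (nat \<Rightarrow> nat \<Rightarrow> 'a) \<Rightarrow> bool" where
  "upper_rel n mu l k p \<longleftrightarrow> p 0 = (\<lambda>_. 0) \<and>
     (\<forall>j<k. \<forall>i<n. mu * p (Suc j) i + (if Suc i < n then p (Suc j) (Suc i) else 0) = l * p (Suc j) i + p j i)"

definition lower_rel :: "nat \<Rightarrow> 'a :: field \<Rightarrow> 'a \<Rightarrow> nat \<Rightarrow> (nat \<Rightarrow> nat \<Rightarrow> 'a) \<Rightarrow> bool" where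
  "lower_rel n mu l k q \<longleftrightarrow> q 0 = (\<lambda>_. 0) \<and>
     (\<forall>j<k. \<forall>i<n. q (Suc j) i = l * (mu * q (Suc j) i + (if 0 < i then q (Suc j) (i - 1) else 0)) +
        (mu * q j i + (if 0 < i then q j (i - 1) else 0)))"

lemma upper_rel_D:
  assumes "upper_rel n mu l k p" "j < k" "i < n"
  shows "mu * p (Suc j) i + (if Suc i < n then p (Suc j) (Suc i) else 0) = l * p (Suc j) i + p j i"
  using assms unfolding upper_rel_def by blast

lemma upper_rel_support:
  assumes p: "upper_rel n l l k p" and "j \<le> k" "i < n" "j \<le> i"
  shows "p j i = 0"
  using assms(2-)
proof (induct j arbitrary: i)
  case 0
  then show ?case using p unfolding upper_rel_def by simp
next
  case (Suc j)
  then obtain a where a: "i = Suc a" by (cases i) auto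
  have "p (Suc j) (Suc a) = p j a" using upper_rel_D[OF p, of j a] Suc.prems a by simp
  then show ?case using Suc a by simp
qed

text \<open>For l = mu a link says \<open>p (Suc j) (Suc i) = p j i\<close>, so any end point
  supported on the first k coordinates can be shifted back to 0. For other l the matrix J - l is
  invertible and the chain vanishes.\<close>

lemma hasdim_upper:
  fixes mu :: "'a :: field"
  shows "hasdim n {vec n (p k) | p. upper_rel n mu l k p} (if l = mu then min k n else 0 :: nat)"
proof -
  define I where "I = (if l = mu then {i. i < n \<and> i < k} else {})"
  have "{vec n (p k) | p. upper_rel n mu l k p} = {v \<in> carrier_vec n. \<forall>i<n. i \<notin> I \<longrightarrow> v $ i = 0}"
  proof (intro equalityI subsetI)
    fix v assume "v \<in> {vec n (p k) | p. upper_rel n mu l k p}"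
    then obtain p where v: "v = vec n (p k)" and p: "upper_rel n mu l k p" by auto
    have p0: "p 0 = (\<lambda>_. 0)" using p unfolding upper_rel_def by blast
    have "p k i = 0" if i: "i < n" "i \<notin> I" for i
    proof (cases "l = mu")
      case True
      then show ?thesis using upper_rel_support[of n l k p k i] p i unfolding I_def by auto
    next
      case False
      have "p j i = 0" if "j \<le> k" "i < n" for j i
        using that
      proof (induct j arbitrary: i)
        case 0
        then show ?case using p0 by simp
      next
        case (Suc j)
        have pj: "p j i = 0" if "i < n" for i using Suc that by simp
        show ?case using Suc.prems(2)
        proof (induct "n - i" arbitrary: i rule: less_induct)
          case less
          have "(if Suc i < n then p (Suc j) (Suc i) else 0) = 0" using less by auto
          then have "(mu - l) * p (Suc j) i = 0"
            using upper_rel_D[OF p, of j i] Suc.prems less.prems pj by (simp add: algebra_simps)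
          then show ?case using False by simp
        qed
      qed
      then show ?thesis using i by simp
    qed
    then show "v \<in> {v \<in> carrier_vec n. \<forall>i<n. i \<notin> I \<longrightarrow> v $ i = 0}" using v by simp
  next
    fix v :: "'a vec" assume "v \<in> {v \<in> carrier_vec n. \<forall>i<n. i \<notin> I \<longrightarrow> v $ i = 0}"
    then have v: "v \<in> carrier_vec n" and vz: "\<And>i. i < n \<Longrightarrow> i \<notin> I \<Longrightarrow> v $ i = 0" by auto
    show "v \<in> {vec n (p k) | p. upper_rel n mu l k p}"
    proof (cases "l = mu")
      case False
      then have "v = vec n (\<lambda>_. 0)" using v vz unfolding I_def by (intro eq_vecI) auto
      moreover have "upper_rel n mu l k (\<lambda>_ _. 0)" unfolding upper_rel_def by simp
      ultimately show ?thesis by auto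
    next
      case True
      define w where "w = (\<lambda>i. if i < n then v $ i else 0)"
      have wz: "w i = 0" if "k \<le> i \<or> n \<le> i" for i using vz that True unfolding w_def I_def by auto
      define p where "p = (\<lambda>j i. w (i + (k - j)))"
      have "upper_rel n mu l k p"
        unfolding upper_rel_def
      proof (intro conjI allI impI)
        show "p 0 = (\<lambda>_. 0)" unfolding p_def using wz by auto
        fix j i assume ji: "j < k" "i < n"
        have e: "Suc i + (k - Suc j) = i + (k - j)" using ji by auto
        have "p (Suc j) (Suc i) = p j i" unfolding p_def by (simp only: e)
        moreover have "\<not> Suc i < n \<Longrightarrow> p j i = 0" unfolding p_def using ji by (intro wz) auto
        ultimately show "mu * p (Suc j) i + (if Suc i < n then p (Suc j) (Suc i) else 0) = l * p (Suc j) i + p j i"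
          using True by auto
      qed
      moreover have "v = vec n (p k)" using v by (intro eq_vecI) (auto simp: p_def w_def)
      ultimately show ?thesis by blast
    qed
  qed
  moreover have "card I = (if l = mu then min k n else 0)"
  proof -
    have "{i. i < n \<and> i < k} = {..<min k n}" by auto
    then show ?thesis unfolding I_def by simp
  qed
  moreover have "I \<subseteq> {..<n}" unfolding I_def by auto
  ultimately show ?thesis using hasdim_coordinate[of I n] by simp
qed

lemma lower_rel_D:
  assumes "lower_rel n mu l k q" "j < k" "i < n"
  shows "q (Suc j) i = l * (mu * q (Suc j) i + (if 0 < i then q (Suc j) (i - 1) else 0)) +
        (mu * q j i + (if 0 < i then q j (i - 1) else 0))"
  using assms unfolding lower_rel_def by blast

text \<open>Forward substitution for the equation with matrix J^T and right-hand side g.\<close>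

primrec solve_lower :: "'a :: field \<Rightarrow> (nat \<Rightarrow> 'a) \<Rightarrow> nat \<Rightarrow> 'a" where
  "solve_lower mu g 0 = g 0 / mu"
| "solve_lower mu g (Suc i) = (g (Suc i) - solve_lower mu g i) / mu"

lemma solve_lower_eq:
  "mu \<noteq> 0 \<Longrightarrow> mu * solve_lower mu g i + (if 0 < i then solve_lower mu g (i - 1) else 0) = g i"
  by (cases i) auto

lemma solve_lower_zero: "(\<And>i. i < c \<Longrightarrow> g i = 0) \<Longrightarrow> i < c \<Longrightarrow> solve_lower mu g i = 0"
  by (induct i) auto

text \<open>For l * mu = 1 a link determines the predecessor from the successor by a triangular
  system, so chains are built backwards from their end point. Each step creates one more leading
  zero, and k steps reach 0 when the first n - k coordinates of the end point vanish.\<close>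

lemma hasdim_lower:
  fixes mu :: "'a :: field"
  assumes mu: "mu \<noteq> 0"
  shows "hasdim n {vec n (q k) | q. lower_rel n mu l k q} (if l * mu = 1 then min k n else 0 :: nat)"
proof -
  define I where "I = (if l * mu = 1 then {i. i < n \<and> n \<le> i + k} else {})"
  have "{vec n (q k) | q. lower_rel n mu l k q} = {v \<in> carrier_vec n. \<forall>i<n. i \<notin> I \<longrightarrow> v $ i = 0}"
  proof (intro equalityI subsetI)
    fix v assume "v \<in> {vec n (q k) | q. lower_rel n mu l k q}"
    then obtain q where v: "v = vec n (q k)" and q: "lower_rel n mu l k q" by auto
    have q0: "q 0 = (\<lambda>_. 0)" using q unfolding lower_rel_def by blast
    have "q k i = 0" if i: "i < n" "i \<notin> I" for i
    proof (cases "l * mu = 1")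
      case True
      have l0: "l \<noteq> 0" using True by auto
      have "q j i = 0" if "j \<le> k" "i + j < n" for i j
        using that
      proof (induct j arbitrary: i)
        case 0
        then show ?case using q0 by simp
      next
        case (Suc j)
        have "q (Suc j) (Suc i) = (l * mu) * q (Suc j) (Suc i) + l * q (Suc j) i + (mu * q j (Suc i) + q j i)"
          using lower_rel_D[OF q, of j "Suc i"] Suc.prems by (simp add: algebra_simps)
        moreover have "q j (Suc i) = 0" "q j i = 0" using Suc by auto
        ultimately have "l * q (Suc j) i = 0" using True by simp
        then show ?case using l0 by simp
      qed
      then show ?thesis using i True unfolding I_def by auto
    next
      case False
      have "q j i = 0" if "j \<le> k" "i < n" for j i
        using that
      proof (induct j arbitrary: i)
        case 0
        then show ?case using q0 by simp
      next
        case (Suc j)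
        have qj: "q j i = 0" if "i < n" for i using Suc that by simp
        show ?case using Suc.prems(2)
        proof (induct i rule: less_induct)
          case (less i)
          have "(if 0 < i then q (Suc j) (i - 1) else 0) = 0" using less by auto
          moreover have "(if 0 < i then q j (i - 1) else 0) = 0" using qj[of "i - 1"] less.prems by auto
          ultimately have "(1 - l * mu) * q (Suc j) i = 0"
            using lower_rel_D[OF q, of j i] Suc.prems less.prems qj by (simp add: algebra_simps)
          then show ?case using False by simp
        qed
      qed
      then show ?thesis using i by simp
    qed
    then show "v \<in> {v \<in> carrier_vec n. \<forall>i<n. i \<notin> I \<longrightarrow> v $ i = 0}" using v by simp
  next
    fix v :: "'a vec" assume "v \<in> {v \<in> carrier_vec n. \<forall>i<n. i \<notin> I \<longrightarrow> v $ i = 0}"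
    then have v: "v \<in> carrier_vec n" and vz: "\<And>i. i < n \<Longrightarrow> i \<notin> I \<Longrightarrow> v $ i = 0" by auto
    show "v \<in> {vec n (q k) | q. lower_rel n mu l k q}"
    proof (cases "l * mu = 1")
      case False
      then have "v = vec n (\<lambda>_. 0)" using v vz unfolding I_def by (intro eq_vecI) auto
      moreover have "lower_rel n mu l k (\<lambda>_ _. 0)" unfolding lower_rel_def by simp
      ultimately show ?thesis by auto
    next
      case True
      define step where "step = (\<lambda>r. solve_lower mu (\<lambda>i. if 0 < i then - l * r (i - 1) else 0))"
      have step_eq: "step r = solve_lower mu (\<lambda>i. if 0 < i then - l * r (i - 1) else 0)" for r
        unfolding step_def ..
      define w where "w = (\<lambda>i. if i < n then v $ i else 0)"
      have supp: "(step ^^ s) w i = 0" if "i + k < n + s" "i < n" for s i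
        using that
      proof (induct s arbitrary: i)
        case 0
        then show ?case using vz[of i] True unfolding w_def I_def by auto
      next
        case (Suc s)
        have z: "(if 0 < a then - l * (step ^^ s) w (a - 1) else 0) = 0" if "a < Suc i" for a
          using Suc.hyps[of "a - 1"] Suc.prems that by auto
        have "(step ^^ Suc s) w i = solve_lower mu (\<lambda>a. if 0 < a then - l * (step ^^ s) w (a - 1) else 0) i"
          by (simp only: funpow.simps comp_apply step_eq)
        also have "\<dots> = 0" by (rule solve_lower_zero[of "Suc i"]) (use z in auto)
        finally show ?case .
      qed
      define q where "q = (\<lambda>j i. if i < n then (step ^^ (k - j)) w i else 0)"
      have "lower_rel n mu l k q"
        unfolding lower_rel_def
      proof (intro conjI allI impI)
        show "q 0 = (\<lambda>_. 0)" unfolding q_def using supp[of _ k] by auto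
        fix j i assume ji: "j < k" "i < n"
        let ?r = "(step ^^ (k - Suc j)) w"
        have "k - j = Suc (k - Suc j)" using ji by simp
        then have sj: "(step ^^ (k - j)) w = step ?r" by simp
        have "mu * step ?r i + (if 0 < i then step ?r (i - 1) else 0) = (if 0 < i then - l * ?r (i - 1) else 0)"
          unfolding step_def by (rule solve_lower_eq[OF mu])
        then have e: "mu * q j i + (if 0 < i then q j (i - 1) else 0) = (if 0 < i then - l * q (Suc j) (i - 1) else 0)"
          unfolding q_def sj using ji by auto
        show "q (Suc j) i = l * (mu * q (Suc j) i + (if 0 < i then q (Suc j) (i - 1) else 0)) +
          (mu * q j i + (if 0 < i then q j (i - 1) else 0))"
          unfolding e using True by (auto simp: algebra_simps mult.assoc[symmetric])
      qed
      moreover have "v = vec n (q k)" using v by (intro eq_vecI) (auto simp: q_def w_def)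
      ultimately show ?thesis by blast
    qed
  qed
  moreover have "card I = (if l * mu = 1 then min k n else 0)"
  proof -
    have "{i. i < n \<and> n \<le> i + k} = {n - min k n..<n}" by auto
    then show ?thesis unfolding I_def by auto
  qed
  moreover have "I \<subseteq> {..<n}" unfolding I_def by auto
  ultimately show ?thesis using hasdim_coordinate[of I n] by simp
qed

lemma chain_pair_block_iff:
  fixes mu :: "'a :: field"
  shows "chain (four_block_mat (0\<^sub>m n n) (1\<^sub>m n) (jordan_block n mu) (0\<^sub>m n n)) l k x \<longleftrightarrow>
    x 0 = (\<lambda>_. 0) \<and> upper_rel n mu l k x \<and> lower_rel n mu l k (\<lambda>j i. x j (i + n))"
    (is "chain ?F l k x \<longleftrightarrow> _")
proof -
  let ?J = "jordan_block n mu"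
  have J: "?J \<in> carrier_mat n n" and I: "1\<^sub>m n \<in> carrier_mat n n" by auto
  have sh: "(\<lambda>a. ue i (a + n)) = (\<lambda>_. 0 :: 'a)" if "i < n" for i unfolding ue_def using that by auto
  have sh': "(\<lambda>a. ue (i + n) (a + n)) = (ue i :: nat \<Rightarrow> 'a)" for i unfolding ue_def by auto
  have z: "bf M (ue (i + n)) y = 0" "bf M y (ue (i + n)) = 0" if "M \<in> carrier_mat n n" for M :: "'a mat" and i y
    using bf_cong[of M "ue (i + n)" "\<lambda>_. 0" y y] bf_cong[of M y y "ue (i + n)" "\<lambda>_. 0"] that by (auto simp: ue_def)
  have 1: "bf ?F (ue i) y = y (i + n)" "bf ?F y (ue i) = mu * y (i + n) + (if 0 < i then y (i - 1 + n) else 0)"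
    if "i < n" for i y
    unfolding bf_antidiag[OF I J] sh[OF that] using that by (simp_all add: bf_one_left bf_jordan_block_right)
  have 2: "bf ?F (ue (i + n)) y = mu * y i + (if Suc i < n then y (Suc i) else 0)" "bf ?F y (ue (i + n)) = y i"
    if "i < n" for i y
    unfolding bf_antidiag[OF I J] sh' z[OF I] z[OF J] using that by (simp_all add: bf_one_right bf_jordan_block_left)
  have split: "(\<forall>i<n + n. P i) \<longleftrightarrow> (\<forall>i<n. P i) \<and> (\<forall>i<n. P (i + n))" for P
  proof (intro iffI conjI allI impI)
    fix i assume h: "(\<forall>i<n. P i) \<and> (\<forall>i<n. P (i + n))" and i: "i < n + n"
    show "P i"
    proof (cases "i < n")
      case False
      then have "P (i - n + n)" using h i by (metis add_less_cancel_right le_add_diff_inverse2 not_less)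
      then show ?thesis using False by simp
    qed (use h in blast)
  qed auto
  have dim: "dim_row ?F = n + n" by simp
  show ?thesis
    unfolding chain_iff_ue dim split upper_rel_def lower_rel_def
    by (auto simp: 1 2 add.commute)
qed

lemma pair_block_carrier:
  "four_block_mat (0\<^sub>m n n) (1\<^sub>m n) (jordan_block n mu) (0\<^sub>m n n) \<in> carrier_mat (n + n) (n + n)"
  by (intro four_block_carrier_mat) auto

lemma cdim_pair_block:
  fixes mu :: "'a :: field"
  assumes mu: "mu \<noteq> 0"
  shows "cdim (four_block_mat (0\<^sub>m n n) (1\<^sub>m n) (jordan_block n mu) (0\<^sub>m n n)) l k False =
    (if l = mu then min k n else 0) + (if l * mu = 1 then min k n else 0)"
proof (rule cdim_eqI)
  let ?F = "four_block_mat (0\<^sub>m n n) (1\<^sub>m n) (jordan_block n mu) (0\<^sub>m n n)"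
  let ?P = "{vec n (p k) | p. upper_rel n mu l k p}"
  let ?Q = "{vec n (q k) | q. lower_rel n mu l k q}"
  have "csp ?F l k False = {v @\<^sub>v w | v w. v \<in> ?P \<and> w \<in> ?Q}"
  proof (intro equalityI subsetI)
    fix u assume "u \<in> csp ?F l k False"
    then obtain x where x: "u = vec (n + n) (x k)" "chain ?F l k x" unfolding csp_def by auto
    have "u = vec n (x k) @\<^sub>v vec n (\<lambda>i. x k (i + n))" unfolding x(1) by (intro eq_vecI) auto
    moreover have "vec n (x k) \<in> ?P" "vec n (\<lambda>i. x k (i + n)) \<in> ?Q"
      using x(2) unfolding chain_pair_block_iff by (blast, auto intro!: exI[of _ "\<lambda>j i. x j (i + n)"])
    ultimately show "u \<in> {v @\<^sub>v w | v w. v \<in> ?P \<and> w \<in> ?Q}" by blast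
  next
    fix u assume "u \<in> {v @\<^sub>v w | v w. v \<in> ?P \<and> w \<in> ?Q}"
    then obtain p q where u: "u = vec n (p k) @\<^sub>v vec n (q k)" and p: "upper_rel n mu l k p" and q: "lower_rel n mu l k q"
      by auto
    define x where "x = (\<lambda>j i. if i < n then p j i else q j (i - n))"
    have "chain ?F l k x"
      unfolding chain_pair_block_iff
    proof (intro conjI)
      show x0: "x 0 = (\<lambda>_. 0)" unfolding x_def using p q unfolding upper_rel_def lower_rel_def by auto
      show "upper_rel n mu l k x"
        unfolding upper_rel_def
      proof (intro conjI allI impI)
        fix j i assume "j < k" "i < n"
        then show "mu * x (Suc j) i + (if Suc i < n then x (Suc j) (Suc i) else 0) = l * x (Suc j) i + x j i"
          using upper_rel_D[OF p, of j i] by (cases "Suc i < n") (auto simp: x_def)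
      qed (rule x0)
      show "lower_rel n mu l k (\<lambda>j i. x j (i + n))" using q unfolding x_def by simp
    qed
    moreover have "u = vec (dim_row ?F) (x k)" unfolding u by (intro eq_vecI) (auto simp: x_def)
    ultimately show "u \<in> csp ?F l k False" by (intro csp_memI) auto
  qed
  moreover have "hasdim (n + n) {v @\<^sub>v w | v w. v \<in> ?P \<and> w \<in> ?Q}
    ((if l = mu then min k n else 0) + (if l * mu = 1 then min k n else 0))"
    by (rule hasdim_append[OF hasdim_upper hasdim_lower[OF mu]])
  ultimately show "hasdim (dim_row ?F) (csp ?F l k False) ((if l = mu then min k n else 0) + (if l * mu = 1 then min k n else 0))"
    by simp
qed

section \<open>Root blocks: their chain spaces and their detection\<close>

lemma root_form_bf_swap:
  fixes C :: "'a :: field mat"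
  assumes C: "root_form n C"
  shows "bf C w x = bf C (\<lambda>i. x i + (if Suc i < n then x (Suc i) else 0)) w"
proof -
  have Cc: "C \<in> carrier_mat n n" and eq: "C = transpose_mat C * jordan_block n 1"
    using C unfolding root_form_def by auto
  have dim: "dim_row C = n" using Cc by simp
  note ch = chain_std[OF Cc eq]
  have s: "bf C w (ue j) = bf C (ue j) w + (if 0 < j then bf C (ue (j - 1)) w else 0)" if "j < n" for j
    using chainD[OF ch that, of w] that by (auto simp: std_chain_def)
  have "bf C w x = (\<Sum>j<n. x j * bf C w (ue j))" using bf_expand_right[of C w x] dim by simp
  also have "\<dots> = (\<Sum>j<n. x j * bf C (ue j) w) + (\<Sum>j<n. if 0 < j then x j * bf C (ue (j - 1)) w else 0)"
    unfolding sum.distrib[symmetric] by (intro sum.cong refl) (auto simp: s algebra_simps)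
  also have "(\<Sum>j<n. if 0 < j then x j * bf C (ue (j - 1)) w else 0) = (\<Sum>j<n. (if Suc j < n then x (Suc j) else 0) * bf C (ue j) w)"
  proof (cases n)
    case (Suc N)
    have "(\<Sum>j<Suc N. if 0 < j then x j * bf C (ue (j - 1)) w else 0) = (\<Sum>j<N. x (Suc j) * bf C (ue j) w)"
      by (simp add: sum.lessThan_Suc_shift del: sum.lessThan_Suc)
    moreover have "(\<Sum>j<Suc N. (if Suc j < Suc N then x (Suc j) else 0) * bf C (ue j) w) = (\<Sum>j<N. x (Suc j) * bf C (ue j) w)"
      by simp
    ultimately show ?thesis using Suc by simp
  qed simp
  also have "(\<Sum>j<n. x j * bf C (ue j) w) + (\<Sum>j<n. (if Suc j < n then x (Suc j) else 0) * bf C (ue j) w) =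
    (\<Sum>j<n. (x j + (if Suc j < n then x (Suc j) else 0)) * bf C (ue j) w)"
    by (simp add: sum.distrib algebra_simps)
  also have "\<dots> = bf C (\<lambda>i. x i + (if Suc i < n then x (Suc i) else 0)) w"
    using bf_expand_left[of C "\<lambda>i. x i + (if Suc i < n then x (Suc i) else 0)" w] dim by simp
  finally show ?thesis .
qed

text \<open>Writing C as C^T J moves all terms of a link to the same side of the form, and C can
  then be cancelled: what is left is J p' = l p' + p with J = J_n(1).\<close>

lemma chain_root_form_iff:
  fixes C :: "'a :: field mat"
  assumes C: "root_form n C"
  shows "chain C l k x \<longleftrightarrow> upper_rel n 1 l k x"
proof -
  have Cc: "C \<in> carrier_mat n n" and inv: "invertible_mat C" using C unfolding root_form_def by auto
  have CT: "transpose_mat C \<in> carrier_mat n n" "invertible_mat (transpose_mat C)"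
    using Cc inv by (auto simp: invertible_mat_transpose[OF Cc])
  have *: "(\<forall>w. bf C w y = l * bf C y w + bf C z w) \<longleftrightarrow>
    (\<forall>i<n. 1 * y i + (if Suc i < n then y (Suc i) else 0) = l * y i + z i)" for y z
  proof -
    define d where "d = (\<lambda>i. (y i + (if Suc i < n then y (Suc i) else 0)) + (- 1) * (l * y i + z i))"
    have e: "bf C d w = bf C w y - (l * bf C y w + bf C z w)" for w
      unfolding d_def bf_add_left bf_plus_left root_form_bf_swap[OF C, of w y] by (simp add: bf_smult_left bf_plus_left)
    have di: "d i = 0 \<longleftrightarrow> 1 * y i + (if Suc i < n then y (Suc i) else 0) = l * y i + z i" for i
    proof -
      have "a + (- 1) * b = 0 \<longleftrightarrow> a = b" for a b :: 'a using right_minus_eq[of a b] by simp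
      then show ?thesis unfolding d_def mult_1 .
    qed
    have iff: "(\<forall>w. bf C d w = 0) \<longleftrightarrow> (\<forall>i<n. d i = 0)"
    proof
      assume h: "\<forall>w. bf C d w = 0"
      have "bf (transpose_mat C) w d = 0" for w using h by (simp add: bf_transpose[OF Cc])
      then show "\<forall>i<n. d i = 0" using bf_right_nondegenerate[OF CT] by blast
    next
      assume h: "\<forall>i<n. d i = 0"
      show "\<forall>w. bf C d w = 0"
      proof
        fix w
        have "bf C d w = bf C (\<lambda>_. 0) w" using h Cc by (intro bf_cong) auto
        then show "bf C d w = 0" by simp
      qed
    qed
    then show ?thesis unfolding e di by (simp only: right_minus_eq)
  qed
  show ?thesis unfolding chain_def upper_rel_def * by blast
qed

lemma cdim_root_form:
  fixes C :: "'a :: field mat"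
  assumes C: "root_form n C"
  shows "cdim C l k False = (if l = 1 then min k n else 0)"
proof (rule cdim_eqI)
  have dim: "dim_row C = n" using C unfolding root_form_def by auto
  have "csp C l k False = {vec n (p k) | p. upper_rel n 1 l k p}"
    unfolding csp_def dim chain_root_form_iff[OF C] by simp
  then show "hasdim (dim_row C) (csp C l k False) (if l = 1 then min k n else 0)"
    unfolding dim using hasdim_upper[of n k 1 l] by simp
qed

text \<open>All members of a chain for l = 1 live on even positions, whereas \<open>J_m(0)\<close>
  pairs each position only with its successor.\<close>

lemma not_has_root_jordan_zero:
  "\<not> has_root n (jordan_block m (0 :: 'a :: field))"
proof
  assume "has_root n (jordan_block m (0 :: 'a))"
  then obtain x where x: "chain (jordan_block m (0 :: 'a)) 1 n x" and nz: "bf (jordan_block m 0) (x 1) (x n) \<noteq> 0"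
    unfolding has_root_def by blast
  have x0: "x 0 = (\<lambda>_. 0)" using chain_0[OF x] .
  have xs: "(if Suc i < m then x (Suc j) (Suc i) else 0) = (if 0 < i then x (Suc j) (i - 1) else 0) + (if 0 < i then x j (i - 1) else 0)"
    if "j < n" "i < m" for i j using x that unfolding chain_jordan_zero_iff by auto
  have supp: "x j p = 0" if "j \<le> n" "p < m" "odd p" for j p
    using that
  proof (induct j arbitrary: p)
    case 0
    then show ?case using x0 by simp
  next
    case (Suc j)
    note IH = Suc.hyps
    have j: "j < n" using Suc.prems by simp
    show ?case using Suc.prems(2,3)
    proof (induct p rule: less_induct)
      case (less p)
      show ?case
      proof (cases "p = 1")
        case True
        then show ?thesis using xs[OF j, of 0] less.prems by simp
      next
        case False
        then have p: "3 \<le> p" "odd (p - 2)" using less.prems by (auto elim!: oddE)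
        have "x (Suc j) p = x (Suc j) (p - 2) + x j (p - 2)"
          using xs[OF j, of "p - 1"] p less.prems by (auto simp: numeral_2_eq_2)
        then show ?thesis using less.hyps[of "p - 2"] IH[of "p - 2"] j p less.prems by simp
      qed
    qed
  qed
  have "1 \<le> n"
    using nz x0 by (cases n) auto
  have "bf (jordan_block m 0) (x 1) (x n) = (\<Sum>i<m. x 1 i * bf (jordan_block m 0) (ue i) (x n))"
    using bf_expand_left[of "jordan_block m 0" "x 1" "x n"] by simp
  also have "\<dots> = 0"
  proof (rule sum.neutral, rule ballI)
    fix i assume "i \<in> {..<m}"
    then have i: "i < m" by simp
    have "x 1 i = 0 \<or> (if Suc i < m then x n (Suc i) else 0) = 0"
      using supp[of 1 i] supp[of n "Suc i"] i \<open>1 \<le> n\<close> by (cases "odd i") auto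
    then show "x 1 i * bf (jordan_block m 0) (ue i) (x n) = 0"
      using bf_jordan_block_left[OF i, of 0 "x n"] by auto
  qed
  finally show False using nz by simp
qed

text \<open>If n < m, then \<open>x 1\<close> is a multiple of the first unit vector and
  \<open>x n\<close> lives on the first n coordinates, where the first row of C is 0. If n > m, the
  coordinate \<open>x 1 0\<close> travels to \<open>x m (m - 1)\<close>, and the next link forces
  that to be 0.\<close>

lemma has_root_root_form:
  fixes C :: "'a :: field mat"
  assumes C: "root_form m C" and "has_root n C" and low: "\<And>p. Suc p < m \<Longrightarrow> C $$ (0,p) = 0"
  shows "n = m"
proof (rule ccontr)
  assume nm: "n \<noteq> m"
  have Cc: "C \<in> carrier_mat m m" using C unfolding root_form_def by auto
  obtain x where x: "chain C 1 n x" and nz: "bf C (x 1) (x n) \<noteq> 0" using assms(2) unfolding has_root_def by blast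
  have u: "upper_rel m 1 1 n x" using x chain_root_form_iff[OF C] by simp
  have n1: "1 \<le> n" using nz chain_0[OF x] by (cases n) auto
  have s1: "x 1 i = 0" if "i < m" "1 \<le> i" for i using upper_rel_support[OF u n1 that] .
  have e: "bf C (x 1) (x n) = (\<Sum>i<m. x 1 i * bf C (ue i) (x n))" using bf_expand_left[of C "x 1" "x n"] Cc by simp
  also have "\<dots> = (\<Sum>i<m. if i = 0 then x 1 0 * bf C (ue 0) (x n) else 0)"
    using s1 by (intro sum.cong) auto
  also have "\<dots> = (if 0 < m then x 1 0 * bf C (ue 0) (x n) else 0)" by simp
  finally have m: "0 < m" and nz': "x 1 0 \<noteq> 0" "bf C (ue 0) (x n) \<noteq> 0" using nz by (auto split: if_splits)
  show False
  proof (cases "n < m")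
    case True
    have "bf C (ue 0) (x n) = (\<Sum>p<m. x n p * C $$ (0,p))"
      using bf_expand_right[of C "ue 0" "x n"] Cc m by (simp add: bf_ue_ue)
    also have "\<dots> = 0"
    proof (rule sum.neutral, rule ballI)
      fix p assume "p \<in> {..<m}"
      then have p: "p < m" by simp
      show "x n p * C $$ (0,p) = 0"
        using upper_rel_support[OF u _ p] low[of p] True p by (cases "n \<le> p") auto
    qed
    finally show False using nz' by simp
  next
    case False
    then have mn: "m < n" using nm by simp
    have "x (Suc s) s = x 1 0" if "s < m" for s
      using that
    proof (induct s)
      case (Suc s)
      then show ?case using upper_rel_D[OF u, of "Suc s" s] mn by simp
    qed simp
    from this[of "m - 1"] have "x m (m - 1) = x 1 0" using m by simp
    moreover have "x m (m - 1) = 0" using upper_rel_D[OF u mn, of "m - 1"] m by simp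
    ultimately show False using nz' by simp
  qed
qed

context alg_closed_char_2
begin

text \<open>The two halves of a chain are chains as well, and each half is isotropic because the
  diagonal blocks are 0. The leading entry is thus a sum of two cross terms, which are equal by
  \<open>chain_leading_sym\<close> and cancel in characteristic 2.\<close>

lemma not_has_root_pair_block:
  fixes mu :: 'a
  shows "\<not> has_root n (four_block_mat (0\<^sub>m m m) (1\<^sub>m m) (jordan_block m mu) (0\<^sub>m m m))"
proof
  let ?J = "jordan_block m mu"
  let ?F = "four_block_mat (0\<^sub>m m m) (1\<^sub>m m) ?J (0\<^sub>m m m)"
  have J: "?J \<in> carrier_mat m m" and I: "1\<^sub>m m \<in> carrier_mat m m" by auto
  assume "has_root n ?F"
  then obtain x where x: "chain ?F 1 n x" and nz: "bf ?F (x 1) (x n) \<noteq> 0" unfolding has_root_def by blast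
  have n1: "1 \<le> n" using nz chain_0[OF x] by (cases n) auto
  have hi: "bf M (\<lambda>i. if i < m then 0 else u i) w = 0" "bf M w (\<lambda>i. if i < m then 0 else u i) = 0"
    if "M \<in> carrier_mat m m" for M :: "'a mat" and u w
    using that bf_cong[of M "\<lambda>i. if i < m then 0 else u i" "\<lambda>_. 0" w w]
      bf_cong[of M w w "\<lambda>i. if i < m then 0 else u i" "\<lambda>_. 0"] by auto
  have lo: "bf M (\<lambda>i. if i < m then u i else 0) w = bf M u w" "bf M w (\<lambda>i. if i < m then u i else 0) = bf M w u"
    if "M \<in> carrier_mat m m" for M :: "'a mat" and u w
    using that by (auto intro!: bf_cong)
  have slo: "(\<lambda>i. if i + m < m then u (i + m) else 0) = (\<lambda>_. 0 :: 'a)" for u by auto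
  have shi: "(\<lambda>i. if i + m < m then 0 else u (i + m)) = (\<lambda>i. u (i + m) :: 'a)" for u by auto
  let ?p = "\<lambda>j i. if i < m then x j i else 0"
  let ?q = "\<lambda>j i. if i < m then 0 else x j i"
  have F: "bf ?F u w = bf (1\<^sub>m m) u (\<lambda>i. w (i + m)) + bf ?J (\<lambda>i. u (i + m)) w" for u w
    by (rule bf_antidiag[OF I J])
  have p: "chain ?F 1 n ?p"
    unfolding chain_def
  proof (intro conjI allI impI)
    show "?p 0 = (\<lambda>_. 0)" by (intro ext) (simp add: chain_0[OF x])
    fix j w assume j: "j < n"
    show "bf ?F w (?p (Suc j)) = 1 * bf ?F (?p (Suc j)) w + bf ?F (?p j) w"
      using chain_1D[OF x j, of "\<lambda>i. if i < m then 0 else w i"] unfolding F slo shi hi[OF I] hi[OF J] lo[OF I] lo[OF J]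
      by simp
  qed
  have q: "chain ?F 1 n ?q"
    unfolding chain_def
  proof (intro conjI allI impI)
    show "?q 0 = (\<lambda>_. 0)" by (intro ext) (simp add: chain_0[OF x])
    fix j w assume j: "j < n"
    show "bf ?F w (?q (Suc j)) = 1 * bf ?F (?q (Suc j)) w + bf ?F (?q j) w"
      using chain_1D[OF x j, of "\<lambda>i. if i < m then w i else 0"] unfolding F slo shi hi[OF I] hi[OF J] lo[OF I] lo[OF J]
      by simp
  qed
  have "bf ?F (x 1) (x n) = bf ?F (?p 1) (?q n) + bf ?F (?q 1) (?p n)"
    unfolding F slo shi hi[OF I] hi[OF J] lo[OF I] lo[OF J] by simp
  also have "\<dots> = 0" using chain_leading_sym[OF p q n1] add_self by simp
  finally show False using nz by simp
qed

text \<open>A root block may be replaced by a congruent root form, whose standard basis is a chain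
  with nonzero corner and whose first row is 0 before that corner.\<close>

lemma has_root_block:
  fixes R :: "nat \<Rightarrow> 'a mat"
  assumes R: "valid_root_choice R" and ok: "block_ok b"
  shows "has_root n (block_mat R b) \<longleftrightarrow> b = BRoot n"
proof (cases b)
  case (BJ0 m)
  then show ?thesis using not_has_root_jordan_zero by simp
next
  case (BPair m mu)
  then show ?thesis using not_has_root_pair_block by simp
next
  case (BRoot m)
  then have m: "odd m" using ok by simp
  have m1: "1 \<le> m" using m by (cases m) auto
  have Rm: "R m \<in> carrier_mat m m" "invertible_mat (R m)" "similar_mat (cosquare (R m)) (jordan_block m 1)"
    using R m unfolding valid_root_choice_def by auto
  obtain C where C: "congruent_mat (R m) C" "root_form m C" using congruent_root_form[OF Rm] by blast
  have eq: "has_root n (R m) \<longleftrightarrow> has_root n C"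
    using has_root_congruent[OF C(1)] has_root_congruent[OF congruent_mat_sym[OF C(1)]] by blast
  have Cc: "C \<in> carrier_mat m m" "C = transpose_mat C * jordan_block m 1" using C(2) unfolding root_form_def by auto
  note ch = chain_std[OF Cc]
  have low: "C $$ (0,p) = 0" if "Suc p < m" for p
  proof -
    have "bf C (std_chain m 1) (std_chain m (Suc p)) = 0"
      using pair_rel_vanish_below[OF chain_pair_rel[OF ch ch]] that m1 unfolding vanish_below_def by auto
    then show ?thesis using that m1 Cc(1) by (simp add: std_chain_def bf_ue_ue)
  qed
  have "has_root m C" unfolding has_root_def using ch root_form_corner[OF C(2) m1] by blast
  then have "has_root n C \<longleftrightarrow> n = m" using has_root_root_form[OF C(2) _ low] by blast
  then show ?thesis using BRoot eq by auto
qed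

lemma cdim_root_block:
  fixes R :: "nat \<Rightarrow> 'a mat"
  assumes R: "valid_root_choice R" and m: "odd m"
  shows "cdim (R m) l k False = (if l = 1 then min k m else 0)"
proof -
  have Rm: "R m \<in> carrier_mat m m" "invertible_mat (R m)" "similar_mat (cosquare (R m)) (jordan_block m 1)"
    using R m unfolding valid_root_choice_def by auto
  obtain C where C: "congruent_mat (R m) C" "root_form m C" using congruent_root_form[OF Rm] by blast
  show ?thesis using cdim_congruent[OF C(1)] cdim_root_form[OF C(2)] by simp
qed

end

section \<open>Uniqueness\<close>

text \<open>As sets, the classes of l and its inverse become equal, so matching blocks up to
  \<open>block_equiv\<close> reduces to an equality of multisets.\<close>

fun block_class :: "'a :: field cblock \<Rightarrow> 'a cblock set" where
  "block_class (BJ0 n) = {BJ0 n}"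
| "block_class (BPair n l) = {BPair n l, BPair n (inverse l)}"
| "block_class (BRoot n) = {BRoot n}"

lemma block_class_imp_equiv: "block_class b = block_class c \<Longrightarrow> block_equiv b c"
  by (cases b; cases c) (auto simp: doubleton_eq_iff)

lemma exists_matching_perm:
  assumes "image_mset f (mset bs) = image_mset f (mset cs)"
  shows "\<exists>ps. mset ps = mset bs \<and> list_all2 (\<lambda>b c. f b = f c) ps cs"
  using assms
proof (induct cs arbitrary: bs)
  case Nil
  then show ?case by simp
next
  case (Cons c cs)
  then have "f c \<in># image_mset f (mset bs)" by simp
  then obtain b where b: "b \<in># mset bs" "f b = f c" by auto
  obtain M where M: "mset bs = add_mset b M" using b(1) by (blast dest: multi_member_split)
  obtain bs' where bs': "mset bs' = M" using ex_mset by blast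
  have "image_mset f (mset bs') = image_mset f (mset cs)" using Cons.prems M bs' b by simp
  from Cons.hyps[OF this] obtain ps where "mset ps = mset bs'" "list_all2 (\<lambda>b c. f b = f c) ps cs" by blast
  then show ?case using M bs' b by (intro exI[of _ "b # ps"]) simp
qed

section \<open>Counting blocks by differences of dimensions\<close>

lemma count_image_mset_sum: "count (image_mset f M) X = (\<Sum>b\<in>#M. if f b = X then 1 else 0)"
  by (induct M) auto

lemma sum_mset_if_filter:
  "(\<Sum>b\<in>#M. if P b then f b else 0) = (\<Sum>b\<in>#filter_mset P M. f b :: nat)"
  by (induct M) auto

lemma sum_mset_indicator: "(\<Sum>b\<in>#M. if b = c then 1 else 0 :: nat) = count M c"
  by (induct M) auto

lemma sum_mset_two_mult: "(\<Sum>b\<in>#M. 2 * f b) = 2 * (\<Sum>b\<in>#M. f b :: nat)"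
  by (induct M) auto

lemma sum_mset_difference:
  fixes G H E :: "'b \<Rightarrow> nat"
  assumes "\<And>b. b \<in># M + N \<Longrightarrow> G b = H b + E b"
    and "(\<Sum>b\<in>#M. G b) = (\<Sum>b\<in>#N. G b)" "(\<Sum>b\<in>#M. H b) = (\<Sum>b\<in>#N. H b)"
  shows "(\<Sum>b\<in>#M. E b) = (\<Sum>b\<in>#N. E b)"
proof -
  have "(\<Sum>b\<in>#M. G b) = (\<Sum>b\<in>#M. H b + E b)" "(\<Sum>b\<in>#N. G b) = (\<Sum>b\<in>#N. H b + E b)"
    using assms(1) by (auto intro!: arg_cong[of _ _ sum_mset] image_mset_cong)
  then show ?thesis using assms(2,3) by (simp add: sum_mset.distrib)
qed

text \<open>The difference is stated additively to avoid truncated subtraction.\<close>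

lemma sum_mset_second_difference:
  fixes G0 G1 G2 E :: "'b \<Rightarrow> nat"
  assumes "\<And>b. b \<in># M + N \<Longrightarrow> 2 * G1 b = G0 b + G2 b + E b"
    and "(\<Sum>b\<in>#M. G0 b) = (\<Sum>b\<in>#N. G0 b)" "(\<Sum>b\<in>#M. G1 b) = (\<Sum>b\<in>#N. G1 b)" "(\<Sum>b\<in>#M. G2 b) = (\<Sum>b\<in>#N. G2 b)"
  shows "(\<Sum>b\<in>#M. E b) = (\<Sum>b\<in>#N. E b)"
proof -
  have *: "2 * (\<Sum>b\<in>#K. G1 b) = (\<Sum>b\<in>#K. G0 b) + (\<Sum>b\<in>#K. G2 b) + (\<Sum>b\<in>#K. E b)"
    if "\<And>b. b \<in># K \<Longrightarrow> 2 * G1 b = G0 b + G2 b + E b" for K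
    using that
  proof (induct K)
    case (add b K)
    have "2 * G1 b = G0 b + G2 b + E b" using add.prems by simp
    moreover have "2 * (\<Sum>b\<in>#K. G1 b) = (\<Sum>b\<in>#K. G0 b) + (\<Sum>b\<in>#K. G2 b) + (\<Sum>b\<in>#K. E b)"
      by (rule add.hyps) (rule add.prems, simp)
    ultimately show ?case by simp
  qed simp
  have "2 * (\<Sum>b\<in>#M. G1 b) = (\<Sum>b\<in>#M. G0 b) + (\<Sum>b\<in>#M. G2 b) + (\<Sum>b\<in>#M. E b)"
    by (rule *, rule assms(1)) simp
  moreover have "2 * (\<Sum>b\<in>#N. G1 b) = (\<Sum>b\<in>#N. G0 b) + (\<Sum>b\<in>#N. G2 b) + (\<Sum>b\<in>#N. E b)"
    by (rule *, rule assms(1)) simp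
  ultimately show ?thesis using assms(2-4) by linarith
qed

text \<open>A block of size c contributes min k c to a dimension, and as a function of k this bends
  only at k = c; hence second differences count the blocks of one size.\<close>

lemma min_second_difference:
  "2 * min (h + 1) c = min h c + min (h + 2) c + (if c = h + 1 then 1 else 0 :: nat)"
  by (cases c "h + 1" rule: linorder_cases) (simp_all add: min_def)

definition is_J0 :: "'a cblock \<Rightarrow> bool" where
  "is_J0 b \<longleftrightarrow> (\<exists>n. b = BJ0 n)"

context alg_closed_char_2
begin

lemma canonical_form_unique:
  fixes R :: "nat \<Rightarrow> 'a mat"
  assumes R: "valid_root_choice R" and bs: "admissible bs" and cs: "admissible cs"
    and Abs: "congruent_mat A (direct_sum R bs)" and Acs: "congruent_mat A (direct_sum R cs)"
  shows "\<exists>ps. mset ps = mset bs \<and> list_all2 block_equiv ps cs"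
proof -
  let ?M = "mset bs"
  let ?N = "mset cs"
  have okbs: "\<forall>b\<in>set bs. block_ok b" and okcs: "\<forall>b\<in>set cs. block_ok b"
    using bs cs unfolding admissible_def by auto
  have ok: "block_ok b" if "b \<in># ?M + ?N" for b using that okbs okcs by auto
  define g where "g = (\<lambda>l k f b. cdim (block_mat R b) l k f)"
  have sum_eq: "(\<Sum>b\<in>#?M. g l k f b) = (\<Sum>b\<in>#?N. g l k f b)" for l k f
    using cdim_congruent[OF Abs, of l k f] cdim_congruent[OF Acs, of l k f]
      cdim_direct_sum[OF R okbs, of l k f] cdim_direct_sum[OF R okcs, of l k f] unfolding g_def by simp
  have gJ: "g 0 k False (BJ0 n) = min k ((n + 1) div 2)" "g 0 k True (BJ0 n) = (if odd n \<and> n < 2 * k then 1 else 0)"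
    if "1 \<le> n" for n k using cdim_jordan_zero[OF that, where 'a = 'a] unfolding g_def by auto
  have gP: "g l k False (BPair n mu) = (if l = mu then min k n else 0) + (if l * mu = 1 then min k n else 0)"
    if "mu \<noteq> 0" for l k n mu using cdim_pair_block[OF that] unfolding g_def by simp
  have gR: "g l k False (BRoot n) = (if l = 1 then min k n else 0)" if "odd n" for l k n
    using cdim_root_block[OF R that] unfolding g_def by simp
  have g0: "g 0 k f b = 0" if b: "block_ok b" "\<not> is_J0 b" for k f b
  proof (cases b)
    case (BJ0 n)
    then show ?thesis using b unfolding is_J0_def by simp
  next
    case (BPair n mu)
    then have "mu \<noteq> 0" using b by simp
    then show ?thesis
      unfolding g_def BPair block_mat.simps by (intro cdim_nonsingular[OF pair_block_carrier pair_block_invertible])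
  next
    case (BRoot n)
    then show ?thesis using b R cdim_nonsingular[of "R n" n] unfolding g_def valid_root_choice_def by simp
  qed
  \<comment> \<open>The flagged dimension of a nilpotent block jumps between h and h + 1 exactly for
    the size 2 * h + 1.\<close>
  have odd_J: "count ?M (BJ0 (2 * h + 1)) = count ?N (BJ0 (2 * h + 1))" for h
  proof -
    have "(\<Sum>b\<in>#?M. if b = BJ0 (2 * h + 1) then 1 else 0 :: nat) = (\<Sum>b\<in>#?N. if b = BJ0 (2 * h + 1) then 1 else 0)"
    proof (rule sum_mset_difference[OF _ sum_eq[of 0 "h + 1" True] sum_eq[of 0 h True]])
      fix b assume "b \<in># ?M + ?N"
      then have b: "block_ok b" by (rule ok)
      show "g 0 (h + 1) True b = g 0 h True b + (if b = BJ0 (2 * h + 1) then 1 else 0)"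
      proof (cases "is_J0 b")
        case True
        then obtain n where n: "b = BJ0 n" "1 \<le> n" using b unfolding is_J0_def by auto
        show ?thesis unfolding n(1) gJ[OF n(2)] by (auto elim!: oddE)
      next
        case False
        then show ?thesis using g0[OF b False] by (auto simp: is_J0_def)
      qed
    qed
    then show ?thesis unfolding sum_mset_indicator .
  qed
  \<comment> \<open>Unflagged dimensions count the sizes 2 * h + 1 and 2 * h + 2 together, so the
    odd sizes have to be known before.\<close>
  have even_J: "count ?M (BJ0 (2 * h + 2)) = count ?N (BJ0 (2 * h + 2))" for h
  proof -
    have "(\<Sum>b\<in>#?M. (if b = BJ0 (2 * h + 1) then 1 else 0) + (if b = BJ0 (2 * h + 2) then 1 else 0) :: nat) =
      (\<Sum>b\<in>#?N. (if b = BJ0 (2 * h + 1) then 1 else 0) + (if b = BJ0 (2 * h + 2) then 1 else 0))"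
    proof (rule sum_mset_second_difference[OF _ sum_eq[of 0 h False] sum_eq[of 0 "h + 1" False] sum_eq[of 0 "h + 2" False]])
      fix b assume "b \<in># ?M + ?N"
      then have b: "block_ok b" by (rule ok)
      show "2 * g 0 (h + 1) False b = g 0 h False b + g 0 (h + 2) False b +
        ((if b = BJ0 (2 * h + 1) then 1 else 0) + (if b = BJ0 (2 * h + 2) then 1 else 0))"
      proof (cases "is_J0 b")
        case True
        then obtain n where n: "b = BJ0 n" "1 \<le> n" using b unfolding is_J0_def by auto
        have "(n + 1) div 2 = h + 1 \<longleftrightarrow> n = 2 * h + 1 \<or> n = 2 * h + 2" by auto
        then show ?thesis unfolding n(1) gJ[OF n(2)] min_second_difference by auto
      next
        case False
        then show ?thesis using g0[OF b False] by (auto simp: is_J0_def)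
      qed
    qed
    then show ?thesis unfolding sum_mset.distrib sum_mset_indicator using odd_J[of h] by simp
  qed
  have all_J: "count ?M (BJ0 n) = count ?N (BJ0 n)" for n
  proof (cases "n = 0")
    case True
    then have "\<not> BJ0 n \<in># ?M" "\<not> BJ0 n \<in># ?N" using okbs okcs by fastforce+
    then show ?thesis by (metis not_in_iff)
  next
    case False
    show ?thesis
    proof (cases "odd n")
      case True
      then show ?thesis using odd_J by (auto elim!: oddE)
    next
      case F: False
      then have "n = 2 * ((n - 2) div 2) + 2" using False by (auto elim!: evenE)
      then show ?thesis using even_J[of "(n - 2) div 2"] by simp
    qed
  qed
  have filtJ: "filter_mset is_J0 ?M = filter_mset is_J0 ?N"
    by (rule multiset_eqI) (use all_J in \<open>auto simp: is_J0_def\<close>)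
  \<comment> \<open>The dimensions of nilpotent blocks at l \<noteq> 0 are never computed: these
    blocks are already the same on both sides and can be removed.\<close>
  have sum_N: "(\<Sum>b\<in>#?M. if is_J0 b then 0 else g l k f b) = (\<Sum>b\<in>#?N. if is_J0 b then 0 else g l k f b)" for l k f
  proof (rule sum_mset_difference[OF _ sum_eq[of l k f]])
    show "g l k f b = (if is_J0 b then g l k f b else 0) + (if is_J0 b then 0 else g l k f b)" for b by simp
    show "(\<Sum>b\<in>#?M. if is_J0 b then g l k f b else 0) = (\<Sum>b\<in>#?N. if is_J0 b then g l k f b else 0)"
      unfolding sum_mset_if_filter filtJ ..
  qed
  \<comment> \<open>The second difference of the dimensions of a block at size n. A pair can
    contribute through l = mu and through l * mu = 1, and does both for mu = l = 1.\<close>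
  define E :: "'a \<Rightarrow> nat \<Rightarrow> 'a cblock \<Rightarrow> nat" where "E = (\<lambda>l n b. case b of BJ0 _ \<Rightarrow> 0
    | BPair n' mu \<Rightarrow> if n' = n then (if l = mu then 1 else 0) + (if l * mu = 1 then 1 else 0) else 0
    | BRoot n' \<Rightarrow> if n' = n \<and> l = 1 then 1 else 0)"
  have sum_E: "(\<Sum>b\<in>#?M. E l n b) = (\<Sum>b\<in>#?N. E l n b)" if n: "1 \<le> n" for l n
  proof -
    obtain h where h: "n = h + 1" using n by (metis add.commute le_Suc_ex)
    note mm = min_second_difference[of h]
    show ?thesis
    proof (rule sum_mset_second_difference[OF _ sum_N[of l h False] sum_N[of l "h + 1" False] sum_N[of l "h + 2" False]])
      fix b assume "b \<in># ?M + ?N"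
      then have b: "block_ok b" by (rule ok)
      show "2 * (if is_J0 b then 0 else g l (h + 1) False b) =
        (if is_J0 b then 0 else g l h False b) + (if is_J0 b then 0 else g l (h + 2) False b) + E l n b"
      proof (cases b)
        case (BJ0 n')
        then show ?thesis by (simp add: is_J0_def E_def)
      next
        case (BPair n' mu)
        then have mu: "mu \<noteq> 0" using b by simp
        have "\<not> is_J0 b" using BPair by (simp add: is_J0_def)
        then show ?thesis unfolding BPair E_def h using gP[OF mu] mm[of n'] by simp
      next
        case (BRoot n')
        then have o: "odd n'" using b by simp
        have "\<not> is_J0 b" using BRoot by (simp add: is_J0_def)
        then show ?thesis unfolding BRoot E_def h using gR[OF o] mm[of n'] by simp
      qed
    qed
  qed
  have roots: "BRoot n \<in> set bs \<longleftrightarrow> BRoot n \<in> set cs" for n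
  proof -
    have "has_root n (direct_sum R bs) \<longleftrightarrow> has_root n (direct_sum R cs)"
      using has_root_congruent[OF congruent_mat_trans[OF congruent_mat_sym[OF Abs] Acs]]
        has_root_congruent[OF congruent_mat_trans[OF congruent_mat_sym[OF Acs] Abs]] by blast
    moreover have "has_root n (direct_sum R ds) \<longleftrightarrow> BRoot n \<in> set ds" if ds: "\<forall>b\<in>set ds. block_ok b" for ds
    proof -
      have "(\<exists>b\<in>set ds. has_root n (block_mat R b)) \<longleftrightarrow> (\<exists>b\<in>set ds. b = BRoot n)"
        by (rule bex_cong[OF refl], rule has_root_block[OF R]) (use ds in simp)
      then show ?thesis unfolding has_root_direct_sum[OF R ds] by simp
    qed
    ultimately show ?thesis using okbs okcs by simp
  qed
  have sum_one: "(\<Sum>b\<in>#K. E 1 n b) = 2 * count K (BPair n 1) + count K (BRoot n)" for n and K :: "'a cblock multiset"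
  proof -
    have "E 1 n b = 2 * (if b = BPair n 1 then 1 else 0) + (if b = BRoot n then 1 else 0)" for b
      unfolding E_def by (cases b) auto
    then have "(\<Sum>b\<in>#K. E 1 n b) = (\<Sum>b\<in>#K. 2 * (if b = BPair n 1 then 1 else 0) + (if b = BRoot n then 1 else 0))"
      by simp
    also have "\<dots> = 2 * count K (BPair n 1) + count K (BRoot n)"
      by (simp only: sum_mset.distrib sum_mset_two_mult sum_mset_indicator)
    finally show ?thesis .
  qed
  have one: "count ?M (BPair n 1) = count ?N (BPair n 1) \<and> count ?M (BRoot n) = count ?N (BRoot n)"
    if n: "1 \<le> n" for n
  proof -
    have e: "2 * count ?M (BPair n 1) + count ?M (BRoot n) = 2 * count ?N (BPair n 1) + count ?N (BRoot n)"
      using sum_E[OF n, of 1] unfolding sum_one .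
    show ?thesis
    proof (cases "BRoot n \<in> set bs")
      case True
      then have "odd n" using okbs by fastforce
      then have "BPair n 1 \<notin> set bs" "BPair n 1 \<notin> set cs" using True roots bs cs unfolding admissible_def by auto
      then have "count ?M (BPair n 1) = 0" "count ?N (BPair n 1) = 0" by (simp_all add: count_eq_zero_iff)
      then show ?thesis using e by linarith
    next
      case False
      then have "count ?M (BRoot n) = 0" "count ?N (BRoot n) = 0" using roots by (simp_all add: count_eq_zero_iff)
      then show ?thesis using e by linarith
    qed
  qed
  have "image_mset block_class ?M = image_mset block_class ?N"
  proof (rule multiset_eqI)
    fix X
    show "count (image_mset block_class ?M) X = count (image_mset block_class ?N) X"
    proof (cases "\<exists>b. block_ok b \<and> X = block_class b")
      case False
      have "X \<notin># image_mset block_class ?M" "X \<notin># image_mset block_class ?N" using False okbs okcs by auto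
      then show ?thesis by (metis not_in_iff)
    next
      case True
      then obtain b where b: "block_ok b" "X = block_class b" by blast
      have single: "count (image_mset block_class K) X = count K b" if "\<And>c. block_class c = X \<longleftrightarrow> c = b" for K
        unfolding count_image_mset_sum that by (rule sum_mset_indicator)
      show ?thesis
      proof (cases b)
        case (BJ0 n)
        have "block_class c = X \<longleftrightarrow> c = b" for c unfolding b(2) BJ0 by (cases c) (auto simp: doubleton_eq_iff)
        then show ?thesis using single all_J BJ0 by simp
      next
        case (BRoot n)
        have "block_class c = X \<longleftrightarrow> c = b" for c unfolding b(2) BRoot by (cases c) (auto simp: doubleton_eq_iff)
        moreover have "1 \<le> n" using b BRoot by (cases n) auto
        ultimately show ?thesis using single one BRoot by simp
      next
        case (BPair n l)
        then have l: "l \<noteq> 0" "1 \<le> n" using b by auto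
        show ?thesis
        proof (cases "l = 1")
          case True
          have "block_class c = X \<longleftrightarrow> c = b" for c
            unfolding b(2) BPair True by (cases c) (auto simp: doubleton_eq_iff)
          then show ?thesis using single one[OF l(2)] BPair True by simp
        next
          case False
          have inv: "l * mu = 1 \<longleftrightarrow> mu = inverse l" for mu using l by (auto simp: field_simps)
          have ll: "l * l \<noteq> 1"
          proof
            assume "l * l = 1"
            then have "(l - 1) * (l + 1) = 0" by (simp add: algebra_simps)
            then have "l = 1 \<or> l + 1 = 0" by simp
            then show False using False eq_if_add_zero by blast
          qed
          \<comment> \<open>As l * l \<noteq> 1, the two contributions of a pair exclude each other,
            and every block of the class is counted once.\<close>
          have "(if block_class c = X then 1 else 0) = E l n c" for c
          proof (cases c)
            case (BPair n' mu)
            show ?thesis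
              unfolding b(2) \<open>b = BPair n l\<close> BPair E_def using ll inv[of mu] inv[of l]
              by (auto simp: doubleton_eq_iff)
          qed (use False in \<open>auto simp: b(2) BPair E_def doubleton_eq_iff\<close>)
          then have "count (image_mset block_class K) X = (\<Sum>c\<in>#K. E l n c)" for K
            unfolding count_image_mset_sum by simp
          then show ?thesis using sum_E[OF l(2)] by simp
        qed
      qed
    qed
  qed
  from exists_matching_perm[OF this] obtain ps where ps: "mset ps = mset bs"
    "list_all2 (\<lambda>b c. block_class b = block_class c) ps cs" by blast
  have "list_all2 block_equiv ps cs"
    using ps(2) by (rule list_all2_mono) (rule block_class_imp_equiv)
  then show ?thesis using ps(1) by blast
qed

end

theorem theorem2p1:
  assumes "CHAR('a :: alg_closed_field) = 2"
  shows
    "(\<forall>n. odd n \<longrightarrow> (\<exists>C \<in> carrier_mat n n. invertible_mat C \<and> cosquare C = (jordan_block n (1::'a))))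
   \<and> (\<forall>n. odd n \<longrightarrow> invertible_mat (Gamma' n :: 'a mat) \<and>
          similar_mat (cosquare (Gamma' n :: 'a mat)) (jordan_block n 1))
   \<and> (\<forall>n (C::'a mat) D. odd n \<and> C \<in> carrier_mat n n \<and> D \<in> carrier_mat n n \<and>
          invertible_mat C \<and> invertible_mat D \<and>
          similar_mat (cosquare C) (jordan_block n 1) \<and> similar_mat (cosquare D) (jordan_block n 1)
          \<longrightarrow> congruent_mat C D)
   \<and> (\<forall>R :: nat \<Rightarrow> 'a mat. valid_root_choice R \<longrightarrow>
        (\<forall>m (A::'a mat). A \<in> carrier_mat m m \<longrightarrow>
            (\<exists>bs. admissible bs \<and> congruent_mat A (direct_sum R bs)))
      \<and> (\<forall>(A::'a mat) bs cs. admissible bs \<and> admissible cs \<and>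
            congruent_mat A (direct_sum R bs) \<and> congruent_mat A (direct_sum R cs) \<longrightarrow>
            (\<exists>ps. mset ps = mset bs \<and> list_all2 block_equiv ps cs)))"
proof -
  have "(2 :: 'a) = 0" using of_nat_CHAR[where 'a = 'a] assms by simp
  then have "c + c = 0" for c :: 'a by (metis mult_2 mult_zero_left)
  then interpret alg_closed_char_2 "TYPE('a)" by unfold_locales
  show ?thesis
  proof (intro conjI allI impI)
    show "\<exists>C \<in> carrier_mat n n. invertible_mat C \<and> cosquare C = jordan_block n (1 :: 'a)" if "odd n" for n
      using exists_root_form[OF that] root_form_cosquare unfolding root_form_def by blast
    show "invertible_mat (Gamma' n :: 'a mat)" if "odd n" for n by (rule Gamma'_invertible[OF that])
    show "similar_mat (cosquare (Gamma' n :: 'a mat)) (jordan_block n 1)" if "odd n" for n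
      by (rule Gamma'_cosquare_similar[OF that])
    show "congruent_mat C D" if "odd n \<and> C \<in> carrier_mat n n \<and> D \<in> carrier_mat n n \<and>
          invertible_mat C \<and> invertible_mat D \<and>
          similar_mat (cosquare C) (jordan_block n 1) \<and> similar_mat (cosquare D) (jordan_block n 1)"
      for n and C D :: "'a mat" using that congruent_if_cosquare_similar by blast
    show "\<exists>bs. admissible bs \<and> congruent_mat A (direct_sum R bs)"
      if "valid_root_choice R" "A \<in> carrier_mat m m" for R m and A :: "'a mat"
      by (rule exists_canonical_form[OF that])
    show "\<exists>ps. mset ps = mset bs \<and> list_all2 block_equiv ps cs"
      if "valid_root_choice R" "admissible bs \<and> admissible cs \<and>
            congruent_mat A (direct_sum R bs) \<and> congruent_mat A (direct_sum R cs)"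
      for R and A :: "'a mat" and bs cs
      using that canonical_form_unique by blast
  qed
qed

end
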